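(* Let $W$ be a strongly uniform $\omega$-Stone space. Then $W$ is determined up to homeomorphism by the isomorphism type of the pair $(K(W),r_W)$: if $X$ is another strongly uniform $\omega$-Stone space with $(K(X),r_X)\cong(K(W),r_W)$ then $X\cong W$. Moreover, the map $W\mapsto(K(W),r_W)$ induces a bijection between homeomorphism classes of strongly uniform $\omega$-Stone spaces and isomorphism classes of pairs $(K,r)$, where $K\in\{\mathscr{D}_0,\mathscr{D}_1\}$ and $r\colon K\to\omega_1$ is upper semi-continuous.
   Context: An $\omega$-Stone space is a locally compact metrisable totally disconnected Hausdorff space. $\mathscr{D}_1$ is the Cantor set, $\mathscr{D}_0$ the Cantor set minus a point, $\omega_1$ the countable ordinals; $r$ is upper semi-continuous if $\{x\mid r(x)\geqslant\xi\}$ is closed for all $\xi$. For $S\subseteq W$, $S'$ is the derived set; $W^{(0)}=W$, $W^{(\xi+1)}=(W^{(\xi)})'$, $W^{(\eta)}=\bigcap_{\xi<\eta}W^{(\xi)}$ for limit $\eta$; $W^{[\xi]}=W^{(\xi)}-W^{(\xi+1)}$; $\nu(W)=\min\{\xi\mid W^{(\xi)}=W^{(\xi+1)}\}$; $K(W)=W^{(\nu(W))}$; $\lambda(W)=\min\{\xi\mid W^{(\xi)}-K(W)\text{ closed}\}$; $r_W(x)=\min\{\xi\mid x\notin\overline{W^{(\xi)}-K(W)}\}$ for $x\in K(W)$; $K_\xi(W)=\{w\in K(W)\mid r_W(w)>\xi\}$; $\rho(W)=\min\{\xi\mid\overline{W^{[\xi]}}\text{ compact}\}$; $\rho_U(W)=\min\{\xi\mid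 K_\xi(W)\text{ compact}\}$. $W$ is uniform if $\nu(W)=\lambda(W)$ and strongly uniform if moreover $\rho_U(W)=\rho(W)$. $(U,r)\cong(V,s)$ means there is a homeomorphism $\phi\colon U\to V$ with $s(\phi(u))=r(u)$ for all $u\in U$.
   Formalization: ω-Stone spaces are taken to be second countable, and the bijection is for nonempty spaces; otherwise the claim fails, e.g. for the product of the Cantor set with an uncountable discrete space, or for the empty space. *)

theory Defs
  imports "HOL-Analysis.Analysis"
begin

subsection \<open>The countable ordinals\<close>

text \<open>The points of the type below are the elements of the first uncountable cardinal, ordered
  by its well-order; thus they are the ordinals below \<open>\<omega>\<^sub>1\<close>.\<close>

typedef omega1 = "Field (cardSuc natLeq)"
proof -
  have "infinite (Field (cardSuc natLeq))"
    using cardSuc_finite[OF natLeq_Card_order] Field_natLeq by simp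
  then show ?thesis
    by (metis all_not_in_conv finite.emptyI)
qed

lemma Well_order_cardSuc_natLeq: "Well_order (cardSuc natLeq)"
  using cardSuc_Card_order[OF natLeq_Card_order] card_order_on_well_order_on by blast

instantiation omega1 :: ord
begin

definition less_eq_omega1 :: "omega1 \<Rightarrow> omega1 \<Rightarrow> bool"
  where "\<xi> \<le> \<eta> \<longleftrightarrow> (Rep_omega1 \<xi>, Rep_omega1 \<eta>) \<in> cardSuc natLeq"

definition less_omega1 :: "omega1 \<Rightarrow> omega1 \<Rightarrow> bool"
  where "(\<xi>::omega1) < \<eta> \<longleftrightarrow> \<xi> \<le> \<eta> \<and> \<xi> \<noteq> \<eta>"

instance ..

end

instance omega1 :: wellorder
proof
  let ?r = "cardSuc natLeq"
  have lin: "Linear_order ?r" and wf: "wf (?r - Id)"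
    using Well_order_cardSuc_natLeq by (auto simp: well_order_on_def)
  have refl: "refl_on (Field ?r) ?r" and tr: "trans ?r" and anti: "antisym ?r"
    and tot: "total_on (Field ?r) ?r"
    using lin by (auto simp: order_on_defs)
  fix x y z :: omega1
  show "x \<le> x"
    using refl Rep_omega1[of x] by (simp add: less_eq_omega1_def refl_on_def)
  show "x \<le> y \<Longrightarrow> y \<le> z \<Longrightarrow> x \<le> z"
    using tr unfolding less_eq_omega1_def trans_def by blast
  show eq: "x \<le> y \<Longrightarrow> y \<le> x \<Longrightarrow> x = y" for x y :: omega1
    using anti unfolding less_eq_omega1_def antisym_def by (metis Rep_omega1_inject)
  show "x < y \<longleftrightarrow> x \<le> y \<and> \<not> y \<le> x"
    using eq \<open>x \<le> x\<close> by (auto simp: less_omega1_def)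
  show "x \<le> y \<or> y \<le> x"
    using tot Rep_omega1[of x] Rep_omega1[of y] \<open>x \<le> x\<close>
    unfolding less_eq_omega1_def total_on_def by (metis Rep_omega1_inject)
next
  fix P :: "omega1 \<Rightarrow> bool" and a
  assume step: "\<And>x. (\<And>y. y < x \<Longrightarrow> P y) \<Longrightarrow> P x"
  have "wf (cardSuc natLeq - Id)"
    using Well_order_cardSuc_natLeq by (auto simp: well_order_on_def)
  then have "wf (inv_image (cardSuc natLeq - Id) Rep_omega1)"
    by (rule wf_inv_image)
  then show "P a"
  proof (induction a rule: wf_induct_rule)
    case (less x)
    show ?case
      by (rule step, rule less)
        (auto simp: less_omega1_def less_eq_omega1_def Rep_omega1_inject)
  qed
qed

lemma countable_atMost_omega1:
  includes cardinal_syntax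
  shows "countable {..\<xi>::omega1}"
proof -
  let ?r = "cardSuc natLeq"
  have "|underS ?r (Rep_omega1 \<xi>)| <o ?r"
    using card_of_underS[OF cardSuc_Card_order[OF natLeq_Card_order] Rep_omega1] .
  then have "|underS ?r (Rep_omega1 \<xi>)| \<le>o natLeq"
    by (simp add: cardSuc_ordLeq_ordLess card_of_Card_order natLeq_Card_order)
  then have "|underS ?r (Rep_omega1 \<xi>)| \<le>o |UNIV :: nat set|"
    using card_of_nat ordIso_symmetric ordLeq_ordIso_trans by blast
  then have "countable (underS ?r (Rep_omega1 \<xi>))"
    by (metis card_of_ordLeq countable_def)
  moreover have "Rep_omega1 ` {..<\<xi>} \<subseteq> underS ?r (Rep_omega1 \<xi>)"
    by (auto simp: underS_def less_omega1_def less_eq_omega1_def Rep_omega1_inject)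
  ultimately have "countable {..<\<xi>}"
    by (meson Rep_omega1_inject countable_image_inj_on countable_subset inj_onI)
  moreover have "{..\<xi>} = insert \<xi> {..<\<xi>}"
    by auto
  ultimately show ?thesis
    by simp
qed

lemma uncountable_UNIV_omega1:
  includes cardinal_syntax
  shows "uncountable (UNIV :: omega1 set)"
proof
  assume "countable (UNIV :: omega1 set)"
  then have "countable (Field (cardSuc natLeq))"
    using countable_image[of UNIV Rep_omega1] type_definition.Rep_range[OF type_definition_omega1]
    by simp
  then have "|Field (cardSuc natLeq)| \<le>o |UNIV :: nat set|"
    by (meson card_of_ordLeq countable_def subset_UNIV)
  moreover have "|Field (cardSuc natLeq)| =o cardSuc natLeq"
    by (simp add: card_of_Field_ordIso cardSuc_Card_order natLeq_Card_order)
  ultimately have "cardSuc natLeq \<le>o natLeq"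
    by (meson card_of_nat ordIso_ordLeq_trans ordIso_symmetric ordLeq_ordIso_trans)
  then show False
    using cardSuc_greater[OF natLeq_Card_order] not_ordLess_ordLeq by blast
qed

lemma omega1_greater_ex: "\<exists>\<eta>. \<xi> < (\<eta>::omega1)"
proof (rule ccontr)
  assume "\<not> ?thesis"
  then have "{..\<xi>} = UNIV"
    by (auto simp: not_less)
  then show False
    using countable_atMost_omega1[of \<xi>] uncountable_UNIV_omega1 by simp
qed

instantiation omega1 :: zero
begin
definition zero_omega1 :: omega1 where "0 = (LEAST \<xi>::omega1. True)"
instance ..
end

lemma omega1_zero_le [simp]: "0 \<le> (\<xi>::omega1)"
  by (simp add: zero_omega1_def Least_le)

definition osuc :: "omega1 \<Rightarrow> omega1"
  where "osuc \<xi> = (LEAST \<eta>. \<xi> < \<eta>)"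

lemma less_osuc: "\<xi> < osuc \<xi>"
  unfolding osuc_def using omega1_greater_ex by (rule LeastI_ex)

lemma osuc_le_iff: "osuc \<xi> \<le> \<eta> \<longleftrightarrow> \<xi> < \<eta>"
  using less_osuc[of \<xi>] Least_le[of "\<lambda>\<eta>. \<xi> < \<eta>" \<eta>] unfolding osuc_def[symmetric] by auto

lemma osuc_inject [simp]: "osuc \<xi> = osuc \<eta> \<longleftrightarrow> \<xi> = \<eta>"
  by (metis less_osuc linorder_neqE not_le osuc_le_iff)

lemma osuc_neq_zero [simp]: "osuc \<xi> \<noteq> 0"
  using less_osuc[of \<xi>] omega1_zero_le[of \<xi>] by (metis not_le)

definition olimit :: "omega1 \<Rightarrow> bool"
  where "olimit \<eta> \<longleftrightarrow> \<eta> \<noteq> 0 \<and> (\<forall>\<xi>. \<eta> \<noteq> osuc \<xi>)"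


subsection \<open>\<open>\<omega>\<close>-Stone spaces\<close>

text \<open>Second countability (equivalently, for these spaces, separability) is what \<open>\<omega>\<close> stands for:
  these are the Stone spaces of the countable Boolean rings. Without it the Cantor-Bendixson
  process need not stabilise at a countable ordinal and the perfect kernel need not be a Cantor
  set with at most one point removed.\<close>

definition omega_Stone_space :: "'a topology \<Rightarrow> bool"
  where "omega_Stone_space W \<longleftrightarrow>
    locally_compact_space W \<and> metrizable_space W \<and> Hausdorff_space W \<and>
    (\<forall>S. connectedin W S \<longrightarrow> (\<exists>a. S \<subseteq> {a})) \<and>
    (\<exists>\<B>. countable \<B> \<and> (\<forall>V\<in>\<B>. openin W V) \<and>
      (\<forall>U x. openin W U \<and> x \<in> U \<longrightarrow> (\<exists>V\<in>\<B>. x \<in> V \<and> V \<subseteq> U)))"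


subsection \<open>Cantor-Bendixson derivatives and the invariants of a space\<close>

function CB :: "'a topology \<Rightarrow> omega1 \<Rightarrow> 'a set"
  where "CB W \<xi> =
    (if \<xi> = 0 then topspace W
     else if \<exists>\<eta>. \<xi> = osuc \<eta> then W derived_set_of (CB W (THE \<eta>. \<xi> = osuc \<eta>))
     else (\<Inter>\<eta>\<in>{..<\<xi>}. CB W \<eta>))"
  by pat_completeness auto
termination
proof (relation "inv_image {(\<xi>, \<eta>). \<xi> < \<eta>} snd")
  show "wf (inv_image {(\<xi>::omega1, \<eta>). \<xi> < \<eta>} snd)"
    by (rule wf_inv_image) (rule wf)
  show "((W, THE \<eta>. \<xi> = osuc \<eta>), (W, \<xi>)) \<in> inv_image {(\<xi>, \<eta>). \<xi> < \<eta>} snd"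
    if "\<xi> \<noteq> 0" "\<exists>\<eta>. \<xi> = osuc \<eta>" for W :: "'a topology" and \<xi>
    using that by (auto simp: less_osuc)
  show "((W, \<eta>), (W, \<xi>)) \<in> inv_image {(\<xi>, \<eta>). \<xi> < \<eta>} snd"
    if "\<eta> \<in> {..<\<xi>}" for W :: "'a topology" and \<xi> \<eta>
    using that by simp
qed

declare CB.simps [simp del]

lemma CB_zero: "CB W 0 = topspace W"
  by (subst CB.simps) simp

lemma CB_osuc: "CB W (osuc \<xi>) = W derived_set_of (CB W \<xi>)"
  by (subst CB.simps) simp

lemma CB_olimit: "olimit \<eta> \<Longrightarrow> CB W \<eta> = (\<Inter>\<xi>\<in>{..<\<eta>}. CB W \<xi>)"
  by (subst CB.simps) (simp add: olimit_def)

text \<open>\<open>CB_level W \<xi>\<close> is \<open>W\<^bsup>[\<xi>]\<^esup>\<close>.\<close>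

definition CB_level :: "'a topology \<Rightarrow> omega1 \<Rightarrow> 'a set"
  where "CB_level W \<xi> = CB W \<xi> - CB W (osuc \<xi>)"

definition nu :: "'a topology \<Rightarrow> omega1"
  where "nu W = (LEAST \<xi>. CB W \<xi> = CB W (osuc \<xi>))"

definition kernel :: "'a topology \<Rightarrow> 'a set"
  where "kernel W = CB W (nu W)"

definition lambda :: "'a topology \<Rightarrow> omega1"
  where "lambda W = (LEAST \<xi>. closedin W (CB W \<xi> - kernel W))"

definition rank_fun :: "'a topology \<Rightarrow> 'a \<Rightarrow> omega1"
  where "rank_fun W x = (LEAST \<xi>. x \<notin> W closure_of (CB W \<xi> - kernel W))"

definition kernel_above :: "'a topology \<Rightarrow> omega1 \<Rightarrow> 'a set"
  where "kernel_above W \<xi> = {w \<in> kernel W. rank_fun W w > \<xi>}"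

definition rho :: "'a topology \<Rightarrow> omega1"
  where "rho W = (LEAST \<xi>. compactin W (W closure_of CB_level W \<xi>))"

definition rho_U :: "'a topology \<Rightarrow> omega1"
  where "rho_U W = (LEAST \<xi>. compactin W (kernel_above W \<xi>))"

definition uniform_Stone :: "'a topology \<Rightarrow> bool"
  where "uniform_Stone W \<longleftrightarrow> nu W = lambda W"

definition strongly_uniform :: "'a topology \<Rightarrow> bool"
  where "strongly_uniform W \<longleftrightarrow> uniform_Stone W \<and> rho_U W = rho W"


subsection \<open>Ranked spaces\<close>

definition pair_iso ::
    "'a topology \<times> ('a \<Rightarrow> omega1) \<Rightarrow> 'b topology \<times> ('b \<Rightarrow> omega1) \<Rightarrow> bool"
  where "pair_iso p q \<longleftrightarrow> (case (p, q) of ((U, r), (V, s)) \<Rightarrow>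
    \<exists>\<phi>. homeomorphic_map U V \<phi> \<and> (\<forall>u\<in>topspace U. s (\<phi> u) = r u))"

definition kernel_pair :: "'a topology \<Rightarrow> 'a topology \<times> ('a \<Rightarrow> omega1)"
  where "kernel_pair W = (subtopology W (kernel W), rank_fun W)"

definition usc :: "'a topology \<Rightarrow> ('a \<Rightarrow> omega1) \<Rightarrow> bool"
  where "usc K r \<longleftrightarrow> (\<forall>\<xi>. closedin K {x \<in> topspace K. r x \<ge> \<xi>})"

definition Cantor1 :: "(nat \<Rightarrow> bool) topology"
  where "Cantor1 = product_topology (\<lambda>_. discrete_topology UNIV) UNIV"

definition Cantor0 :: "(nat \<Rightarrow> bool) topology"
  where "Cantor0 = subtopology Cantor1 (UNIV - {\<lambda>_. False})"

text \<open>The rank functions are total on the type, but isomorphism only looks at their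
  values on the underlying space.\<close>

definition model_pairs :: "((nat \<Rightarrow> bool) topology \<times> ((nat \<Rightarrow> bool) \<Rightarrow> omega1)) set"
  where "model_pairs = {(K, r). K \<in> {Cantor0, Cantor1} \<and> usc K r}"

definition model_pairs_rel ::
    "((((nat \<Rightarrow> bool) topology \<times> ((nat \<Rightarrow> bool) \<Rightarrow> omega1))) \<times>
      ((nat \<Rightarrow> bool) topology \<times> ((nat \<Rightarrow> bool) \<Rightarrow> omega1))) set"
  where "model_pairs_rel = {(p, q). p \<in> model_pairs \<and> q \<in> model_pairs \<and> pair_iso p q}"

text \<open>The space is required to be nonempty: the empty space is strongly uniform,
  but its perfect kernel is empty.\<close>

definition strongly_uniform_spaces :: "'a topology set"
  where "strongly_uniform_spaces =
    {W. omega_Stone_space W \<and> topspace W \<noteq> {} \<and> strongly_uniform W}"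

text \<open>HOL has no type of all spaces, so homeomorphism classes are formed among the spaces whose
  points lie in a type. Nonempty second countable Hausdorff spaces have at most continuum many
  points, so every type into which the reals inject carries a representative of each class.\<close>

definition homeo_rel :: "('a topology \<times> 'a topology) set"
  where "homeo_rel = {(W, X). W \<in> strongly_uniform_spaces \<and> X \<in> strongly_uniform_spaces \<and>
    W homeomorphic_space X}"

definition kernel_class ::
    "'a topology \<Rightarrow> ((nat \<Rightarrow> bool) topology \<times> ((nat \<Rightarrow> bool) \<Rightarrow> omega1)) set"
  where "kernel_class W = {p \<in> model_pairs. pair_iso (kernel_pair W) p}"

end

theory Submission
  imports Defs
begin

text \<open>Let \<open>\<phi>\<close> be an isomorphism between the ranked kernels of \<open>W\<close> and \<open>X\<close>. Call compact open sets
  \<open>A \<subseteq> W\<close> and \<open>B \<subseteq> X\<close> matched if \<open>\<phi>\<close> maps \<open>A \<inter> K(W)\<close> onto \<open>B \<inter> K(X)\<close> and if \<open>A\<close> and \<open>B\<close> have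
  equally many points (finitely or infinitely many) in each Cantor-Bendixson level. The numbers of
  points of \<open>A\<close> are infinite up to some level \<open>\<alpha>\<close>, finite at \<open>\<alpha>\<close> and zero afterwards, and the only
  constraint that the kernel puts on them is that the rank function is at most \<open>\<alpha>\<close> on \<open>A \<inter> K(W)\<close>.
  Hence a clopen partition of \<open>A\<close> into two pieces is followed by a partition of \<open>B\<close> into matched
  pieces: it suffices to choose the piece with the smaller \<open>\<alpha>\<close>, a neighbourhood of its part of the
  kernel together with finitely many points of level \<open>\<alpha>\<close>. Uniformity and strong uniformity allow
  us to match the noncompact spaces themselves, so that a back-and-forth argument yields a
  homeomorphism. The same argument characterises the two perfect spaces. Conversely, a ranked Cantor
  set is realised by letting scattered points of the prescribed ranks accumulate at it.\<close>

subsection \<open>Compact open sets\<close>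

text \<open>The uniformity conditions turn invariants of the whole space into invariants of the
  ranked kernel: \<open>nu = lambda\<close> and \<open>rho = rho_U\<close>, and the right-hand sides
  depend only on the pair. They also provide room. For \<open>\<xi> < nu W\<close> some kernel point
  has rank above \<open>\<xi>\<close>, so level \<open>\<xi>\<close> accumulates there; for
  \<open>\<xi> < rho W\<close> these kernel points form a closed noncompact set, so they leave every
  compact set, and outside any compact open set there are infinitely many points of level
  \<open>\<xi>\<close>. Hence a new compact piece can always be matched outside of what is already
  used. The obstacle in splitting is that infinite counts cannot be subtracted. Handling the piece
  with the smaller \<open>\<alpha>\<close> first avoids this: where its counts are infinite, so are
  those of the other piece. For the realisation, second countability bounds the ranks by some
  \<open>N\<close>, so one sequence \<open>e\<close> can repeat every ordinal up to \<open>N\<close>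
  infinitely often. Strictly decreasing selections from \<open>e\<close> mark the scattered points,
  and all constraints on them concern finite prefixes, so the space is closed in a compact one,
  except for the point missing from \<open>Cantor0\<close>.\<close>

definition compact_open :: "'a topology \<Rightarrow> 'a set \<Rightarrow> bool"
  where "compact_open X A \<longleftrightarrow> compactin X A \<and> openin X A"

lemma compact_open_empty [simp]: "compact_open X {}"
  by (simp add: compact_open_def)

lemma compact_open_subset: "compact_open X A \<Longrightarrow> A \<subseteq> topspace X"
  by (simp add: compact_open_def openin_subset)

lemma compact_open_closedin: "Hausdorff_space X \<Longrightarrow> compact_open X A \<Longrightarrow> closedin X A"
  by (simp add: compact_open_def compactin_imp_closedin)

lemma compact_open_Un: "compact_open X A \<Longrightarrow> compact_open X B \<Longrightarrow> compact_open X (A \<union> B)"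
  by (simp add: compact_open_def compactin_Un openin_Un)

lemma compact_open_Int_clopen:
  assumes "compact_open X A" "closedin X B" "openin X B"
  shows "compact_open X (A \<inter> B)"
  using assms by (simp add: compact_open_def compact_Int_closedin openin_Int)

lemma compact_open_Diff_clopen:
  assumes "compact_open X A" "closedin X B" "openin X B"
  shows "compact_open X (A - B)"
proof -
  have "A - B = A \<inter> (topspace X - B)"
    using compact_open_subset[OF assms(1)] by blast
  then show ?thesis
    using assms by (simp add: compact_open_Int_clopen openin_diff closedin_diff)
qed

lemma compact_open_Int:
  "Hausdorff_space X \<Longrightarrow> compact_open X A \<Longrightarrow> compact_open X B \<Longrightarrow> compact_open X (A \<inter> B)"
  using compact_open_Int_clopen compact_open_closedin compact_open_def by metis

lemma compact_open_Diff:
  "Hausdorff_space X \<Longrightarrow> compact_open X A \<Longrightarrow> compact_open X B \<Longrightarrow> compact_open X (A - B)"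
  using compact_open_Diff_clopen compact_open_closedin compact_open_def by metis

lemma compact_open_Union:
  "finite \<F> \<Longrightarrow> (\<And>A. A \<in> \<F> \<Longrightarrow> compact_open X A) \<Longrightarrow> compact_open X (\<Union>\<F>)"
  by (induction rule: finite_induct) (auto intro: compact_open_Un)

lemma omega_Stone_spaceD:
  assumes "omega_Stone_space X"
  shows "locally_compact_space X" "metrizable_space X" "Hausdorff_space X" "second_countable X"
    "\<And>S. connectedin X S \<Longrightarrow> \<exists>a. S \<subseteq> {a}"
  using assms by (auto simp: omega_Stone_space_def second_countable_def)

lemma omega_Stone_spaceI:
  assumes "locally_compact_space X" "metrizable_space X" "second_countable X"
    "\<And>S. connectedin X S \<Longrightarrow> \<exists>a. S \<subseteq> {a}"
  shows "omega_Stone_space X"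
  using assms metrizable_imp_Hausdorff_space
  by (auto simp: omega_Stone_space_def second_countable_def)

text \<open>The component of \<open>x\<close> is \<open>{x}\<close>, which is compact, so local
  compactness yields a clopen set separating it from the closed complement of
  \<open>U \<inter> V\<close>. Being closed inside \<open>K\<close>, this clopen set is
  compact.\<close>

lemma omega_Stone_base:
  assumes X: "omega_Stone_space X" and U: "openin X U" "x \<in> U"
  obtains A where "compact_open X A" "x \<in> A" "A \<subseteq> U"
proof -
  note X' = omega_Stone_spaceD[OF X]
  have x: "x \<in> topspace X"
    using U openin_subset by blast
  have cc: "connected_component_of_set X x = {x}"
  proof -
    have "x \<in> connected_component_of_set X x"
      using x connected_component_of_refl by fastforce
    moreover have "connectedin X (connected_component_of_set X x)"
      by (simp add: connectedin_connected_component_of)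
    ultimately show ?thesis
      using X'(5)[of "connected_component_of_set X x"] by auto
  qed
  obtain V K where VK: "openin X V" "compactin X K" "x \<in> V" "V \<subseteq> K"
    using X'(1) x unfolding locally_compact_space_def by blast
  have "{x} \<in> connected_components_of X"
    using x cc connected_components_of_def by (metis imageI)
  moreover have "closedin X (topspace X - U \<inter> V)"
    using U VK by blast
  moreover have "disjnt {x} (topspace X - U \<inter> V)"
    using U VK by auto
  ultimately have "separated_between X {x} (topspace X - U \<inter> V)"
    using separated_between_compact_connected_component[OF X'(1,3)] x by simp
  then obtain A where A: "closedin X A" "openin X A" "{x} \<subseteq> A" "topspace X - U \<inter> V \<subseteq> topspace X - A"
    unfolding separated_between by blast
  then have "A \<subseteq> U \<inter> V"
    using openin_subset by blast
  moreover have "compactin X A"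
    using closed_compactin[OF VK(2) _ A(1)] \<open>A \<subseteq> U \<inter> V\<close> VK(4) by blast
  ultimately show ?thesis
    using A by (intro that[of A]) (auto simp: compact_open_def)
qed

lemma omega_Stone_compact_between:
  assumes X: "omega_Stone_space X" and L: "compactin X L" and U: "openin X U" "L \<subseteq> U"
  obtains A where "compact_open X A" "L \<subseteq> A" "A \<subseteq> U"
proof -
  have "\<exists>A. compact_open X A \<and> x \<in> A \<and> A \<subseteq> U" if "x \<in> L" for x
    using that U by (auto intro: omega_Stone_base[OF X U(1), of x])
  then obtain A where A: "\<And>x. x \<in> L \<Longrightarrow> compact_open X (A x) \<and> x \<in> A x \<and> A x \<subseteq> U"
    by metis
  have "\<exists>\<F>. finite \<F> \<and> \<F> \<subseteq> A ` L \<and> L \<subseteq> \<Union>\<F>"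
    using A by (intro compactinD[OF L]) (auto simp: compact_open_def)
  then obtain \<F> where F: "finite \<F>" "\<F> \<subseteq> A ` L" "L \<subseteq> \<Union>\<F>"
    by blast
  have "compact_open X (\<Union>\<F>)"
    using F A by (intro compact_open_Union) auto
  moreover have "\<Union>\<F> \<subseteq> U"
    using F(2) A by (force simp: subset_iff)
  ultimately show ?thesis
    using F(3) by (intro that[of "\<Union>\<F>"])
qed

text \<open>A compact open set is a finite union of members of a countable base. This both
  enumerates the sets to cut along and bounds families of ordinals that are witnessed by distinct
  compact open sets.\<close>

lemma countable_compact_open:
  assumes X: "second_countable X"
  shows "countable {A. compact_open X A}"
proof -
  obtain \<B> where B: "countable \<B>" "\<forall>V\<in>\<B>. openin X V"
      "\<forall>U x. openin X U \<and> x \<in> U \<longrightarrow> (\<exists>V\<in>\<B>. x \<in> V \<and> V \<subseteq> U)"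
    using X unfolding second_countable_def by (elim exE conjE) (rule that)
  have "{A. compact_open X A} \<subseteq> Union ` {\<F>. finite \<F> \<and> \<F> \<subseteq> \<B>}"
  proof
    fix A assume "A \<in> {A. compact_open X A}"
    then have A: "compactin X A" "openin X A"
      by (auto simp: compact_open_def)
    let ?\<U> = "{V \<in> \<B>. V \<subseteq> A}"
    have "A \<subseteq> \<Union>?\<U>"
      using B(3) A(2) by blast
    then obtain \<F> where F: "finite \<F>" "\<F> \<subseteq> ?\<U>" "A \<subseteq> \<Union>\<F>"
      using compactinD[OF A(1), of ?\<U>] B(2) by auto
    then have "A = \<Union>\<F>"
      by blast
    then show "A \<in> Union ` {\<F>. finite \<F> \<and> \<F> \<subseteq> \<B>}"
      using F by blast
  qed
  then show ?thesis
    by (rule countable_subset[OF _ countable_image[OF countable_Collect_finite_subset[OF B(1)]]])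
qed

lemma omega_Stone_subtopology:
  assumes X: "omega_Stone_space X" and S: "closedin X S \<or> openin X S"
  shows "omega_Stone_space (subtopology X S)"
proof (rule omega_Stone_spaceI)
  note X' = omega_Stone_spaceD[OF X]
  show "locally_compact_space (subtopology X S)"
    using S X'(1,3) locally_compact_space_closed_subset locally_compact_space_open_subset by blast
  show "metrizable_space (subtopology X S)"
    using X'(2) by (rule metrizable_space_subtopology)
  show "second_countable (subtopology X S)"
    using X'(4) by (rule second_countable_subtopology)
  show "\<exists>a. T \<subseteq> {a}" if "connectedin (subtopology X S) T" for T
    using that X'(5) by (simp add: connectedin_subtopology)
qed

lemma homeomorphic_omega_Stone_space:
  assumes X: "omega_Stone_space X" and h: "X homeomorphic_space Y"
  shows "omega_Stone_space Y"
proof (rule omega_Stone_spaceI)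
  note X' = omega_Stone_spaceD[OF X]
  show "locally_compact_space Y"
    using X'(1-4) h homeomorphic_locally_compact_space by blast
  show "metrizable_space Y"
    using X'(1-4) h homeomorphic_metrizable_space by blast
  show "second_countable Y"
    using X'(1-4) h homeomorphic_space_second_countability by blast
  obtain g where g: "homeomorphic_map Y X g"
    using h homeomorphic_space_sym homeomorphic_space by blast
  show "\<exists>a. T \<subseteq> {a}" if T: "connectedin Y T" for T
  proof -
    have "T \<subseteq> topspace Y"
      using T connectedin_subset_topspace by blast
    moreover have "inj_on g (topspace Y)"
      using g homeomorphic_imp_injective_map by blast
    moreover obtain a where "g ` T \<subseteq> {a}"
      using X'(5)[of "g ` T"] T homeomorphic_map_connectedness_eq[OF g] by blast
    ultimately have "x = y" if "x \<in> T" "y \<in> T" for x y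
      using that by (intro inj_onD[of g "topspace Y"]) auto
    then show ?thesis
      by blast
  qed
qed

subsection \<open>Back and forth\<close>

text \<open>Cells are indexed by Boolean lists whose head is the latest choice, so
  \<open>u @ s\<close> lies below \<open>s\<close> in the tree.\<close>

lemma cell_tree_append:
  assumes "\<And>s. a s = a (True # s) \<union> a (False # s)"
  shows "a (u @ s) \<subseteq> a s"
proof (induction u)
  case (Cons i u)
  have "a (i # u @ s) \<subseteq> a (u @ s)"
    using assms[of "u @ s"] by (cases i) auto
  with Cons show ?case
    by simp
qed simp

lemma cell_tree_unique:
  assumes split: "\<And>s. a s = a (True # s) \<union> a (False # s)" "\<And>s. a (True # s) \<inter> a (False # s) = {}"
    and "length s = length t" "x \<in> a s" "x \<in> a t"
  shows "s = t"
  using assms(3-)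
proof (induction s t rule: list_induct2)
  case (Cons i s j t)
  have "x \<in> a s" "x \<in> a t"
    using Cons.prems split(1)[of s] split(1)[of t] by (cases i; cases j; simp)+
  then have "s = t"
    by (rule Cons.IH)
  then show ?case
    using Cons.prems split(2)[of s] by (cases i; cases j) auto
qed simp

lemma cell_tree_branch:
  assumes split: "\<And>s. a s = a (True # s) \<union> a (False # s)" and "x \<in> a []"
  shows "\<exists>\<sigma>. \<forall>n. length (\<sigma> n) = n \<and> x \<in> a (\<sigma> n)"
proof -
  have "\<exists>s. length s = n \<and> x \<in> a s" for n
  proof (induction n)
    case (Suc n)
    then obtain s where s: "length s = n" "x \<in> a s"
      by blast
    then have "x \<in> a (True # s) \<or> x \<in> a (False # s)"
      using split[of s] by auto
    then show ?case
      using s(1) by (metis length_Cons)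
  qed (use assms(2) in auto)
  then show ?thesis
    by metis
qed

text \<open>The cells containing \<open>x\<close> form a branch. The corresponding cells of
  \<open>b\<close> are nested, closed, nonempty and eventually inside a compact set, so they have a
  common point \<open>y\<close>; disjointness of cells of equal depth shows that \<open>y\<close>
  lies in no other cells.\<close>

lemma cell_tree_match:
  assumes a: "\<And>s. a s = a (True # s) \<union> a (False # s)" "\<And>s. a (True # s) \<inter> a (False # s) = {}"
    and b: "\<And>s. b s = b (True # s) \<union> b (False # s)" "\<And>s. b (True # s) \<inter> b (False # s) = {}"
    and closed: "\<And>s. closedin Y (b s)"
    and nonempty: "\<And>s. a s \<noteq> {} \<Longrightarrow> b s \<noteq> {}"
    and cpt: "x \<in> a s0" "compactin Y (b s0)"
  shows "\<exists>y. \<forall>s. x \<in> a s \<longleftrightarrow> y \<in> b s"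
proof -
  have mono: "a (u @ s) \<subseteq> a s" "b (u @ s) \<subseteq> b s" for u s
    using cell_tree_append[of a] cell_tree_append[of b] a(1) b(1) by metis+
  have "x \<in> a []"
    using mono(1)[of s0 "[]"] cpt(1) by auto
  then obtain \<sigma> where \<sigma>: "\<And>n. length (\<sigma> n) = n" "\<And>n. x \<in> a (\<sigma> n)"
    using cell_tree_branch[OF a(1)] by blast
  have \<sigma>_eq: "s = \<sigma> (length s)" if "x \<in> a s" for s
    using cell_tree_unique[OF a, where s = s and t = "\<sigma> (length s)" and x = x] that \<sigma> by simp
  have dec: "b (\<sigma> (Suc n)) \<subseteq> b (\<sigma> n)" for n
  proof -
    obtain i s where s: "\<sigma> (Suc n) = i # s"
      using \<sigma>(1)[of "Suc n"] by (cases "\<sigma> (Suc n)") auto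
    then have "x \<in> a s"
      using \<sigma>(2)[of "Suc n"] mono(1)[of "[i]" s] by auto
    moreover have "length s = n"
      using s \<sigma>(1)[of "Suc n"] by simp
    ultimately have "s = \<sigma> n"
      using \<sigma>_eq by metis
    then show ?thesis
      using s mono(2)[of "[i]" s] by simp
  qed
  have antimono: "b (\<sigma> n) \<subseteq> b (\<sigma> m)" if "m \<le> n" for m n
    using lift_Suc_antimono_le[of "\<lambda>n. b (\<sigma> n)", OF dec that] .
  \<comment> \<open>Only the cells from \<open>s0\<close> downwards are known to lie in a compact
    set, so the intersection starts at this depth.\<close>
  let ?N = "length s0"
  let ?Y = "subtopology Y (b s0)"
  have s0: "s0 = \<sigma> ?N"
    by (rule \<sigma>_eq[OF cpt(1)])
  have "(\<Inter>n. b (\<sigma> (?N + n))) \<noteq> {}"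
  proof (rule compact_space_imp_nest[of ?Y])
    show "compact_space ?Y"
      using cpt(2) by (simp add: compact_space_subtopology)
    show "closedin ?Y (b (\<sigma> (?N + n)))" for n
    proof -
      have "b (\<sigma> (?N + n)) \<subseteq> b s0"
        using antimono[of ?N "?N + n"] s0 by simp
      then show ?thesis
        using closed by (simp add: closedin_subset_topspace)
    qed
    show "b (\<sigma> (?N + n)) \<noteq> {}" for n
      using \<sigma>(2)[of "?N + n"] by (intro nonempty) auto
    show "decseq (\<lambda>n. b (\<sigma> (?N + n)))"
      unfolding decseq_def by (intro allI impI antimono) simp
  qed
  then obtain y where "y \<in> b (\<sigma> (?N + n))" for n
    by blast
  then have y: "y \<in> b (\<sigma> n)" for n
    using antimono[of n "?N + n"] by auto
  have "x \<in> a s \<longleftrightarrow> y \<in> b s" for s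
  proof
    show "x \<in> a s \<Longrightarrow> y \<in> b s"
      using \<sigma>_eq[of s] y[of "length s"] by simp
    assume "y \<in> b s"
    then have "s = \<sigma> (length s)"
      using cell_tree_unique[OF b, where s = s and t = "\<sigma> (length s)" and x = y] y \<sigma>(1) by simp
    then show "x \<in> a s"
      using \<sigma>(2)[of "length s"] by simp
  qed
  then show ?thesis
    by blast
qed

lemma cell_tree_continuous:
  assumes "a [] = topspace X" "b [] = topspace Y" and opena: "\<And>s. openin X (a s)"
    and baseb: "\<And>U y. openin Y U \<Longrightarrow> y \<in> U \<Longrightarrow> \<exists>s. y \<in> b s \<and> b s \<subseteq> U"
    and f: "\<And>x s. x \<in> topspace X \<Longrightarrow> x \<in> a s \<longleftrightarrow> f x \<in> b s"
  shows "continuous_map X Y f"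
  unfolding continuous_map_def
proof (intro conjI allI impI)
  show "f \<in> topspace X \<rightarrow> topspace Y"
    using f[of _ "[]"] assms(1,2) by auto
  fix U assume U: "openin Y U"
  show "openin X {x \<in> topspace X. f x \<in> U}"
  proof (subst openin_subopen, intro ballI)
    fix x assume x: "x \<in> {x \<in> topspace X. f x \<in> U}"
    then obtain s where s: "f x \<in> b s" "b s \<subseteq> U"
      using baseb[OF U, of "f x"] by auto
    have "a s \<subseteq> topspace X"
      using opena openin_subset by metis
    then have "a s \<subseteq> {x \<in> topspace X. f x \<in> U}"
      using f[of _ s] s(2) by auto
    moreover have "x \<in> a s"
      using f[of x s] x s(1) by simp
    ultimately show "\<exists>T. openin X T \<and> x \<in> T \<and> T \<subseteq> {x \<in> topspace X. f x \<in> U}"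
      using opena by blast
  qed
qed

text \<open>Points correspond if they lie in corresponding cells. As the cells form a base on both
  sides, they separate points, which makes the two maps mutually inverse, and they make both maps
  continuous. Compact cells guarantee that each point has a partner.\<close>

lemma homeomorphic_space_cell_trees:
  assumes root: "a [] = topspace X" "b [] = topspace Y"
    and a: "\<And>s. a s = a (True # s) \<union> a (False # s)" "\<And>s. a (True # s) \<inter> a (False # s) = {}"
    and b: "\<And>s. b s = b (True # s) \<union> b (False # s)" "\<And>s. b (True # s) \<inter> b (False # s) = {}"
    and clopena: "\<And>s. openin X (a s)" "\<And>s. closedin X (a s)"
    and clopenb: "\<And>s. openin Y (b s)" "\<And>s. closedin Y (b s)"
    and empty: "\<And>s. a s = {} \<longleftrightarrow> b s = {}"
    and cpt: "\<And>s. compactin X (a s) \<longleftrightarrow> compactin Y (b s)"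
    and basea: "\<And>U x. openin X U \<Longrightarrow> x \<in> U \<Longrightarrow> \<exists>s. x \<in> a s \<and> a s \<subseteq> U \<and> compactin X (a s)"
    and baseb: "\<And>U y. openin Y U \<Longrightarrow> y \<in> U \<Longrightarrow> \<exists>s. y \<in> b s \<and> b s \<subseteq> U \<and> compactin Y (b s)"
    and Haus: "Hausdorff_space X" "Hausdorff_space Y"
  shows "X homeomorphic_space Y"
proof -
  have sepa: "x = x'" if "x \<in> topspace X" "\<And>s. x \<in> a s \<longleftrightarrow> x' \<in> a s" for x x'
  proof (rule ccontr)
    assume "x \<noteq> x'"
    have "x' \<in> topspace X"
      using that(2)[of "[]"] that(1) root by simp
    then have "openin X (topspace X - {x'})"
      using Haus(1) by (simp add: closedin_Hausdorff_singleton openin_diff)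
    then show False
      using basea[of "topspace X - {x'}" x] \<open>x \<noteq> x'\<close> that by auto
  qed
  have sepb: "y = y'" if "y \<in> topspace Y" "\<And>s. y \<in> b s \<longleftrightarrow> y' \<in> b s" for y y'
  proof (rule ccontr)
    assume "y \<noteq> y'"
    have "y' \<in> topspace Y"
      using that(2)[of "[]"] that(1) root by simp
    then have "openin Y (topspace Y - {y'})"
      using Haus(2) by (simp add: closedin_Hausdorff_singleton openin_diff)
    then show False
      using baseb[of "topspace Y - {y'}" y] \<open>y \<noteq> y'\<close> that by auto
  qed
  have "\<exists>y. \<forall>s. x \<in> a s \<longleftrightarrow> y \<in> b s" if x: "x \<in> topspace X" for x
  proof -
    obtain s0 where "x \<in> a s0" "compactin X (a s0)"
      using basea[OF openin_topspace x] by blast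
    then show ?thesis
      using empty cpt by (intro cell_tree_match[OF a b clopenb(2)]) auto
  qed
  then obtain f where f: "\<And>x s. x \<in> topspace X \<Longrightarrow> x \<in> a s \<longleftrightarrow> f x \<in> b s"
    by metis
  have "\<exists>x. \<forall>s. y \<in> b s \<longleftrightarrow> x \<in> a s" if y: "y \<in> topspace Y" for y
  proof -
    obtain s0 where "y \<in> b s0" "compactin Y (b s0)"
      using baseb[OF openin_topspace y] by blast
    then show ?thesis
      using empty cpt by (intro cell_tree_match[OF b a clopena(2)]) auto
  qed
  then obtain g where g: "\<And>y s. y \<in> topspace Y \<Longrightarrow> y \<in> b s \<longleftrightarrow> g y \<in> a s"
    by metis
  have "\<exists>s. y \<in> b s \<and> b s \<subseteq> U" if "openin Y U" "y \<in> U" for U y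
    using baseb[OF that] by auto
  then have contf: "continuous_map X Y f"
    using root clopena(1) f by (intro cell_tree_continuous[of a X b Y f])
  have "\<exists>s. x \<in> a s \<and> a s \<subseteq> U" if "openin X U" "x \<in> U" for U x
    using basea[OF that] by auto
  then have contg: "continuous_map Y X g"
    using root clopenb(1) g by (intro cell_tree_continuous[of b Y a X g])
  have f': "f x \<in> topspace Y" if "x \<in> topspace X" for x
    using f[OF that, of "[]"] root that by simp
  have g': "g y \<in> topspace X" if "y \<in> topspace Y" for y
    using g[OF that, of "[]"] root that by simp
  have "g (f x) = x" if x: "x \<in> topspace X" for x
    using f[OF x] g[OF f'[OF x]] sepa[OF x] by metis
  moreover have "f (g y) = y" if y: "y \<in> topspace Y" for y
    using g[OF y] f[OF g'[OF y]] sepb[OF y] by metis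
  ultimately have "homeomorphic_maps X Y f g"
    using contf contg by (simp add: homeomorphic_maps_def)
  then show ?thesis
    using homeomorphic_maps_imp_homeomorphic_space by blast
qed

lemma range_compact_open:
  assumes X: "second_countable X"
  shows "\<exists>C :: nat \<Rightarrow> 'a set. range C = {A :: 'a set. compact_open X A}"
proof
  have "{A. compact_open X A} \<noteq> {}"
    using compact_open_empty by blast
  then show "range (from_nat_into {A. compact_open X A}) = {A. compact_open X A}"
    using countable_compact_open[OF X] by (rule range_from_nat_into)
qed

text \<open>Cuts along all compact open sets of \<open>X\<close> and of \<open>Y\<close> alternate,
  so the cells of either tree contain arbitrarily small compact neighbourhoods of each
  point.\<close>

lemma back_and_forth:
  fixes X :: "'a topology" and Y :: "'b topology" and R :: "'a set \<Rightarrow> 'b set \<Rightarrow> bool"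
  assumes X: "omega_Stone_space X" and Y: "omega_Stone_space Y"
    and clopen: "\<And>A B. R A B \<Longrightarrow> openin X A \<and> closedin X A \<and> openin Y B \<and> closedin Y B"
    and empty: "\<And>A B. R A B \<Longrightarrow> A = {} \<longleftrightarrow> B = {}"
    and cpt: "\<And>A B. R A B \<Longrightarrow> compactin X A \<longleftrightarrow> compactin Y B"
    and init: "R A0 B0" "R (topspace X - A0) (topspace Y - B0)"
    and forward: "\<And>A B C. R A B \<Longrightarrow> compact_open X C \<Longrightarrow>
        \<exists>B'\<subseteq>B. R (A \<inter> C) B' \<and> R (A - C) (B - B')"
    and backward: "\<And>A B D. R A B \<Longrightarrow> compact_open Y D \<Longrightarrow>
        \<exists>A'\<subseteq>A. R A' (B \<inter> D) \<and> R (A - A') (B - D)"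
  shows "X homeomorphic_space Y"
proof -
  note Haus = omega_Stone_spaceD(3)[OF X] omega_Stone_spaceD(3)[OF Y]
  obtain C :: "nat \<Rightarrow> 'a set" where C: "range C = {A. compact_open X A}"
    using range_compact_open[OF omega_Stone_spaceD(4)[OF X]] by (elim exE) (rule that)
  obtain D :: "nat \<Rightarrow> 'b set" where D: "range D = {A. compact_open Y A}"
    using range_compact_open[OF omega_Stone_spaceD(4)[OF Y]] by (elim exE) (rule that)
  have CD: "compact_open X (C k)" "compact_open Y (D k)" for k
    using C D by auto
  \<comment> \<open>The pair of whole spaces is allowed to violate \<open>R\<close>; the relation is
    required only from depth 1 on, after the cut into \<open>A0\<close>, \<open>B0\<close> and their
    complements.\<close>
  define Q where "Q n p = (if n = 0 then p = (topspace X, topspace Y) else R (fst p) (snd p))" for n :: nat and p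
  \<comment> \<open>Depth 0 is reserved for the initial cut. Depth \<open>2 * k + 1\<close> cuts
    along \<open>C k\<close> and depth \<open>2 * k + 2\<close> along \<open>D k\<close>, hence the
    subtraction of one.\<close>
  define dec where "dec n p q = (if n = 0 then True else if odd n then fst q = fst p \<inter> C (n div 2)
      else snd q = snd p \<inter> D (n div 2 - 1))" for n :: nat and p :: "'a set \<times> 'b set" and q :: "'a set \<times> 'b set"
  have "\<exists>q. fst q \<subseteq> fst p \<and> snd q \<subseteq> snd p \<and> Q (Suc n) q \<and> Q (Suc n) (fst p - fst q, snd p - snd q) \<and> dec n p q"
    if Q: "Q n p" for n p
  proof -
    consider "n = 0" | "n > 0" "odd n" | "n > 0" "even n"
      by blast
    then show ?thesis
    proof cases
      case 1
      then have "p = (topspace X, topspace Y)"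
        using Q by (simp add: Q_def)
      then show ?thesis
        using init clopen[OF init(1)] 1 openin_subset[of X A0] openin_subset[of Y B0] by (intro exI[of _ "(A0, B0)"]) (auto simp: Q_def dec_def)
    next
      case 2
      then have "R (fst p) (snd p)"
        using Q by (simp add: Q_def)
      from forward[OF this CD(1)[of "n div 2"]] obtain B' where "B' \<subseteq> snd p" "R (fst p \<inter> C (n div 2)) B'" "R (fst p - C (n div 2)) (snd p - B')"
        by (elim exE conjE) (rule that)
      then show ?thesis
        using 2 by (intro exI[of _ "(fst p \<inter> C (n div 2), B')"]) (auto simp: Q_def dec_def Diff_Int)
    next
      case 3
      then have "R (fst p) (snd p)"
        using Q by (simp add: Q_def)
      from backward[OF this CD(2)[of "n div 2 - 1"]] obtain A' where "A' \<subseteq> fst p" "R A' (snd p \<inter> D (n div 2 - 1))" "R (fst p - A') (snd p - D (n div 2 - 1))"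
        by (elim exE conjE) (rule that)
      then show ?thesis
        using 3 by (intro exI[of _ "(A', snd p \<inter> D (n div 2 - 1))"]) (auto simp: Q_def dec_def Diff_Int)
    qed
  qed
  then obtain h where h: "\<And>n p. Q n p \<Longrightarrow> fst (h n p) \<subseteq> fst p \<and> snd (h n p) \<subseteq> snd p \<and> Q (Suc n) (h n p) \<and>
      Q (Suc n) (fst p - fst (h n p), snd p - snd (h n p)) \<and> dec n p (h n p)"
    by metis
  define c where "c = rec_list (topspace X, topspace Y)
    (\<lambda>i s p. if i then h (length s) p else (fst p - fst (h (length s) p), snd p - snd (h (length s) p)))"
  have c: "c [] = (topspace X, topspace Y)" "c (True # s) = h (length s) (c s)"
    "c (False # s) = (fst (c s) - fst (h (length s) (c s)), snd (c s) - snd (h (length s) (c s)))" for s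
    by (simp_all add: c_def)
  have Qc: "Q (length s) (c s)" for s
  proof (induction s)
    case (Cons i s)
    then show ?case
      using h[OF Cons] c by (cases i) auto
  qed (simp add: c Q_def)
  define a where "a s = fst (c s)" for s
  define b where "b s = snd (c s)" for s
  note hc = h[OF Qc]
  have root: "a [] = topspace X" "b [] = topspace Y"
    by (simp_all add: a_def b_def c)
  have a: "a s = a (True # s) \<union> a (False # s)" "a (True # s) \<inter> a (False # s) = {}" for s
    using hc[of s] by (auto simp: a_def c)
  have b: "b s = b (True # s) \<union> b (False # s)" "b (True # s) \<inter> b (False # s) = {}" for s
    using hc[of s] by (auto simp: b_def c)
  have R: "R (a s) (b s)" if "s \<noteq> []" for s
    using Qc[of s] that by (simp add: Q_def a_def b_def)
  have clopenab: "openin X (a s) \<and> closedin X (a s) \<and> openin Y (b s) \<and> closedin Y (b s)" for s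
    using clopen R root by (cases "s = []") auto
  \<comment> \<open>The root need not be a related pair, so emptiness and, below, compactness at the
    root are recovered from its two halves.\<close>
  have "a s = {} \<longleftrightarrow> b s = {}" if "s \<noteq> []" for s
    using empty R that by metis
  moreover from this have "a [] = {} \<longleftrightarrow> b [] = {}"
    using a(1)[of "[]"] b(1)[of "[]"] by auto
  ultimately have emptyab: "a s = {} \<longleftrightarrow> b s = {}" for s
    by metis
  have cpt_nonroot: "compactin X (a s) \<longleftrightarrow> compactin Y (b s)" if "s \<noteq> []" for s
    using cpt R that by metis
  have "compactin X (a []) \<longleftrightarrow> compactin X (a [True]) \<and> compactin X (a [False])"
    using a(1)[of "[]"] clopenab compactin_Un closed_compactin by (metis Un_upper1 Un_upper2)
  moreover have "compactin Y (b []) \<longleftrightarrow> compactin Y (b [True]) \<and> compactin Y (b [False])"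
    using b(1)[of "[]"] clopenab compactin_Un closed_compactin by (metis Un_upper1 Un_upper2)
  ultimately have "compactin X (a []) \<longleftrightarrow> compactin Y (b [])"
    using cpt_nonroot[of "[True]"] cpt_nonroot[of "[False]"] by simp
  then have cptab: "compactin X (a s) \<longleftrightarrow> compactin Y (b s)" for s
    using cpt_nonroot by (cases "s = []") auto
  have basea: "\<exists>s. x \<in> a s \<and> a s \<subseteq> U \<and> compactin X (a s)" if U: "openin X U" "x \<in> U" for U x
  proof -
    obtain E where E: "compact_open X E" "x \<in> E" "E \<subseteq> U"
      using omega_Stone_base[OF X U] .
    then obtain k where k: "E = C k"
      using C by blast
    have "x \<in> a []"
      using E compact_open_subset root by blast
    then obtain s where s: "length s = 2 * k + 1" "x \<in> a s"
      using cell_tree_branch[of a, OF a(1)] by blast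
    then have "a (True # s) = a s \<inter> E"
      using hc[of s] by (simp add: dec_def a_def c k)
    moreover from this have "compactin X (a (True # s))"
      using closed_compactin E(1) clopenab by (metis compact_open_def inf_le2)
    ultimately show ?thesis
      using s E by blast
  qed
  have baseb: "\<exists>s. x \<in> b s \<and> b s \<subseteq> U \<and> compactin Y (b s)" if U: "openin Y U" "x \<in> U" for U x
  proof -
    obtain E where E: "compact_open Y E" "x \<in> E" "E \<subseteq> U"
      using omega_Stone_base[OF Y U] .
    then obtain k where k: "E = D k"
      using D by blast
    have "x \<in> b []"
      using E compact_open_subset root by blast
    then obtain s where s: "length s = 2 * k + 2" "x \<in> b s"
      using cell_tree_branch[of b, OF b(1)] by blast
    then have "b (True # s) = b s \<inter> E"
      using hc[of s] by (simp add: dec_def b_def c k)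
    moreover from this have "compactin Y (b (True # s))"
      using closed_compactin E(1) clopenab by (metis compact_open_def inf_le2)
    ultimately show ?thesis
      using s E by blast
  qed
  show ?thesis
    using clopenab by (intro homeomorphic_space_cell_trees[OF root a b _ _ _ _ emptyab cptab basea baseb Haus]) auto
qed

subsection \<open>Countable ordinals\<close>

lemma less_osuc_iff: "\<xi> < osuc \<eta> \<longleftrightarrow> \<xi> \<le> \<eta>"
  using osuc_le_iff[of \<eta> \<xi>] by (auto simp: not_le[symmetric])

lemma omega1_cases:
  obtains "\<xi> = 0" | \<eta> where "\<xi> = osuc \<eta>" | "olimit \<xi>"
  unfolding olimit_def by blast

text \<open>Otherwise the initial segments of the elements of \<open>S\<close> would cover
  \<open>omega1\<close> by countably many countable sets.\<close>

lemma countable_omega1_bounded: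
  assumes "countable (S :: omega1 set)"
  shows "\<exists>\<eta>. \<forall>\<xi>\<in>S. \<xi> \<le> \<eta>"
proof (rule ccontr)
  assume "\<not> ?thesis"
  then have "\<eta> \<in> (\<Union>\<xi>\<in>S. {..\<xi>})" for \<eta>
    by (auto simp: not_le intro: less_imp_le)
  then have "(UNIV :: omega1 set) = (\<Union>\<xi>\<in>S. {..\<xi>})"
    by blast
  moreover have "countable (\<Union>\<xi>\<in>S. {..\<xi>})"
    using assms countable_atMost_omega1 by (intro countable_UN) auto
  ultimately show False
    using uncountable_UNIV_omega1 by simp
qed

subsection \<open>Cantor-Bendixson levels\<close>

lemma CB_subset_topspace: "CB W \<xi> \<subseteq> topspace W"
proof (cases \<xi> rule: omega1_cases)
  case 3
  then have "0 < \<xi>"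
    using omega1_zero_le[of \<xi>] by (auto simp: olimit_def less_le)
  then show ?thesis
    using CB_zero[of W] by (auto simp: CB_olimit[OF 3])
qed (auto simp: CB_zero CB_osuc derived_set_of_subset_topspace)

lemma closedin_CB:
  assumes "Hausdorff_space W"
  shows "closedin W (CB W \<xi>)"
proof (induction \<xi> rule: less_induct)
  case (less \<xi>)
  show ?case
  proof (cases \<xi> rule: omega1_cases)
    case 3
    then have "0 \<in> {..<\<xi>}"
      using omega1_zero_le[of \<xi>] by (auto simp: olimit_def less_le)
    then show ?thesis
      unfolding CB_olimit[OF 3] using less by (intro closedin_Inter) auto
  qed (auto simp: CB_zero CB_osuc closedin_derived_set_of[OF assms])
qed

lemma CB_osuc_subset: "Hausdorff_space W \<Longrightarrow> CB W (osuc \<xi>) \<subseteq> CB W \<xi>"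
  unfolding CB_osuc by (simp add: derived_set_subset CB_subset_topspace closedin_CB)

lemma CB_antimono:
  assumes W: "Hausdorff_space W"
  shows "\<xi> \<le> \<eta> \<Longrightarrow> CB W \<eta> \<subseteq> CB W \<xi>"
proof (induction \<eta> rule: less_induct)
  case (less \<eta>)
  show ?case
  proof (cases "\<xi> = \<eta>")
    case False
    with less.prems have "\<xi> < \<eta>"
      by simp
    show ?thesis
    proof (cases \<eta> rule: omega1_cases)
      case 1
      with \<open>\<xi> < \<eta>\<close> show ?thesis
        using omega1_zero_le[of \<xi>] by (simp add: not_le[symmetric])
    next
      case (2 \<zeta>)
      then have "\<xi> \<le> \<zeta>" "\<zeta> < \<eta>"
        using \<open>\<xi> < \<eta>\<close> by (simp_all add: less_osuc_iff less_osuc)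
      then show ?thesis
        using less.IH[of \<zeta>] CB_osuc_subset[OF W, of \<zeta>] 2 by auto
    next
      case 3
      then show ?thesis
        using \<open>\<xi> < \<eta>\<close> by (auto simp: CB_olimit)
    qed
  qed simp
qed

text \<open>Derivation is local: inside an open set the derived set depends only on the part of the
  set in there. Hence once \<open>U\<close> sees no change from one derivative to the next, it never
  does again.\<close>

lemma CB_stable:
  assumes W: "Hausdorff_space W" and U: "openin W U" and eq: "U \<inter> CB W \<xi> = U \<inter> CB W (osuc \<xi>)"
  shows "\<xi> \<le> \<eta> \<Longrightarrow> U \<inter> CB W \<eta> = U \<inter> CB W \<xi>"
proof (induction \<eta> rule: less_induct)
  case (less \<eta>)
  show ?case
  proof (cases "\<xi> = \<eta>")
    case False
    with less.prems have lt: "\<xi> < \<eta>"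
      by simp
    show ?thesis
    proof (cases \<eta> rule: omega1_cases)
      case 1
      with lt show ?thesis
        using omega1_zero_le[of \<xi>] by (simp add: not_le[symmetric])
    next
      case (2 \<zeta>)
      then have "U \<inter> CB W \<zeta> = U \<inter> CB W \<xi>"
        using lt by (intro less.IH) (simp_all add: less_osuc_iff less_osuc)
      then have "U \<inter> CB W (osuc \<zeta>) = U \<inter> CB W (osuc \<xi>)"
        unfolding CB_osuc using openin_Int_derived_set_of_eq[OF U] by metis
      then show ?thesis
        using eq 2 by simp
    next
      case 3
      have "U \<inter> CB W \<xi> \<subseteq> CB W \<zeta>" if "\<zeta> < \<eta>" for \<zeta>
      proof (cases "\<xi> \<le> \<zeta>")
        case True
        then show ?thesis
          using less.IH[OF that] by blast
      next
        case False
        then show ?thesis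
          using CB_antimono[OF W, of \<zeta> \<xi>] by (auto simp: not_le less_imp_le)
      qed
      moreover have "CB W \<eta> \<subseteq> CB W \<xi>"
        using CB_antimono[OF W] lt by simp
      ultimately show ?thesis
        unfolding CB_olimit[OF 3] by blast
    qed
  qed simp
qed

text \<open>A strictly decreasing transfinite sequence of closed sets of a second countable space is
  countable: each drop is witnessed by a basic open set.\<close>

lemma CB_eventually_stable:
  assumes W: "omega_Stone_space W"
  shows "\<exists>\<xi>. CB W \<xi> = CB W (osuc \<xi>)"
proof (rule ccontr)
  assume no: "\<not> ?thesis"
  note H = omega_Stone_spaceD(3)[OF W]
  have "\<exists>A. compact_open W A \<and> A \<inter> CB W \<xi> \<noteq> {} \<and> A \<inter> CB W (osuc \<xi>) = {}" for \<xi>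
  proof -
    obtain x where x: "x \<in> CB W \<xi>" "x \<notin> CB W (osuc \<xi>)"
      using no CB_osuc_subset[OF H, of \<xi>] by blast
    have "openin W (topspace W - CB W (osuc \<xi>))"
      using closedin_CB[OF H] by blast
    moreover have "x \<in> topspace W - CB W (osuc \<xi>)"
      using x CB_subset_topspace[of W \<xi>] by blast
    ultimately obtain A where "compact_open W A" "x \<in> A" "A \<subseteq> topspace W - CB W (osuc \<xi>)"
      by (rule omega_Stone_base[OF W])
    then show ?thesis
      using x by blast
  qed
  then obtain A where A: "\<And>\<xi>. compact_open W (A \<xi>)" "\<And>\<xi>. A \<xi> \<inter> CB W \<xi> \<noteq> {}"
      "\<And>\<xi>. A \<xi> \<inter> CB W (osuc \<xi>) = {}"
    by metis
  have "A \<xi> \<noteq> A \<eta>" if "\<xi> < \<eta>" for \<xi> \<eta>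
  proof -
    have "CB W \<eta> \<subseteq> CB W (osuc \<xi>)"
      using that by (intro CB_antimono[OF H]) (simp add: osuc_le_iff)
    then show ?thesis
      using A(2)[of \<eta>] A(3)[of \<xi>] by auto
  qed
  then have "inj A"
    by (metis injI linorder_neqE)
  moreover have "countable (range A)"
    using A(1) by (intro countable_subset[OF _ countable_compact_open[OF omega_Stone_spaceD(4)[OF W]]]) auto
  ultimately show False
    using countable_image_inj_eq uncountable_UNIV_omega1 by blast
qed

lemma CB_nu:
  assumes "omega_Stone_space W"
  shows "CB W (osuc (nu W)) = kernel W"
  unfolding kernel_def nu_def using LeastI_ex[OF CB_eventually_stable[OF assms]] by simp

lemma kernel_subset_topspace: "kernel W \<subseteq> topspace W"
  by (simp add: kernel_def CB_subset_topspace)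

lemma closedin_kernel: "Hausdorff_space W \<Longrightarrow> closedin W (kernel W)"
  by (simp add: kernel_def closedin_CB)

lemma derived_set_of_kernel: "omega_Stone_space W \<Longrightarrow> W derived_set_of (kernel W) = kernel W"
  using CB_nu[of W] by (simp add: CB_osuc kernel_def)

lemma CB_eq_kernel:
  assumes W: "omega_Stone_space W" and "nu W \<le> \<xi>"
  shows "CB W \<xi> = kernel W"
proof -
  have "topspace W \<inter> CB W \<xi> = topspace W \<inter> CB W (nu W)"
    using CB_nu[OF W]
    by (intro CB_stable[OF omega_Stone_spaceD(3)[OF W] openin_topspace _ assms(2)]) (simp add: kernel_def)
  then show ?thesis
    using CB_subset_topspace[of W] by (metis inf.absorb2 kernel_def)
qed

lemma kernel_subset_CB:
  assumes W: "omega_Stone_space W"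
  shows "kernel W \<subseteq> CB W \<xi>"
proof (cases "nu W \<le> \<xi>")
  case True
  then show ?thesis
    using CB_eq_kernel[OF W] by simp
next
  case False
  then show ?thesis
    using CB_antimono[OF omega_Stone_spaceD(3)[OF W], of \<xi> "nu W"] by (simp add: kernel_def)
qed

lemma CB_level_disjoint_kernel:
  "omega_Stone_space W \<Longrightarrow> CB_level W \<xi> \<inter> kernel W = {}"
  using kernel_subset_CB[of W "osuc \<xi>"] by (auto simp: CB_level_def)

lemma CB_level_subset: "CB_level W \<xi> \<subseteq> CB W \<xi>"
  by (auto simp: CB_level_def)

lemma CB_level_unique:
  assumes W: "Hausdorff_space W" and "x \<in> CB_level W \<xi>" "x \<in> CB_level W \<eta>"
  shows "\<xi> = \<eta>"
proof (rule ccontr)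
  assume "\<xi> \<noteq> \<eta>"
  then consider "osuc \<xi> \<le> \<eta>" | "osuc \<eta> \<le> \<xi>"
    unfolding osuc_le_iff by (metis linorder_neqE)
  then show False
  proof cases
    case 1
    then show False
      using CB_antimono[OF W 1] assms(2,3) by (auto simp: CB_level_def)
  next
    case 2
    then show False
      using CB_antimono[OF W 2] assms(2,3) by (auto simp: CB_level_def)
  qed
qed

text \<open>The least derivative \<open>\<zeta>\<close> that omits \<open>x\<close> cannot be a
  limit, because there the derivative is an intersection, nor zero. So it is a successor, and its
  predecessor is the level of \<open>x\<close>.\<close>

lemma CB_level_exists:
  assumes W: "omega_Stone_space W" and x: "x \<in> CB W \<xi>" "x \<notin> kernel W"
  shows "\<exists>\<eta>\<ge>\<xi>. x \<in> CB_level W \<eta>"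
proof -
  define \<zeta> where "\<zeta> = (LEAST \<zeta>. x \<notin> CB W \<zeta>)"
  have \<zeta>: "x \<notin> CB W \<zeta>"
    unfolding \<zeta>_def by (rule LeastI[of _ "nu W"]) (use x(2) in \<open>simp add: kernel_def\<close>)
  have less: "x \<in> CB W \<eta>" if "\<eta> < \<zeta>" for \<eta>
    using not_less_Least[of \<eta> "\<lambda>\<zeta>. x \<notin> CB W \<zeta>"] that by (simp add: \<zeta>_def)
  have "\<xi> < \<zeta>"
    using \<zeta> x(1) CB_antimono[OF omega_Stone_spaceD(3)[OF W], of \<zeta> \<xi>] by (auto simp: not_le[symmetric])
  show ?thesis
  proof (cases \<zeta> rule: omega1_cases)
    case 1
    then show ?thesis
      using \<open>\<xi> < \<zeta>\<close> omega1_zero_le[of \<xi>] by (simp add: not_le[symmetric])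
  next
    case (2 \<eta>)
    then have "x \<in> CB_level W \<eta>"
      using \<zeta> less[of \<eta>] by (simp add: CB_level_def less_osuc)
    then show ?thesis
      using \<open>\<xi> < \<zeta>\<close> 2 by (auto simp: less_osuc_iff)
  next
    case 3
    then show ?thesis
      using \<zeta> less by (auto simp: CB_olimit)
  qed
qed

lemma CB_level_nu: "omega_Stone_space W \<Longrightarrow> nu W \<le> \<xi> \<Longrightarrow> CB_level W \<xi> = {}"
  using CB_eq_kernel[of W \<xi>] kernel_subset_CB[of W "osuc \<xi>"] by (auto simp: CB_level_def)

lemma openin_Diff_finite:
  assumes "Hausdorff_space W" "openin W U" "finite F"
  shows "openin W (U - F)"
proof -
  have "U - F = U - F \<inter> topspace W"
    using openin_subset[OF assms(2)] by blast
  moreover have "closedin W (F \<inter> topspace W)"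
    using assms by (intro closedin_Hausdorff_finite) auto
  ultimately show ?thesis
    using assms(2) by (metis openin_diff)
qed

text \<open>If \<open>U\<close> had finitely many points of level \<open>\<xi>\<close>, deleting
  them would leave an open neighbourhood of \<open>x\<close> in which the derivatives are stable
  from \<open>\<xi>\<close> on, but \<open>x\<close> disappears after \<open>\<eta>\<close>.\<close>

lemma infinite_lower_level:
  assumes W: "omega_Stone_space W" and U: "openin W U" and x: "x \<in> U" "x \<in> CB_level W \<eta>" and "\<xi> < \<eta>"
  shows "infinite (U \<inter> CB_level W \<xi>)"
proof
  note H = omega_Stone_spaceD(3)[OF W]
  assume fin: "finite (U \<inter> CB_level W \<xi>)"
  let ?V = "U - U \<inter> CB_level W \<xi>"
  have V: "openin W ?V"
    by (rule openin_Diff_finite[OF H U fin])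
  have eq: "?V \<inter> CB W \<xi> = ?V \<inter> CB W (osuc \<xi>)"
    using CB_osuc_subset[OF H, of \<xi>] by (auto simp: CB_level_def)
  have "x \<notin> CB_level W \<xi>"
    using CB_level_unique[OF H x(2), of \<xi>] assms(5) by auto
  then have "x \<in> ?V"
    using x(1) by simp
  moreover have "x \<in> CB W \<xi>"
    using x(2) CB_antimono[OF H less_imp_le[OF assms(5)]] by (auto simp: CB_level_def)
  moreover have "?V \<inter> CB W (osuc \<eta>) = ?V \<inter> CB W \<xi>"
    using assms(5) less_osuc[of \<eta>] by (intro CB_stable[OF H V eq]) (simp add: less_osuc_iff less_imp_le)
  ultimately show False
    using x(2) by (auto simp: CB_level_def)
qed

subsection \<open>The rank function on the perfect kernel\<close>

lemma closure_CB_Diff_subset: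
  "Hausdorff_space W \<Longrightarrow> W closure_of (CB W \<xi> - kernel W) \<subseteq> CB W \<xi>"
  by (rule closure_of_minimal) (auto simp: closedin_CB)

text \<open>The closures decrease with \<open>\<xi>\<close>, so the least index that omits
  \<open>x\<close> is a threshold. Such an index exists since \<open>CB W (nu W) - kernel W\<close>
  is empty.\<close>

lemma less_rank_fun_iff:
  assumes W: "omega_Stone_space W"
  shows "\<xi> < rank_fun W x \<longleftrightarrow> x \<in> W closure_of (CB W \<xi> - kernel W)"
proof
  show "\<xi> < rank_fun W x \<Longrightarrow> x \<in> W closure_of (CB W \<xi> - kernel W)"
    unfolding rank_fun_def using not_less_Least[of \<xi>] by auto
  assume x: "x \<in> W closure_of (CB W \<xi> - kernel W)"
  have "x \<notin> W closure_of (CB W (nu W) - kernel W)"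
    by (simp add: kernel_def)
  then have nin: "x \<notin> W closure_of (CB W (rank_fun W x) - kernel W)"
    unfolding rank_fun_def by (rule LeastI)
  show "\<xi> < rank_fun W x"
  proof (rule ccontr)
    assume "\<not> \<xi> < rank_fun W x"
    then have "CB W \<xi> - kernel W \<subseteq> CB W (rank_fun W x) - kernel W"
      using CB_antimono[OF omega_Stone_spaceD(3)[OF W], of "rank_fun W x" \<xi>] by (auto simp: not_less)
    then show False
      using closure_of_mono x nin by blast
  qed
qed

lemma kernel_above_eq:
  "omega_Stone_space W \<Longrightarrow> kernel_above W \<xi> = kernel W \<inter> W closure_of (CB W \<xi> - kernel W)"
  by (auto simp: kernel_above_def less_rank_fun_iff)

lemma closedin_kernel_above:
  "omega_Stone_space W \<Longrightarrow> closedin W (kernel_above W \<xi>)"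
  by (simp add: kernel_above_eq closedin_Int closedin_kernel omega_Stone_spaceD(3))

text \<open>After deleting finitely many points of level \<open>\<xi>\<close>, points outside the
  kernel of level at least \<open>\<xi>\<close> remain near \<open>x\<close>. Their level is then
  strictly larger, so they bring infinitely many points of level \<open>\<xi>\<close> with
  them.\<close>

lemma infinite_level_near_kernel:
  assumes W: "omega_Stone_space W" and U: "openin W U" and x: "x \<in> U" "x \<in> kernel W" "\<xi> < rank_fun W x"
  shows "infinite (U \<inter> CB_level W \<xi>)"
proof
  note H = omega_Stone_spaceD(3)[OF W]
  assume fin: "finite (U \<inter> CB_level W \<xi>)"
  let ?V = "U - U \<inter> CB_level W \<xi>"
  have V: "openin W ?V"
    by (rule openin_Diff_finite[OF H U fin])
  have "x \<in> ?V"
    using x CB_level_disjoint_kernel[OF W, of \<xi>] by auto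
  then obtain y where y: "y \<in> CB W \<xi> - kernel W" "y \<in> ?V"
    using x(3) V unfolding less_rank_fun_iff[OF W] in_closure_of by metis
  then obtain \<eta> where \<eta>: "\<xi> \<le> \<eta>" "y \<in> CB_level W \<eta>"
    using CB_level_exists[OF W, of y \<xi>] by auto
  then have "\<xi> < \<eta>"
    using y(2) by (cases "\<xi> = \<eta>") auto
  then have "infinite (?V \<inter> CB_level W \<xi>)"
    using infinite_lower_level[OF W V y(2) \<eta>(2)] by simp
  moreover have "?V \<inter> CB_level W \<xi> = {}"
    by blast
  ultimately show False
    by simp
qed

text \<open>A compact set can only have infinitely many points of level \<open>\<xi>\<close> for one
  of two reasons: a kernel point of rank above \<open>\<xi>\<close>, or a topmost level. Excluding
  the former, the part \<open>Q\<close> of \<open>A\<close> near levels from \<open>\<xi>\<close> on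
  is compact and misses the kernel, so its levels have a maximum \<open>\<eta>\<close>; level
  \<open>\<eta>\<close> is finite, since an accumulation point of it in \<open>A\<close> would lie
  in \<open>Q\<close> at a higher level.\<close>

lemma infinite_level_cases:
  assumes W: "omega_Stone_space W" and A: "compactin W A" and inf: "infinite (A \<inter> CB_level W \<xi>)"
    and no: "\<And>x. x \<in> A \<Longrightarrow> x \<in> kernel W \<Longrightarrow> \<not> \<xi> < rank_fun W x"
  obtains \<eta> where "\<xi> < \<eta>" "finite (A \<inter> CB_level W \<eta>)" "A \<inter> CB_level W \<eta> \<noteq> {}"
proof -
  note H = omega_Stone_spaceD(3)[OF W]
  define C where "C = W closure_of (CB W \<xi> - kernel W)"
  define Q where "Q = A \<inter> C"
  have cQ: "compactin W Q"
    unfolding Q_def C_def using A by (simp add: compact_Int_closedin)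
  have lev: "CB_level W \<eta> \<subseteq> C" if "\<xi> \<le> \<eta>" for \<eta>
  proof -
    have "CB_level W \<eta> \<subseteq> CB W \<xi> - kernel W"
      using CB_antimono[OF H that] CB_level_disjoint_kernel[OF W, of \<eta>] by (auto simp: CB_level_def)
    also have "\<dots> \<subseteq> C"
      unfolding C_def using CB_subset_topspace[of W \<xi>] by (intro closure_of_subset) auto
    finally show ?thesis .
  qed
  have QK: "x \<notin> kernel W" if "x \<in> Q" for x
    using no[of x] that less_rank_fun_iff[OF W] by (auto simp: Q_def C_def)
  have "\<exists>\<eta>\<ge>\<xi>. x \<in> CB_level W \<eta>" if "x \<in> Q" for x
    using CB_level_exists[OF W, of x \<xi>] QK[OF that] that closure_CB_Diff_subset[OF H, of \<xi>]
    by (auto simp: Q_def C_def)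
  then obtain l where l: "\<And>x. x \<in> Q \<Longrightarrow> \<xi> \<le> l x \<and> x \<in> CB_level W (l x)"
    by metis
  \<comment> \<open>These open sets grow with \<open>\<eta>\<close>, so a finite subcover is
    dominated by its largest index.\<close>
  let ?V = "\<lambda>\<eta>. topspace W - CB W (osuc \<eta>)"
  have "Q \<subseteq> (\<Union>x\<in>Q. ?V (l x))"
    using l compactin_subset_topspace[OF cQ] by (fastforce simp: CB_level_def)
  then have "\<exists>\<F>. finite \<F> \<and> \<F> \<subseteq> (\<lambda>x. ?V (l x)) ` Q \<and> Q \<subseteq> \<Union>\<F>"
    using closedin_CB[OF H] by (intro compactinD[OF cQ]) (auto simp: openin_diff)
  then obtain \<F> where F: "finite \<F>" "\<F> \<subseteq> (\<lambda>x. ?V (l x)) ` Q" "Q \<subseteq> \<Union>\<F>"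
    by blast
  then obtain P where P: "finite P" "P \<subseteq> Q" "\<F> = (\<lambda>x. ?V (l x)) ` P"
    using finite_subset_image by metis
  have "Q \<noteq> {}"
    using inf lev[of \<xi>] by (auto simp: Q_def dest: infinite_imp_nonempty)
  then have "P \<noteq> {}"
    using F P by auto
  define \<eta> where "\<eta> = Max (l ` P)"
  have "\<eta> \<in> l ` P"
    unfolding \<eta>_def using P \<open>P \<noteq> {}\<close> by (intro Max_in) auto
  then obtain y where y: "y \<in> P" "\<eta> = l y"
    by blast
  then have y': "y \<in> Q" "\<xi> \<le> \<eta>" "y \<in> CB_level W \<eta>"
    using l P by auto
  have Q\<eta>: "x \<notin> CB W (osuc \<eta>)" if "x \<in> Q" for x
  proof -
    obtain p where p: "p \<in> P" "x \<notin> CB W (osuc (l p))"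
      using subsetD[OF F(3) \<open>x \<in> Q\<close>] P(3) by auto
    have "l p \<le> \<eta>"
      unfolding \<eta>_def using P p by (intro Max_ge) auto
    then have "osuc (l p) \<le> osuc \<eta>"
      by (simp add: osuc_le_iff less_osuc_iff)
    then show ?thesis
      using CB_antimono[OF H] p(2) by blast
  qed
  have fin: "finite (A \<inter> CB_level W \<eta>)"
  proof (rule ccontr)
    assume "infinite (A \<inter> CB_level W \<eta>)"
    then have "A \<inter> W derived_set_of (A \<inter> CB_level W \<eta>) \<noteq> {}"
      using A by (intro compactin_imp_Bolzano_Weierstrass) auto
    then obtain z where z: "z \<in> A" "z \<in> W derived_set_of (A \<inter> CB_level W \<eta>)"
      by blast
    have "W derived_set_of (A \<inter> CB_level W \<eta>) \<subseteq> W derived_set_of (CB W \<eta>)"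
      by (rule derived_set_of_mono) (auto simp: CB_level_def)
    then have "z \<in> CB W (osuc \<eta>)"
      using z by (auto simp: CB_osuc)
    moreover have "W derived_set_of (A \<inter> CB_level W \<eta>) \<subseteq> W closure_of C"
      using derived_set_of_mono[of "A \<inter> CB_level W \<eta>" C W] lev[OF y'(2)]
        derived_set_of_subset_closure_of[of W C] by blast
    then have "z \<in> C"
      using z by (auto simp: C_def)
    ultimately show False
      using Q\<eta> z(1) by (simp add: Q_def)
  qed
  moreover have "\<xi> \<noteq> \<eta>"
    using fin inf by auto
  ultimately show ?thesis
    using y' by (intro that[of \<eta>]) (auto simp: Q_def)
qed

lemma level_isolated:
  assumes "x \<in> CB_level W \<gamma>"
  obtains T where "openin W T" "x \<in> T" "T \<inter> CB W \<gamma> = {x}"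
proof -
  have x: "x \<in> CB W \<gamma>" "x \<notin> W derived_set_of (CB W \<gamma>)"
    using assms by (auto simp: CB_level_def CB_osuc)
  then obtain T where "openin W T" "x \<in> T" "\<And>y. y \<noteq> x \<Longrightarrow> y \<in> CB W \<gamma> \<Longrightarrow> y \<notin> T"
    using CB_subset_topspace[of W \<gamma>] unfolding in_derived_set_of by blast
  then show ?thesis
    using x(1) by (intro that[of T]) auto
qed

text \<open>\<open>D\<close> is interposed between the compact set \<open>L \<union> F\<close> and
  the open set left after removing from \<open>U\<close> the unwanted part of the kernel and the
  closure of the unwanted points of \<open>CB W \<gamma>\<close>. The rank bound keeps
  \<open>L\<close> off that closure, and \<open>F\<close> stays off it because points of level
  \<open>\<gamma>\<close> are isolated in \<open>CB W \<gamma>\<close>.\<close>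

lemma compact_open_prescribed:
  assumes W: "omega_Stone_space W" and U: "openin W U"
    and L: "compactin W L" "L \<subseteq> U \<inter> kernel W" "closedin W (kernel W - L)"
      "\<And>x. x \<in> L \<Longrightarrow> rank_fun W x \<le> \<gamma>"
    and F: "finite F" "F \<subseteq> U \<inter> CB_level W \<gamma>"
  obtains D where "compact_open W D" "D \<subseteq> U" "D \<inter> kernel W = L" "F \<subseteq> D" "D \<inter> CB W \<gamma> \<subseteq> kernel W \<union> F"
proof -
  note H = omega_Stone_spaceD(3)[OF W]
  let ?C = "W closure_of (CB W \<gamma> - kernel W - F)"
  let ?O = "U - ?C - (kernel W - L)"
  have top: "CB W \<gamma> - kernel W - F \<subseteq> topspace W"
    using CB_subset_topspace[of W \<gamma>] by auto
  have "x \<notin> ?C" if "x \<in> L" for x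
  proof -
    have "x \<notin> W closure_of (CB W \<gamma> - kernel W)"
      using L(4)[OF that] less_rank_fun_iff[OF W, of \<gamma> x] by auto
    moreover have "?C \<subseteq> W closure_of (CB W \<gamma> - kernel W)"
      by (rule closure_of_mono) auto
    ultimately show ?thesis
      by blast
  qed
  moreover have "x \<notin> ?C" if x: "x \<in> F" for x
  proof -
    have "x \<in> CB_level W \<gamma>"
      using x F by auto
    then obtain T where T: "openin W T" "x \<in> T" "T \<inter> CB W \<gamma> = {x}"
      by (rule level_isolated)
    then have "\<not> (\<exists>y. y \<in> CB W \<gamma> - kernel W - F \<and> y \<in> T)"
      using x by auto
    then show ?thesis
      using T unfolding in_closure_of by blast
  qed
  ultimately have "L \<union> F \<subseteq> ?O"
    using L(2) F(2) CB_level_disjoint_kernel[OF W, of \<gamma>] by blast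
  moreover have "openin W ?O"
    using U L(3) by (intro openin_diff) auto
  moreover have "compactin W (L \<union> F)"
    using F openin_subset[OF U] by (intro compactin_Un L(1) finite_imp_compactin) auto
  ultimately obtain D where D: "compact_open W D" "L \<union> F \<subseteq> D" "D \<subseteq> ?O"
    using omega_Stone_compact_between[OF W] by metis
  have "CB W \<gamma> - kernel W - F \<subseteq> ?C"
    using top by (rule closure_of_subset)
  then show ?thesis
    using D L(2) by (intro that[of D]) auto
qed

subsection \<open>Matching compact open sets along an isomorphism of ranked kernels\<close>

text \<open>As \<open>card\<close> is zero on infinite sets, finiteness has to be compared
  separately.\<close>

definition same_levels :: "'a topology \<Rightarrow> 'b topology \<Rightarrow> 'a set \<Rightarrow> 'b set \<Rightarrow> bool"
  where "same_levels W X A B \<longleftrightarrow>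
    (\<forall>\<xi>. (finite (A \<inter> CB_level W \<xi>) \<longleftrightarrow> finite (B \<inter> CB_level X \<xi>)) \<and>
      card (A \<inter> CB_level W \<xi>) = card (B \<inter> CB_level X \<xi>))"

definition matched :: "'a topology \<Rightarrow> 'b topology \<Rightarrow> ('a \<Rightarrow> 'b) \<Rightarrow> 'a set \<Rightarrow> 'b set \<Rightarrow> bool"
  where "matched W X \<phi> A B \<longleftrightarrow> compact_open W A \<and> compact_open X B \<and>
    \<phi> ` (A \<inter> kernel W) = B \<inter> kernel X \<and> same_levels W X A B"

lemma same_levels_sym: "same_levels W X A B \<Longrightarrow> same_levels X W B A"
  by (simp add: same_levels_def)

lemma empty_above_finite_level:
  assumes W: "omega_Stone_space W" and A: "openin W A" and fin: "finite (A \<inter> CB_level W \<gamma>)"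
    and "\<gamma> < \<eta>"
  shows "A \<inter> CB_level W \<eta> = {}"
  using infinite_lower_level[OF W A _ _ assms(4)] fin by auto

lemma finite_above_finite_level:
  assumes W: "omega_Stone_space W" and A: "openin W A" and fin: "finite (A \<inter> CB_level W \<gamma>)"
    and "\<gamma> \<le> \<eta>"
  shows "finite (A \<inter> CB_level W \<eta>)"
  using empty_above_finite_level[OF W A fin, of \<eta>] assms(3,4) by (cases "\<gamma> = \<eta>") auto

text \<open>For open \<open>A\<close> this is the level \<open>\<alpha>\<close> of the overview:
  later levels of \<open>A\<close> are empty, because a single point there would make this one
  infinite.\<close>

definition first_finite_level :: "'a topology \<Rightarrow> 'a set \<Rightarrow> omega1"
  where "first_finite_level W A = (LEAST \<xi>. finite (A \<inter> CB_level W \<xi>))"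

lemma finite_level_iff:
  assumes W: "omega_Stone_space W" and A: "openin W A"
  shows "finite (A \<inter> CB_level W \<xi>) \<longleftrightarrow> first_finite_level W A \<le> \<xi>"
proof
  show "finite (A \<inter> CB_level W \<xi>) \<Longrightarrow> first_finite_level W A \<le> \<xi>"
    unfolding first_finite_level_def by (rule Least_le)
  have "finite (A \<inter> CB_level W (nu W))"
    by (simp add: CB_level_nu[OF W])
  then have "finite (A \<inter> CB_level W (first_finite_level W A))"
    unfolding first_finite_level_def by (rule LeastI)
  then show "first_finite_level W A \<le> \<xi> \<Longrightarrow> finite (A \<inter> CB_level W \<xi>)"
    by (rule finite_above_finite_level[OF W A])
qed

lemma exists_level:
  assumes W: "omega_Stone_space W" and "x \<in> topspace W" "x \<notin> kernel W"
  shows "\<exists>\<eta>. x \<in> CB_level W \<eta>"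
  using CB_level_exists[OF W, of x 0] assms(2,3) by (auto simp: CB_zero)

text \<open>Both directions of the homeomorphism are fixed, so that exchanging the spaces gives
  another instance and each forward step also yields the backward one.\<close>

locale kernel_iso =
  fixes W :: "'a topology" and X :: "'b topology" and \<phi> :: "'a \<Rightarrow> 'b" and \<psi> :: "'b \<Rightarrow> 'a"
  assumes W: "omega_Stone_space W" and X: "omega_Stone_space X"
    and hom: "homeomorphic_maps (subtopology W (kernel W)) (subtopology X (kernel X)) \<phi> \<psi>"
    and rank: "\<And>w. w \<in> kernel W \<Longrightarrow> rank_fun X (\<phi> w) = rank_fun W w"
begin

lemmas HW = omega_Stone_spaceD(3)[OF W]
lemmas HX = omega_Stone_spaceD(3)[OF X]

lemma phi_in: "w \<in> kernel W \<Longrightarrow> \<phi> w \<in> kernel X"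
  using hom kernel_subset_topspace[of W]
  by (auto simp: homeomorphic_maps_def continuous_map_in_subtopology subset_iff image_subset_iff)

lemma psi_in: "x \<in> kernel X \<Longrightarrow> \<psi> x \<in> kernel W"
  using hom kernel_subset_topspace[of X]
  by (auto simp: homeomorphic_maps_def continuous_map_in_subtopology subset_iff image_subset_iff)

lemma psi_phi: "w \<in> kernel W \<Longrightarrow> \<psi> (\<phi> w) = w"
  using hom kernel_subset_topspace[of W] by (auto simp: homeomorphic_maps_def)

lemma inj_phi: "inj_on \<phi> (kernel W)"
  using psi_phi by (rule inj_on_inverseI)

lemma phi_psi: "x \<in> kernel X \<Longrightarrow> \<phi> (\<psi> x) = x"
  using hom kernel_subset_topspace[of X] by (auto simp: homeomorphic_maps_def)

lemma flip: "kernel_iso X W \<psi> \<phi>"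
proof
  show "homeomorphic_maps (subtopology X (kernel X)) (subtopology W (kernel W)) \<psi> \<phi>"
    using hom homeomorphic_maps_sym by blast
  show "rank_fun W (\<psi> x) = rank_fun X x" if "x \<in> kernel X" for x
    using rank[OF psi_in[OF that]] phi_psi[OF that] by simp
qed (rule X, rule W)

lemma phi_image_eq_flip:
  assumes "\<phi> ` (A \<inter> kernel W) = B \<inter> kernel X"
  shows "\<psi> ` (B \<inter> kernel X) = A \<inter> kernel W"
proof -
  have "\<psi> ` (B \<inter> kernel X) = (\<lambda>w. \<psi> (\<phi> w)) ` (A \<inter> kernel W)"
    by (simp add: assms[symmetric] image_image)
  also have "\<dots> = A \<inter> kernel W"
    using psi_phi by force
  finally show ?thesis .
qed

lemma matched_flip: "matched W X \<phi> A B \<Longrightarrow> matched X W \<psi> B A"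
  using phi_image_eq_flip[of A B] same_levels_sym[of W X A B] by (simp add: matched_def)

lemma compactin_phi_image:
  assumes "compactin W A" "A \<subseteq> kernel W"
  shows "compactin X (\<phi> ` A)"
proof -
  have "compactin (subtopology X (kernel X)) (\<phi> ` A)"
    using assms hom
    by (intro image_compactin[of "subtopology W (kernel W)"])
      (auto simp: compactin_subtopology homeomorphic_maps_def)
  then show ?thesis
    by (simp add: compactin_subtopology)
qed

lemma closedin_phi_image:
  assumes "closedin W A" "A \<subseteq> kernel W"
  shows "closedin X (\<phi> ` A)"
proof -
  have "closedin (subtopology X (kernel X)) (\<phi> ` A)"
    using homeomorphic_map_closedness[OF homeomorphic_maps_imp_map[OF hom], of A] assms
      closedin_subset[OF assms(1)] by (simp add: closedin_subset_topspace)
  then show ?thesis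
    by (rule closedin_trans_full) (rule closedin_kernel[OF HX])
qed

lemma matched_empty_left:
  assumes "matched W X \<phi> {} B"
  shows "B = {}"
proof (rule ccontr)
  assume "B \<noteq> {}"
  then obtain x where x: "x \<in> B" "x \<in> topspace X"
    using assms compact_open_subset[of X B] by (auto simp: matched_def)
  show False
  proof (cases "x \<in> kernel X")
    case True
    then show ?thesis
      using assms x by (auto simp: matched_def)
  next
    case False
    then obtain \<eta> where \<eta>: "x \<in> CB_level X \<eta>"
      using exists_level[OF X x(2)] by blast
    have "finite (B \<inter> CB_level X \<eta>)" "card (B \<inter> CB_level X \<eta>) = 0"
      using assms by (auto simp: matched_def same_levels_def)
    then show ?thesis
      using x(1) \<eta> by auto
  qed
qed

lemma matched_empty_iff: "matched W X \<phi> A B \<Longrightarrow> A = {} \<longleftrightarrow> B = {}"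
  using matched_empty_left kernel_iso.matched_empty_left[OF flip] matched_flip by metis

text \<open>Only the level \<open>\<gamma>\<close> where the counts of \<open>C\<close> become
  finite has to be copied exactly, by choosing \<open>F\<close>. Above it both sides are empty, and
  below it infinitude is inherited from a kernel point of large rank or from a point of
  \<open>F\<close>. The hypothesis \<open>room\<close> supplies enough points of that level.\<close>

lemma exists_matched:
  assumes C: "compact_open W C" and U: "openin X U" "\<phi> ` (C \<inter> kernel W) \<subseteq> U"
    and room: "\<And>\<gamma>. finite (C \<inter> CB_level W \<gamma>) \<Longrightarrow> C \<inter> CB_level W \<gamma> \<noteq> {} \<Longrightarrow>
      \<exists>F. finite F \<and> F \<subseteq> U \<inter> CB_level X \<gamma> \<and> card F = card (C \<inter> CB_level W \<gamma>)"
  obtains D where "D \<subseteq> U" "matched W X \<phi> C D"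
proof -
  have C': "openin W C" "compactin W C"
    using C by (auto simp: compact_open_def)
  define \<gamma> where "\<gamma> = first_finite_level W C"
  note fin_iff = finite_level_iff[OF W C'(1), folded \<gamma>_def]
  have fin: "finite (C \<inter> CB_level W \<gamma>)"
    by (simp add: fin_iff)
  have "\<exists>F. finite F \<and> F \<subseteq> U \<inter> CB_level X \<gamma> \<and> card F = card (C \<inter> CB_level W \<gamma>)"
  proof (cases "C \<inter> CB_level W \<gamma> = {}")
    case True
    then show ?thesis
      by (intro exI[of _ "{}"]) simp
  qed (use room fin in simp)
  then obtain F where F: "finite F" "F \<subseteq> U \<inter> CB_level X \<gamma>" "card F = card (C \<inter> CB_level W \<gamma>)"
    by blast
  let ?L = "\<phi> ` (C \<inter> kernel W)"
  have "compactin W (C \<inter> kernel W)"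
    using C'(2) closedin_kernel[OF HW] by (simp add: compact_Int_closedin)
  then have L: "compactin X ?L"
    by (intro compactin_phi_image) auto
  have LK: "?L \<subseteq> U \<inter> kernel X"
    using U(2) phi_in by auto
  have "kernel X - ?L = \<phi> ` (kernel W - C)"
  proof (intro equalityI subsetI)
    fix x assume x: "x \<in> kernel X - ?L"
    then have "\<psi> x \<in> kernel W" "\<phi> (\<psi> x) = x"
      using psi_in phi_psi by auto
    then show "x \<in> \<phi> ` (kernel W - C)"
      using x by (metis DiffD2 DiffI IntI imageI)
  next
    fix x assume "x \<in> \<phi> ` (kernel W - C)"
    then obtain w where w: "w \<in> kernel W" "w \<notin> C" "x = \<phi> w"
      by blast
    have "x \<notin> ?L"
    proof
      assume "x \<in> ?L"
      then obtain v where v: "v \<in> C" "v \<in> kernel W" "\<phi> w = \<phi> v"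
        using w(3) by auto
      then have "w = v"
        using psi_phi w(1) by metis
      then show False
        using v(1) w(2) by simp
    qed
    then show "x \<in> kernel X - ?L"
      using w phi_in by simp
  qed
  moreover have "closedin W (kernel W - C)"
    using closedin_kernel[OF HW] C'(1) by (rule closedin_diff)
  ultimately have cl: "closedin X (kernel X - ?L)"
    by (simp add: closedin_phi_image)
  \<comment> \<open>A rank above \<open>\<gamma>\<close> would force infinitely many points of level
    \<open>\<gamma>\<close> into \<open>C\<close>.\<close>
  have rk: "rank_fun X x \<le> \<gamma>" if "x \<in> ?L" for x
  proof -
    obtain w where w: "w \<in> C" "w \<in> kernel W" "x = \<phi> w"
      using \<open>x \<in> ?L\<close> by blast
    then have "\<not> \<gamma> < rank_fun W w"
      using infinite_level_near_kernel[OF W C'(1) w(1,2)] fin by blast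
    then show ?thesis
      using rank[OF w(2)] w(3) by simp
  qed
  obtain D where D: "compact_open X D" "D \<subseteq> U" "D \<inter> kernel X = ?L" "F \<subseteq> D"
      "D \<inter> CB X \<gamma> \<subseteq> kernel X \<union> F"
    using compact_open_prescribed[OF X U(1) L LK cl rk F(1,2)] by metis
  have D': "openin X D"
    using D by (simp add: compact_open_def)
  have "(finite (C \<inter> CB_level W \<xi>) \<longleftrightarrow> finite (D \<inter> CB_level X \<xi>)) \<and>
      card (C \<inter> CB_level W \<xi>) = card (D \<inter> CB_level X \<xi>)" for \<xi>
  proof -
    consider "\<xi> < \<gamma>" | "\<xi> = \<gamma>" | "\<gamma> < \<xi>"
      using linorder_less_linear by blast
    then show ?thesis
    proof cases
      case 1
      then have inf: "infinite (C \<inter> CB_level W \<xi>)"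
        by (simp add: fin_iff)
      have "infinite (D \<inter> CB_level X \<xi>)"
      proof (cases "\<exists>x. x \<in> C \<and> x \<in> kernel W \<and> \<xi> < rank_fun W x")
        case True
        then obtain x where x: "x \<in> C" "x \<in> kernel W" "\<xi> < rank_fun W x"
          by blast
        then have "\<phi> x \<in> D" "\<phi> x \<in> kernel X" "\<xi> < rank_fun X (\<phi> x)"
          using D(3) rank[of x] by auto
        then show ?thesis
          by (rule infinite_level_near_kernel[OF X D'])
      next
        case False
        then obtain \<eta> where \<eta>: "\<xi> < \<eta>" "finite (C \<inter> CB_level W \<eta>)" "C \<inter> CB_level W \<eta> \<noteq> {}"
          using infinite_level_cases[OF W C'(2) inf] by metis
        \<comment> \<open>The only level of \<open>C\<close> that can be finite and nonempty is
          \<open>\<gamma>\<close>.\<close>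
        have "\<eta> = \<gamma>"
          using \<eta>(2,3) empty_above_finite_level[OF W C'(1) fin, of \<eta>] by (auto simp: fin_iff le_less)
        then have "F \<noteq> {}"
          using \<eta> F(3) by auto
        then obtain f where "f \<in> D" "f \<in> CB_level X \<gamma>"
          using F(2) D(4) by auto
        then show ?thesis
          using infinite_lower_level[OF X D' _ _ 1] by blast
      qed
      then show ?thesis
        using inf by simp
    next
      case 2
      have "D \<inter> CB_level X \<gamma> = F"
        using F(2) D(4,5) CB_level_subset[of X \<gamma>] CB_level_disjoint_kernel[OF X, of \<gamma>] by blast
      then show ?thesis
        using 2 F fin by simp
    next
      case 3
      have "D \<inter> CB_level X \<xi> \<subseteq> D \<inter> CB X \<gamma>"
        using CB_level_subset[of X \<xi>] CB_antimono[OF HX less_imp_le[OF 3]] by blast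
      then have "D \<inter> CB_level X \<xi> \<subseteq> F"
        using D(5) CB_level_disjoint_kernel[OF X, of \<xi>] by blast
      then have "D \<inter> CB_level X \<xi> = {}"
        using F(2) CB_level_unique[OF HX, of _ \<xi> \<gamma>] 3 by blast
      moreover have "C \<inter> CB_level W \<xi> = {}"
        by (rule empty_above_finite_level[OF W C'(1) fin 3])
      ultimately show ?thesis
        by simp
    qed
  qed
  then have "matched W X \<phi> C D"
    using C D by (auto simp: matched_def same_levels_def)
  then show ?thesis
    by (rule that[OF D(2)])
qed

text \<open>\<open>A2\<close> receives its partner first; the hypothesis \<open>le\<close> makes the
  remainders match automatically.\<close>

lemma matched_split_small:
  assumes AB: "matched W X \<phi> A B" and A2: "compact_open W A2" "A2 \<subseteq> A"
    and le: "first_finite_level W A2 \<le> first_finite_level W (A - A2)"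
  obtains B2 where "B2 \<subseteq> B" "matched W X \<phi> A2 B2" "matched W X \<phi> (A - A2) (B - B2)"
proof -
  let ?A1 = "A - A2"
  have A: "compact_open W A" and B: "compact_open X B" and AK: "\<phi> ` (A \<inter> kernel W) = B \<inter> kernel X"
    and lev: "\<And>\<xi>. finite (A \<inter> CB_level W \<xi>) \<longleftrightarrow> finite (B \<inter> CB_level X \<xi>)"
      "\<And>\<xi>. card (A \<inter> CB_level W \<xi>) = card (B \<inter> CB_level X \<xi>)"
    using AB by (auto simp: matched_def same_levels_def)
  have A1: "compact_open W ?A1"
    using compact_open_Diff[OF HW] A A2 by blast
  let ?U = "B - \<phi> ` (?A1 \<inter> kernel W)"
  have "closedin W (?A1 \<inter> kernel W)"
    using compact_open_closedin[OF HW A1] closedin_kernel[OF HW] by (rule closedin_Int)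
  then have U: "openin X ?U"
    using B closedin_phi_image[of "?A1 \<inter> kernel W"] by (auto simp: compact_open_def openin_diff)
  have "\<phi> ` (A2 \<inter> kernel W) \<inter> \<phi> ` (?A1 \<inter> kernel W) = {}"
    using inj_on_image_Int[OF inj_phi, of "A2 \<inter> kernel W" "?A1 \<inter> kernel W"] by auto
  then have "\<phi> ` (A2 \<inter> kernel W) \<subseteq> ?U"
    using AK A2(2) by blast
  moreover have "\<exists>F. finite F \<and> F \<subseteq> ?U \<inter> CB_level X \<gamma> \<and> card F = card (A2 \<inter> CB_level W \<gamma>)" for \<gamma>
  proof -
    have eq: "?U \<inter> CB_level X \<gamma> = B \<inter> CB_level X \<gamma>"
      using CB_level_disjoint_kernel[OF X, of \<gamma>] phi_in by blast
    show ?thesis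
    proof (cases "finite (B \<inter> CB_level X \<gamma>)")
      case True
      then have "card (A2 \<inter> CB_level W \<gamma>) \<le> card (B \<inter> CB_level X \<gamma>)"
        unfolding lev(2)[symmetric] using A2(2) lev(1) by (intro card_mono) auto
      then show ?thesis
        unfolding eq by (metis True finite_subset obtain_subset_with_card_n)
    next
      case False
      then show ?thesis
        unfolding eq using infinite_arbitrarily_large by metis
    qed
  qed
  ultimately obtain B2 where B2: "B2 \<subseteq> ?U" "matched W X \<phi> A2 B2"
    using exists_matched[OF A2(1) U] by metis
  let ?B1 = "B - B2"
  have B2': "compact_open X B2" "\<phi> ` (A2 \<inter> kernel W) = B2 \<inter> kernel X"
    and lev2: "\<And>\<xi>. finite (A2 \<inter> CB_level W \<xi>) \<longleftrightarrow> finite (B2 \<inter> CB_level X \<xi>)"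
      "\<And>\<xi>. card (A2 \<inter> CB_level W \<xi>) = card (B2 \<inter> CB_level X \<xi>)"
    using B2 by (auto simp: matched_def same_levels_def)
  have B1: "compact_open X ?B1"
    using compact_open_Diff[OF HX] B B2'(1) by blast
  have K1: "\<phi> ` (?A1 \<inter> kernel W) = ?B1 \<inter> kernel X"
  proof -
    have "?A1 \<inter> kernel W = A \<inter> kernel W - A2 \<inter> kernel W"
      by blast
    then have "\<phi> ` (?A1 \<inter> kernel W) = \<phi> ` (A \<inter> kernel W) - \<phi> ` (A2 \<inter> kernel W)"
      using inj_on_image_set_diff[OF inj_phi, of "A \<inter> kernel W" "A2 \<inter> kernel W"] by auto
    then show ?thesis
      using AK B2'(2) by auto
  qed
  \<comment> \<open>Where \<open>A2\<close> has finitely many points, the counts of the remainders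
    follow by subtraction.\<close>
  have small: "(finite (?A1 \<inter> CB_level W \<xi>) \<longleftrightarrow> finite (?B1 \<inter> CB_level X \<xi>)) \<and>
      card (?A1 \<inter> CB_level W \<xi>) = card (?B1 \<inter> CB_level X \<xi>)"
    if fin: "finite (A2 \<inter> CB_level W \<xi>)" for \<xi>
  proof -
    have fin': "finite (B2 \<inter> CB_level X \<xi>)"
      using fin lev2 by simp
    have d: "?A1 \<inter> CB_level W \<xi> = A \<inter> CB_level W \<xi> - A2 \<inter> CB_level W \<xi>"
      "?B1 \<inter> CB_level X \<xi> = B \<inter> CB_level X \<xi> - B2 \<inter> CB_level X \<xi>"
      by auto
    have "finite (?A1 \<inter> CB_level W \<xi>) \<longleftrightarrow> finite (?B1 \<inter> CB_level X \<xi>)"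
      unfolding d using fin fin' lev(1) by simp
    moreover have "card (?A1 \<inter> CB_level W \<xi>) = card (?B1 \<inter> CB_level X \<xi>)"
      unfolding d using fin fin' lev(2) lev2(2) A2(2) B2(1)
      by (subst (1 2) card_Diff_subset) auto
    ultimately show ?thesis
      by blast
  qed
  have A1': "openin W ?A1" "compactin W ?A1" and A2': "openin W A2" and B1': "openin X ?B1"
    using A1 A2 B1 by (auto simp: compact_open_def)
  \<comment> \<open>Here subtraction says nothing. The threshold of \<open>?A1\<close> lies above
    \<open>\<xi>\<close> too, and infinitude passes to \<open>?B1\<close> through a kernel point of
    rank above \<open>\<xi>\<close>, or through a finite nonempty level \<open>\<eta>\<close> of
    \<open>?A1\<close>, where subtraction does work.\<close>
  have large: "infinite (?B1 \<inter> CB_level X \<xi>)" "infinite (?A1 \<inter> CB_level W \<xi>)"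
    if inf: "infinite (A2 \<inter> CB_level W \<xi>)" for \<xi>
  proof -
    have "\<xi> < first_finite_level W A2"
      using inf finite_level_iff[OF W A2', of \<xi>] by simp
    then have "\<xi> < first_finite_level W ?A1"
      using le by simp
    then show inf1: "infinite (?A1 \<inter> CB_level W \<xi>)"
      using finite_level_iff[OF W A1'(1), of \<xi>] by simp
    show "infinite (?B1 \<inter> CB_level X \<xi>)"
    proof (cases "\<exists>x. x \<in> ?A1 \<and> x \<in> kernel W \<and> \<xi> < rank_fun W x")
      case True
      then obtain x where x: "x \<in> ?A1" "x \<in> kernel W" "\<xi> < rank_fun W x"
        by blast
      then have "\<phi> x \<in> ?B1" "\<phi> x \<in> kernel X" "\<xi> < rank_fun X (\<phi> x)"
        using K1 rank[of x] by auto
      then show ?thesis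
        by (rule infinite_level_near_kernel[OF X B1'])
    next
      case False
      then obtain \<eta> where \<eta>: "\<xi> < \<eta>" "finite (?A1 \<inter> CB_level W \<eta>)" "?A1 \<inter> CB_level W \<eta> \<noteq> {}"
        using infinite_level_cases[OF W A1'(2) inf1] by metis
      have "first_finite_level W A2 \<le> \<eta>"
        using \<eta>(2) finite_level_iff[OF W A1'(1), of \<eta>] le by simp
      then have "finite (A2 \<inter> CB_level W \<eta>)"
        using finite_level_iff[OF W A2'] by simp
      then have "?B1 \<inter> CB_level X \<eta> \<noteq> {}"
        using small[of \<eta>] \<eta> by (metis card_0_eq card.empty)
      then show ?thesis
        using infinite_lower_level[OF X B1' _ _ \<eta>(1)] by blast
    qed
  qed
  have "same_levels W X ?A1 ?B1"
    unfolding same_levels_def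
  proof
    fix \<xi>
    show "(finite (?A1 \<inter> CB_level W \<xi>) \<longleftrightarrow> finite (?B1 \<inter> CB_level X \<xi>)) \<and>
      card (?A1 \<inter> CB_level W \<xi>) = card (?B1 \<inter> CB_level X \<xi>)"
    proof (cases "finite (A2 \<inter> CB_level W \<xi>)")
      case False
      then show ?thesis
        using large[OF False] by simp
    qed (rule small)
  qed
  then have "matched W X \<phi> ?A1 ?B1"
    using A1 B1 K1 by (simp add: matched_def)
  then show ?thesis
    using B2 by (intro that[of B2]) auto
qed

text \<open>The claim is symmetric in \<open>A'\<close> and \<open>A - A'\<close>, so the piece with
  the smaller threshold may be treated first.\<close>

lemma matched_split:
  assumes AB: "matched W X \<phi> A B" and A': "compact_open W A'" "A' \<subseteq> A"
  obtains B' where "B' \<subseteq> B" "matched W X \<phi> A' B'" "matched W X \<phi> (A - A') (B - B')"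
proof (cases "first_finite_level W A' \<le> first_finite_level W (A - A')")
  case True
  show ?thesis
    by (rule matched_split_small[OF AB A' True]) (rule that)
next
  case False
  have AA: "A - (A - A') = A'"
    using A'(2) by blast
  have "compact_open W (A - A')"
    using AB compact_open_Diff[OF HW] A'(1) by (auto simp: matched_def)
  moreover have "first_finite_level W (A - A') \<le> first_finite_level W (A - (A - A'))"
    using False AA by simp
  ultimately obtain B2 where B2: "B2 \<subseteq> B" "matched W X \<phi> (A - A') B2" "matched W X \<phi> A' (B - B2)"
    using matched_split_small[OF AB _ Diff_subset] AA by metis
  moreover have "B - (B - B2) = B2"
    using B2(1) by blast
  ultimately show ?thesis
    by (intro that[of "B - B2"]) auto
qed

end

subsection \<open>Uniqueness\<close>

text \<open>Since \<open>CB W \<xi>\<close> is closed, taking the closure of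
  \<open>CB W \<xi> - kernel W\<close> can only add kernel points, and those are the points of rank
  above \<open>\<xi>\<close>.\<close>

lemma closedin_CB_Diff_kernel_iff:
  assumes W: "omega_Stone_space W"
  shows "closedin W (CB W \<xi> - kernel W) \<longleftrightarrow> kernel_above W \<xi> = {}"
proof
  assume "closedin W (CB W \<xi> - kernel W)"
  then show "kernel_above W \<xi> = {}"
    by (auto simp: kernel_above_eq[OF W] closure_of_closedin)
next
  assume e: "kernel_above W \<xi> = {}"
  have "W closure_of (CB W \<xi> - kernel W) \<subseteq> CB W \<xi> - kernel W"
    using e closure_CB_Diff_subset[OF omega_Stone_spaceD(3)[OF W], of \<xi>]
    by (auto simp: kernel_above_eq[OF W])
  moreover have "CB W \<xi> - kernel W \<subseteq> topspace W"
    using CB_subset_topspace[of W \<xi>] by blast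
  ultimately show "closedin W (CB W \<xi> - kernel W)"
    using closure_of_subset_eq by blast
qed

lemma lambda_eq: "omega_Stone_space W \<Longrightarrow> lambda W = (LEAST \<xi>. kernel_above W \<xi> = {})"
  by (simp add: lambda_def closedin_CB_Diff_kernel_iff)

lemma kernel_above_antimono: "\<xi> \<le> \<eta> \<Longrightarrow> kernel_above W \<eta> \<subseteq> kernel_above W \<xi>"
  by (auto simp: kernel_above_def)

lemma kernel_above_subset_closure_level:
  assumes W: "omega_Stone_space W"
  shows "kernel_above W \<xi> \<subseteq> W closure_of CB_level W \<xi>"
proof
  fix x assume "x \<in> kernel_above W \<xi>"
  then have x: "x \<in> kernel W" "\<xi> < rank_fun W x"
    by (auto simp: kernel_above_def)
  have "\<exists>y. y \<in> CB_level W \<xi> \<and> y \<in> T" if "x \<in> T" "openin W T" for T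
    using infinite_level_near_kernel[OF W that(2,1) x] infinite_imp_nonempty by blast
  then show "x \<in> W closure_of CB_level W \<xi>"
    using x(1) kernel_subset_topspace[of W] by (auto simp: in_closure_of)
qed

text \<open>Points of higher level are limits of points of level \<open>\<xi>\<close>. Thus
  compactness of the closure of a single level, as in \<open>rho\<close>, confines all later levels
  as well.\<close>

lemma CB_Diff_kernel_subset_closure_level:
  assumes W: "omega_Stone_space W"
  shows "CB W \<xi> - kernel W \<subseteq> W closure_of CB_level W \<xi>"
proof
  fix x assume x: "x \<in> CB W \<xi> - kernel W"
  then obtain \<eta> where \<eta>: "\<xi> \<le> \<eta>" "x \<in> CB_level W \<eta>"
    using CB_level_exists[OF W, of x \<xi>] by auto
  have xt: "x \<in> topspace W"
    using x CB_subset_topspace[of W \<xi>] by auto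
  show "x \<in> W closure_of CB_level W \<xi>"
  proof (cases "\<xi> = \<eta>")
    case True
    then show ?thesis
      using \<eta> xt by (auto simp: in_closure_of)
  next
    case False
    then have "\<xi> < \<eta>"
      using \<eta>(1) by simp
    then have "\<exists>y. y \<in> CB_level W \<xi> \<and> y \<in> T" if "x \<in> T" "openin W T" for T
      using infinite_lower_level[OF W that(2,1) \<eta>(2)] infinite_imp_nonempty by blast
    then show ?thesis
      using xt by (auto simp: in_closure_of)
  qed
qed

lemma compactin_closure_rho:
  assumes W: "omega_Stone_space W"
  shows "compactin W (W closure_of CB_level W (rho W))"
proof -
  have "compactin W (W closure_of CB_level W (nu W))"
    by (simp add: CB_level_nu[OF W])
  then show ?thesis
    unfolding rho_def by (rule LeastI)
qed

section \<open>Invariants determined by the ranked kernel\<close>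

context kernel_iso
begin

lemma phi_kernel_above: "\<phi> ` kernel_above W \<xi> = kernel_above X \<xi>"
proof (intro equalityI subsetI)
  fix x assume x: "x \<in> kernel_above X \<xi>"
  then have "x \<in> kernel X"
    by (simp add: kernel_above_def)
  then have "\<psi> x \<in> kernel_above W \<xi>" "\<phi> (\<psi> x) = x"
    using x psi_in[of x] phi_psi[of x] rank[of "\<psi> x"] by (auto simp: kernel_above_def)
  then show "x \<in> \<phi> ` kernel_above W \<xi>"
    by (metis imageI)
next
  fix x assume "x \<in> \<phi> ` kernel_above W \<xi>"
  then show "x \<in> kernel_above X \<xi>"
    using phi_in rank by (auto simp: kernel_above_def)
qed

lemma compactin_kernel_above_iff:
  "compactin W (kernel_above W \<xi>) \<longleftrightarrow> compactin X (kernel_above X \<xi>)"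
proof
  show "compactin W (kernel_above W \<xi>) \<Longrightarrow> compactin X (kernel_above X \<xi>)"
    using compactin_phi_image[of "kernel_above W \<xi>"] phi_kernel_above[of \<xi>]
    by (auto simp: kernel_above_def)
  show "compactin X (kernel_above X \<xi>) \<Longrightarrow> compactin W (kernel_above W \<xi>)"
    using kernel_iso.compactin_phi_image[OF flip, of "kernel_above X \<xi>"]
      kernel_iso.phi_kernel_above[OF flip, of \<xi>]
    by (auto simp: kernel_above_def)
qed

lemma rho_U_eq: "rho_U W = rho_U X"
  by (simp add: rho_U_def compactin_kernel_above_iff)

lemma lambda_iso: "lambda W = lambda X"
proof -
  have "kernel_above W \<xi> = {} \<longleftrightarrow> kernel_above X \<xi> = {}" for \<xi>
    using phi_kernel_above[of \<xi>] by auto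
  then show ?thesis
    by (simp add: lambda_eq[OF W] lambda_eq[OF X])
qed

end

text \<open>The complements of pairs of sets as below serve as the noncompact cells of the back-and-forth
  argument: outside of them only the levels below \<open>\<rho>\<close> remain, and these are unbounded.\<close>

definition exhausts :: "'a topology \<Rightarrow> 'b topology \<Rightarrow> ('a \<Rightarrow> 'b) \<Rightarrow> 'a set \<Rightarrow> 'b set \<Rightarrow> bool"
  where "exhausts W X \<phi> A B \<longleftrightarrow> compact_open W A \<and> compact_open X B \<and>
    \<phi> ` (A \<inter> kernel W) = B \<inter> kernel X \<and>
    CB W (rho W) - kernel W \<subseteq> A \<and> CB X (rho X) - kernel X \<subseteq> B"

text \<open>Strong uniformity replaces \<open>nu\<close> by \<open>lambda\<close> and
  \<open>rho\<close> by \<open>rho_U\<close>, which are read off from the ranked kernel; hence the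
  two spaces share these invariants.\<close>

locale strongly_uniform_iso = kernel_iso +
  assumes suW: "strongly_uniform W" and suX: "strongly_uniform X"
begin

lemma sflip: "strongly_uniform_iso X W \<psi> \<phi>"
  using flip suW suX by (simp add: strongly_uniform_iso_def strongly_uniform_iso_axioms_def)

lemma rho_eq: "rho W = rho X"
  using rho_U_eq suW suX by (simp add: strongly_uniform_def)

lemma nu_eq: "nu W = nu X"
  using lambda_iso suW suX by (simp add: strongly_uniform_def uniform_Stone_def)

lemma kernel_above_nonempty: "\<xi> < nu W \<Longrightarrow> kernel_above W \<xi> \<noteq> {}"
  using suW lambda_eq[OF W] not_less_Least by (auto simp: strongly_uniform_def uniform_Stone_def)

lemma not_compact_kernel_above: "\<xi> < rho W \<Longrightarrow> \<not> compactin W (kernel_above W \<xi>)"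
  using suW not_less_Least[of \<xi> "\<lambda>\<xi>. compactin W (kernel_above W \<xi>)"]
  by (simp add: strongly_uniform_def rho_U_def)

lemma exhausts_flip: "exhausts W X \<phi> A B \<Longrightarrow> exhausts X W \<psi> B A"
  using phi_image_eq_flip[of A B] by (simp add: exhausts_def)

text \<open>\<open>C\<close> only meets levels \<open>\<gamma>\<close> below \<open>rho W\<close>.
  For these, \<open>kernel_above X \<gamma>\<close> is closed and not compact, so it has a point
  outside \<open>B\<close>, near which there are infinitely many points of level
  \<open>\<gamma>\<close> to choose from.\<close>

lemma exhausts_extend:
  assumes AB: "exhausts W X \<phi> A B" and C: "compact_open W C" "C \<inter> A = {}"
  obtains D where "D \<subseteq> topspace X - B" "matched W X \<phi> C D" "exhausts W X \<phi> (A \<union> C) (B \<union> D)"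
proof -
  have A: "compact_open W A" and B: "compact_open X B" and AK: "\<phi> ` (A \<inter> kernel W) = B \<inter> kernel X"
    and low: "CB W (rho W) - kernel W \<subseteq> A"
    using AB by (auto simp: exhausts_def)
  let ?U = "topspace X - B"
  have U: "openin X ?U"
    using compact_open_closedin[OF HX B] by blast
  have "\<phi> ` (C \<inter> kernel W) \<inter> \<phi> ` (A \<inter> kernel W) = {}"
    using inj_on_image_Int[OF inj_phi, of "C \<inter> kernel W" "A \<inter> kernel W"] C(2) by auto
  moreover have "\<phi> ` (C \<inter> kernel W) \<subseteq> kernel X"
    using phi_in by auto
  ultimately have CU: "\<phi> ` (C \<inter> kernel W) \<subseteq> ?U"
    using AK kernel_subset_topspace[of X] by auto
  have "\<exists>F. finite F \<and> F \<subseteq> ?U \<inter> CB_level X \<gamma> \<and> card F = card (C \<inter> CB_level W \<gamma>)"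
    if ne: "C \<inter> CB_level W \<gamma> \<noteq> {}" for \<gamma>
  proof -
    obtain y where y: "y \<in> C" "y \<in> CB_level W \<gamma>"
      using ne by blast
    have "\<gamma> < rho W"
    proof (rule ccontr)
      assume "\<not> \<gamma> < rho W"
      then have "rho W \<le> \<gamma>"
        by simp
      then have "y \<in> CB W (rho W) - kernel W"
        using y(2) CB_antimono[OF HW] CB_level_subset[of W \<gamma>] CB_level_disjoint_kernel[OF W, of \<gamma>]
        by blast
      then show False
        using low y(1) C(2) by auto
    qed
    then have "\<not> compactin X (kernel_above X \<gamma>)"
      using not_compact_kernel_above compactin_kernel_above_iff by simp
    then have "\<not> kernel_above X \<gamma> \<subseteq> B"
      using closed_compactin[OF _ _ closedin_kernel_above[OF X]] B by (auto simp: compact_open_def)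
    then obtain x where x: "x \<in> kernel_above X \<gamma>" "x \<notin> B"
      by blast
    then have "infinite (?U \<inter> CB_level X \<gamma>)"
      using kernel_subset_topspace[of X]
      by (intro infinite_level_near_kernel[OF X U, of x]) (auto simp: kernel_above_def)
    then obtain F where "finite F" "card F = card (C \<inter> CB_level W \<gamma>)" "F \<subseteq> ?U \<inter> CB_level X \<gamma>"
      using infinite_arbitrarily_large by blast
    then show ?thesis
      by blast
  qed
  then obtain D where D: "D \<subseteq> ?U" "matched W X \<phi> C D"
    using exists_matched[OF C(1) U CU] by metis
  have "\<phi> ` ((A \<union> C) \<inter> kernel W) = (B \<union> D) \<inter> kernel X"
    using AK D(2) by (simp add: matched_def Int_Un_distrib2 image_Un)
  then have "exhausts W X \<phi> (A \<union> C) (B \<union> D)"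
    using AB D(2) by (auto simp: exhausts_def matched_def compact_open_Un)
  then show ?thesis
    by (rule that[OF D])
qed

definition cell :: "'a set \<Rightarrow> 'b set \<Rightarrow> bool"
  where "cell A B \<longleftrightarrow> matched W X \<phi> A B \<or>
    A \<subseteq> topspace W \<and> B \<subseteq> topspace X \<and> exhausts W X \<phi> (topspace W - A) (topspace X - B)"

lemma cell_iff_flip: "cell A B \<longleftrightarrow> strongly_uniform_iso.cell X W \<psi> B A"
proof -
  interpret flip: strongly_uniform_iso X W \<psi> \<phi>
    by (rule sflip)
  show ?thesis
    unfolding cell_def flip.cell_def
    using matched_flip flip.matched_flip exhausts_flip flip.exhausts_flip by metis
qed

text \<open>If the complement \<open>A\<close> of an exhausting set is compact, it can be adjoined
  to that set as a whole. A compact open piece of \<open>B\<close> left over afterwards would have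
  to be matched, in the reverse direction, with a subset of the empty set.\<close>

lemma compact_cell_matched:
  assumes "cell A B" "compactin W A"
  shows "matched W X \<phi> A B"
proof (cases "matched W X \<phi> A B")
  case False
  interpret flip: strongly_uniform_iso X W \<psi> \<phi>
    by (rule sflip)
  have A: "A \<subseteq> topspace W" and B: "B \<subseteq> topspace X"
    and ex: "exhausts W X \<phi> (topspace W - A) (topspace X - B)"
    using assms(1) False by (auto simp: cell_def)
  have TA: "topspace W - (topspace W - A) = A" and TB: "topspace X - (topspace X - B) = B"
    using A B by auto
  have "openin W (topspace W - (topspace W - A))"
    using ex compact_open_closedin[OF HW, of "topspace W - A"] by (auto simp: exhausts_def)
  then have "compact_open W A"
    using assms(2) TA by (simp add: compact_open_def)
  moreover have "A \<inter> (topspace W - A) = {}"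
    by blast
  ultimately obtain D where D: "D \<subseteq> B" "matched W X \<phi> A D"
      "exhausts W X \<phi> (topspace W - A \<union> A) (topspace X - B \<union> D)"
    by (rule exhausts_extend[OF ex, unfolded TB])
  have "B - D = {}"
  proof (rule ccontr)
    assume "B - D \<noteq> {}"
    then obtain y where y: "y \<in> B - D"
      by blast
    have eq: "topspace X - (topspace X - B \<union> D) = B - D"
      using B by blast
    have "openin X (B - D)"
      unfolding eq[symmetric] using D(3) compact_open_closedin[OF HX]
      by (intro openin_diff) (auto simp: exhausts_def)
    then obtain E where E: "compact_open X E" "y \<in> E" "E \<subseteq> B - D"
      using y by (rule omega_Stone_base[OF X])
    have "E \<inter> (topspace X - B \<union> D) = {}"
      using E(3) by blast
    then obtain C where C: "C \<subseteq> topspace W - (topspace W - A \<union> A)" "matched X W \<psi> E C"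
      by (rule flip.exhausts_extend[OF exhausts_flip[OF D(3)] E(1)])
    have "C = {}"
      using C(1) by blast
    then show False
      using flip.matched_empty_iff[OF C(2)] E(2) by simp
  qed
  then show ?thesis
    using D by (metis Diff_eq_empty_iff subset_antisym)
qed

lemma cell_compact: "cell A B \<Longrightarrow> compactin W A \<Longrightarrow> compactin X B"
  using compact_cell_matched[of A B] by (simp add: matched_def compact_open_def)

lemma cell_empty: "cell A B \<Longrightarrow> A = {} \<Longrightarrow> B = {}"
  using compact_cell_matched[of A B] matched_empty_iff[of A B] by simp

text \<open>A matched cell is split by \<open>matched_split\<close>. For a cell that is the
  complement of an exhausting set, the compact part \<open>A \<inter> C\<close> is adjoined to that
  set.\<close>

lemma cell_forward:
  assumes AB: "cell A B" and C: "compact_open W C"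
  shows "\<exists>B'\<subseteq>B. cell (A \<inter> C) B' \<and> cell (A - C) (B - B')"
proof (cases "matched W X \<phi> A B")
  case True
  then have "compact_open W (A \<inter> C)"
    using C compact_open_Int[OF HW] by (simp add: matched_def)
  then obtain B' where "B' \<subseteq> B" "matched W X \<phi> (A \<inter> C) B'" "matched W X \<phi> (A - A \<inter> C) (B - B')"
    using matched_split[OF True, of "A \<inter> C"] by blast
  then show ?thesis
    by (intro exI[of _ B']) (simp add: cell_def Diff_Int)
next
  case False
  have A: "A \<subseteq> topspace W" and B: "B \<subseteq> topspace X"
    and ex: "exhausts W X \<phi> (topspace W - A) (topspace X - B)"
    using AB False by (auto simp: cell_def)
  have eqA: "A \<inter> C = C - (topspace W - A)"
    using compact_open_subset[OF C] by blast
  have "compact_open W (A \<inter> C)"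
    unfolding eqA using ex C compact_open_Diff[OF HW] by (simp add: exhausts_def)
  moreover have "A \<inter> C \<inter> (topspace W - A) = {}"
    by blast
  ultimately obtain D where D: "D \<subseteq> topspace X - (topspace X - B)" "matched W X \<phi> (A \<inter> C) D"
      "exhausts W X \<phi> (topspace W - A \<union> A \<inter> C) (topspace X - B \<union> D)"
    by (rule exhausts_extend[OF ex])
  have "topspace W - A \<union> A \<inter> C = topspace W - (A - C)" "topspace X - B \<union> D = topspace X - (B - D)"
    using A D(1) by auto
  then have "cell (A - C) (B - D)"
    using D(3) A B by (auto simp: cell_def)
  then show ?thesis
    using D by (intro exI[of _ D]) (auto simp: cell_def)
qed

lemma cell_clopen:
  assumes "cell A B"
  shows "openin W A \<and> closedin W A"
proof (cases "matched W X \<phi> A B")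
  case True
  then show ?thesis
    using compact_open_closedin[OF HW] by (auto simp: matched_def compact_open_def)
next
  case False
  then have A: "A \<subseteq> topspace W" and "compact_open W (topspace W - A)"
    using assms by (auto simp: cell_def exhausts_def)
  then have "openin W (topspace W - (topspace W - A))" "closedin W (topspace W - (topspace W - A))"
    using compact_open_closedin[OF HW] by (auto simp: compact_open_def)
  moreover have "topspace W - (topspace W - A) = A"
    using A by blast
  ultimately show ?thesis
    by simp
qed

text \<open>Unless nothing outside the kernels survives to level \<open>rho\<close>, the sets
  \<open>A\<close> and \<open>B\<close> are made to contain the compact closures of these levels.
  Then they contain kernel points of every rank threshold below \<open>nu\<close>, so all their
  levels below \<open>nu\<close> are infinite and match; all others are empty.\<close>

lemma initial_cells:
  shows "\<exists>A B. matched W X \<phi> A B \<and> exhausts W X \<phi> A B"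
proof (cases "nu W \<le> rho W")
  case True
  then have "CB W (rho W) = kernel W" "CB X (rho X) = kernel X"
    using CB_eq_kernel[OF W] CB_eq_kernel[OF X] rho_eq nu_eq by simp_all
  then show ?thesis
    by (intro exI[of _ "{}"]) (simp add: matched_def exhausts_def same_levels_def)
next
  case False
  interpret flip: kernel_iso X W \<psi> \<phi>
    by (rule flip)
  let ?CW = "W closure_of CB_level W (rho W)" and ?CX = "X closure_of CB_level X (rho X)"
  have "compactin W (\<psi> ` (?CX \<inter> kernel X))"
    using compactin_closure_rho[OF X] closedin_kernel[OF HX]
    by (intro flip.compactin_phi_image) (auto simp: compact_Int_closedin)
  then have "compactin W (?CW \<union> \<psi> ` (?CX \<inter> kernel X))"
    using compactin_closure_rho[OF W] by (rule compactin_Un[rotated])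
  then obtain A where A: "compact_open W A" "?CW \<union> \<psi> ` (?CX \<inter> kernel X) \<subseteq> A"
    using compactin_subset_topspace by (metis omega_Stone_compact_between[OF W _ openin_topspace])
  have "openin X (topspace X - \<phi> ` (kernel W - A))"
    using A(1) closedin_kernel[OF HW]
    by (intro openin_diff openin_topspace closedin_phi_image closedin_diff) (auto simp: compact_open_def)
  moreover have "compactin X (?CX \<union> \<phi> ` (A \<inter> kernel W))"
    using A(1) closedin_kernel[OF HW] compactin_closure_rho[OF X]
    by (intro compactin_Un compactin_phi_image) (auto simp: compact_open_def compact_Int_closedin)
  \<comment> \<open>This is why \<open>A\<close> was chosen to contain the kernel part of
    \<open>?CX\<close>, pulled back by \<open>\<psi>\<close>: otherwise \<open>B\<close> could not
    contain \<open>?CX\<close> and have the prescribed kernel part.\<close>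
  moreover have "?CX \<union> \<phi> ` (A \<inter> kernel W) \<subseteq> topspace X - \<phi> ` (kernel W - A)"
  proof -
    have "\<phi> ` (A \<inter> kernel W) \<inter> \<phi> ` (kernel W - A) = {}"
      using inj_on_image_Int[OF inj_phi, of "A \<inter> kernel W" "kernel W - A"] by auto
    moreover have "x \<notin> ?CX" if x: "x \<in> \<phi> ` (kernel W - A)" for x
    proof
      assume "x \<in> ?CX"
      obtain w where w: "w \<in> kernel W" "w \<notin> A" "x = \<phi> w"
        using x by blast
      then have "\<psi> x \<in> \<psi> ` (?CX \<inter> kernel X)"
        using \<open>x \<in> ?CX\<close> phi_in by blast
      then show False
        using A(2) w psi_phi by auto
    qed
    moreover have "\<phi> ` (A \<inter> kernel W) \<subseteq> topspace X" "?CX \<subseteq> topspace X"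
      using phi_in kernel_subset_topspace[of X] closure_of_subset_topspace[of X] by auto
    ultimately show ?thesis
      by blast
  qed
  ultimately obtain B where B: "compact_open X B" "?CX \<union> \<phi> ` (A \<inter> kernel W) \<subseteq> B"
      "B \<subseteq> topspace X - \<phi> ` (kernel W - A)"
    using omega_Stone_compact_between[OF X] by metis
  have AK: "\<phi> ` (A \<inter> kernel W) = B \<inter> kernel X"
  proof
    show "\<phi> ` (A \<inter> kernel W) \<subseteq> B \<inter> kernel X"
      using B(2) phi_in by auto
    show "B \<inter> kernel X \<subseteq> \<phi> ` (A \<inter> kernel W)"
    proof
      fix x assume x: "x \<in> B \<inter> kernel X"
      then have "\<psi> x \<in> kernel W" "x = \<phi> (\<psi> x)"
        using psi_in phi_psi by auto
      moreover from this have "\<psi> x \<in> A"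
        using x B(3) by blast
      ultimately show "x \<in> \<phi> ` (A \<inter> kernel W)"
        by blast
    qed
  qed
  have infA: "infinite (A \<inter> CB_level W \<xi>)" if "\<xi> < nu W" for \<xi>
  proof -
    \<comment> \<open>Rank above \<open>rho W\<close> places the kernel point in \<open>A\<close>;
      rank above \<open>\<xi>\<close> makes level \<open>\<xi>\<close> accumulate at it.\<close>
    let ?\<zeta> = "max \<xi> (rho W)"
    have "?\<zeta> < nu W"
      using that False by simp
    then obtain x where x: "x \<in> kernel_above W ?\<zeta>"
      using kernel_above_nonempty by blast
    then have "x \<in> kernel_above W (rho W)"
      using kernel_above_antimono[of "rho W" ?\<zeta> W] by auto
    then have "x \<in> A"
      using kernel_above_subset_closure_level[OF W] A(2) by auto
    moreover have "x \<in> kernel W" "\<xi> < rank_fun W x"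
      using x by (auto simp: kernel_above_def)
    ultimately show ?thesis
      using A(1) by (intro infinite_level_near_kernel[OF W, of A x]) (auto simp: compact_open_def)
  qed
  have infB: "infinite (B \<inter> CB_level X \<xi>)" if \<xi>: "\<xi> < nu W" for \<xi>
  proof -
    let ?\<zeta> = "max \<xi> (rho W)"
    have "?\<zeta> < nu W"
      using that False by simp
    then have "kernel_above X ?\<zeta> \<noteq> {}"
      using kernel_above_nonempty phi_kernel_above by blast
    then obtain x where x: "x \<in> kernel_above X ?\<zeta>"
      by blast
    then have "x \<in> kernel_above X (rho X)"
      using kernel_above_antimono[of "rho W" ?\<zeta> X] rho_eq by auto
    then have "x \<in> B"
      using kernel_above_subset_closure_level[OF X] B(2) by auto
    moreover have "x \<in> kernel X" "\<xi> < rank_fun X x"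
      using x by (auto simp: kernel_above_def)
    ultimately show ?thesis
      using B(1) by (intro infinite_level_near_kernel[OF X, of B x]) (auto simp: compact_open_def)
  qed
  have "same_levels W X A B"
    unfolding same_levels_def
  proof
    fix \<xi>
    show "(finite (A \<inter> CB_level W \<xi>) \<longleftrightarrow> finite (B \<inter> CB_level X \<xi>)) \<and>
      card (A \<inter> CB_level W \<xi>) = card (B \<inter> CB_level X \<xi>)"
    proof (cases "\<xi> < nu W")
      case True
      then show ?thesis
        using infA infB by simp
    next
      case False
      then show ?thesis
        using CB_level_nu[OF W, of \<xi>] CB_level_nu[OF X, of \<xi>] nu_eq by simp
    qed
  qed
  then have "matched W X \<phi> A B"
    using A B AK by (simp add: matched_def)
  moreover have "exhausts W X \<phi> A B"
    using A B AK CB_Diff_kernel_subset_closure_level[OF W, of "rho W"]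
      CB_Diff_kernel_subset_closure_level[OF X, of "rho X"] by (auto simp: exhausts_def)
  ultimately show ?thesis
    by blast
qed

lemma homeomorphic: "W homeomorphic_space X"
proof -
  interpret flip: strongly_uniform_iso X W \<psi> \<phi>
    by (rule sflip)
  obtain A B where AB: "matched W X \<phi> A B" "exhausts W X \<phi> A B"
    using initial_cells by blast
  have cells: "cell A B" "cell (topspace W - A) (topspace X - B)"
  proof -
    show "cell A B"
      using AB(1) by (simp add: cell_def)
    have "topspace W - (topspace W - A) = A" "topspace X - (topspace X - B) = B"
      using AB(1) compact_open_subset[of W A] compact_open_subset[of X B] by (auto simp: matched_def)
    then show "cell (topspace W - A) (topspace X - B)"
      using AB(2) by (auto simp: cell_def)
  qed
  show ?thesis
  proof (rule back_and_forth[OF W X, of cell])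
    fix A B assume AB: "cell A B"
    then have BA: "flip.cell B A"
      by (simp add: cell_iff_flip)
    show "openin W A \<and> closedin W A \<and> openin X B \<and> closedin X B"
      using cell_clopen[OF AB] flip.cell_clopen[OF BA] by simp
    show "A = {} \<longleftrightarrow> B = {}"
      using cell_empty[OF AB] flip.cell_empty[OF BA] by blast
    show "compactin W A \<longleftrightarrow> compactin X B"
      using cell_compact[OF AB] flip.cell_compact[OF BA] by blast
    show "\<exists>B'\<subseteq>B. cell (A \<inter> C) B' \<and> cell (A - C) (B - B')" if "compact_open W C" for C
      by (rule cell_forward[OF AB that])
    show "\<exists>A'\<subseteq>A. cell A' (B \<inter> D) \<and> cell (A - A') (B - D)" if "compact_open X D" for D
      using flip.cell_forward[OF BA that] by (simp add: cell_iff_flip)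
  qed (rule cells)+
qed

end

lemma strongly_uniform_homeomorphic:
  assumes "omega_Stone_space W" "strongly_uniform W" "omega_Stone_space X" "strongly_uniform X"
    and iso: "pair_iso (kernel_pair W) (kernel_pair X)"
  shows "W homeomorphic_space X"
proof -
  obtain \<phi> where \<phi>: "homeomorphic_map (subtopology W (kernel W)) (subtopology X (kernel X)) \<phi>"
      "\<And>u. u \<in> kernel W \<Longrightarrow> rank_fun X (\<phi> u) = rank_fun W u"
    using iso kernel_subset_topspace[of W] by (auto simp: pair_iso_def kernel_pair_def)
  then obtain \<psi> where "homeomorphic_maps (subtopology W (kernel W)) (subtopology X (kernel X)) \<phi> \<psi>"
    using homeomorphic_map_maps by blast
  then interpret strongly_uniform_iso W X \<phi> \<psi>
    using assms \<phi> by unfold_locales auto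
  show ?thesis
    by (rule homeomorphic)
qed

subsection \<open>Spaces of sequences over a finite alphabet\<close>

text \<open>The alphabet is left general: \<open>bool\<close> gives \<open>Cantor1\<close>, and
  \<open>bool \<times> bool\<close> carries the model spaces of the existence proof.\<close>

definition seq_space :: "(nat \<Rightarrow> 'a) topology"
  where "seq_space = product_topology (\<lambda>_. discrete_topology UNIV) UNIV"

lemma Cantor1_eq: "Cantor1 = seq_space"
  by (simp add: Cantor1_def seq_space_def)

lemma topspace_seq_space [simp]: "topspace seq_space = UNIV"
  by (simp add: seq_space_def)

lemma openin_seq_space:
  "openin seq_space U \<longleftrightarrow> (\<forall>w\<in>U. \<exists>m. \<forall>w'. (\<forall>n<m. w' n = w n) \<longrightarrow> w' \<in> U)"
  (is "_ \<longleftrightarrow> (\<forall>w\<in>U. ?P w)")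
proof
  assume U: "openin seq_space U"
  show "\<forall>w\<in>U. ?P w"
  proof
    fix w assume "w \<in> U"
    then obtain V where V: "finite {i. V i \<noteq> UNIV}" "w \<in> Pi\<^sub>E UNIV V" "Pi\<^sub>E UNIV V \<subseteq> U"
      using U by (auto simp: seq_space_def openin_product_topology_alt)
    obtain m where m: "{i. V i \<noteq> UNIV} \<subseteq> {..<m}"
      using V(1) finite_nat_bounded by blast
    have "w' \<in> U" if w': "\<forall>n<m. w' n = w n" for w'
    proof -
      have "w' i \<in> V i" for i
      proof (cases "i < m")
        case True
        then show ?thesis
          using w' V(2) by (auto simp: PiE_iff)
      next
        case False
        then have "V i = UNIV"
          using m by auto
        then show ?thesis
          by simp
      qed
      then show ?thesis
        using V(3) by (auto simp: PiE_iff)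
    qed
    then show "?P w"
      by blast
  qed
next
  assume R: "\<forall>w\<in>U. ?P w"
  have "\<exists>V. finite {i. V i \<noteq> UNIV} \<and> w \<in> Pi\<^sub>E UNIV V \<and> Pi\<^sub>E UNIV V \<subseteq> U" if "w \<in> U" for w
  proof -
    obtain m where m: "\<forall>w'. (\<forall>n<m. w' n = w n) \<longrightarrow> w' \<in> U"
      using R \<open>w \<in> U\<close> by blast
    let ?V = "\<lambda>i. if i < m then {w i} else UNIV"
    have "finite {i. ?V i \<noteq> UNIV}"
      by (rule finite_subset[of _ "{..<m}"]) auto
    moreover have "w \<in> Pi\<^sub>E UNIV ?V"
      by auto
    moreover have "Pi\<^sub>E UNIV ?V \<subseteq> U"
    proof
      fix w' assume "w' \<in> Pi\<^sub>E UNIV ?V"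
      then have "w' i \<in> ?V i" for i
        by (auto simp: PiE_iff)
      then have "w' n = w n" if "n < m" for n
        using that by (metis (full_types) singletonD)
      then show "w' \<in> U"
        using m by blast
    qed
    ultimately show ?thesis
      by (intro exI[of _ ?V] conjI)
  qed
  then show "openin seq_space U"
    unfolding seq_space_def openin_product_topology_alt by simp
qed

lemma openin_seq_space_cylinder: "openin seq_space {w. \<forall>n<m. w n = a n}"
  unfolding openin_seq_space by (intro ballI exI[of _ m]) auto

lemma compact_space_seq_space: "compact_space (seq_space :: (nat \<Rightarrow> 'a::finite) topology)"
  by (simp add: seq_space_def compact_space_product_topology compact_space_discrete_topology)

lemma omega_Stone_seq_space: "omega_Stone_space (seq_space :: (nat \<Rightarrow> 'a::finite) topology)"
proof (rule omega_Stone_spaceI)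
  show "locally_compact_space (seq_space :: (nat \<Rightarrow> 'a) topology)"
    using compact_space_seq_space compact_imp_locally_compact_space by blast
  show "metrizable_space (seq_space :: (nat \<Rightarrow> 'a) topology)"
    by (simp add: seq_space_def metrizable_space_product_topology)
  show "\<exists>a. S \<subseteq> {a}" if S: "connectedin (seq_space :: (nat \<Rightarrow> 'a) topology) S" for S
  proof -
    have "\<exists>a. (\<lambda>w. w n) ` S \<subseteq> {a}" for n
    proof -
      have "continuous_map (seq_space :: (nat \<Rightarrow> 'a) topology) (discrete_topology UNIV) (\<lambda>w. w n)"
        using continuous_map_product_projection[of n UNIV "\<lambda>_. discrete_topology UNIV"]
        by (simp add: seq_space_def)
      then have "connectedin (discrete_topology UNIV) ((\<lambda>w. w n) ` S)"
        using S by (rule connectedin_continuous_map_image)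
      then show ?thesis
        by (simp add: connectedin_discrete_topology)
    qed
    then obtain a where a: "\<And>n. (\<lambda>w. w n) ` S \<subseteq> {a n}"
      by metis
    have "w n = a n" if "w \<in> S" for w n
      using a[of n] that by auto
    then have "S \<subseteq> {a}"
      by auto
    then show ?thesis
      by (intro exI[of _ a])
  qed
  let ?c = "\<lambda>l :: 'a list. {w. \<forall>n<length l. w n = l ! n}"
  have "openin seq_space V" if "V \<in> range ?c" for V
    using that openin_seq_space_cylinder by auto
  moreover have "\<exists>V\<in>range ?c. w \<in> V \<and> V \<subseteq> U" if U: "openin seq_space U" and w: "w \<in> U" for U w
  proof -
    obtain m where m: "\<forall>w'. (\<forall>n<m. w' n = w n) \<longrightarrow> w' \<in> U"
      using U w unfolding openin_seq_space by blast
    have "w \<in> ?c (map w [0..<m])" "?c (map w [0..<m]) \<subseteq> U"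
      using m by auto
    then show ?thesis
      by blast
  qed
  moreover have "countable (range ?c)"
    by simp
  ultimately show "second_countable (seq_space :: (nat \<Rightarrow> 'a) topology)"
    unfolding second_countable_def by (intro exI[of _ "range ?c"] conjI allI ballI impI) auto
qed

lemma omega_Stone_Cantor1: "omega_Stone_space Cantor1"
  by (simp add: Cantor1_eq omega_Stone_seq_space)

lemma openin_Cantor1_nonzero: "openin Cantor1 (UNIV - {\<lambda>_. False})"
proof -
  have "openin Cantor1 (topspace Cantor1 - {\<lambda>_. False})"
    by (intro openin_diff openin_topspace closedin_Hausdorff_singleton omega_Stone_spaceD(3)[OF omega_Stone_Cantor1])
      (auto simp: Cantor1_eq)
  then show ?thesis
    by (simp add: Cantor1_eq)
qed

lemma omega_Stone_Cantor0: "omega_Stone_space Cantor0"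
  unfolding Cantor0_def by (intro omega_Stone_subtopology omega_Stone_Cantor1 disjI2 openin_Cantor1_nonzero)

lemma topspace_Cantor [simp]: "topspace Cantor1 = UNIV" "topspace Cantor0 = UNIV - {\<lambda>_. False}"
  by (simp_all add: Cantor1_eq Cantor0_def)

lemma perfect_Cantor1: "Cantor1 derived_set_of UNIV = UNIV"
proof -
  have "\<exists>y. y \<noteq> w \<and> y \<in> T" if T: "w \<in> T" "openin Cantor1 T" for w T
  proof -
    obtain m where m: "\<forall>w'. (\<forall>n<m. w' n = w n) \<longrightarrow> w' \<in> T"
      using T unfolding Cantor1_eq openin_seq_space by blast
    have "w(m := \<not> w m) \<in> T"
      by (rule m[rule_format]) simp
    moreover have "w(m := \<not> w m) \<noteq> w"
      by (metis fun_upd_same)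
    ultimately show ?thesis
      by blast
  qed
  then show ?thesis
    by (auto simp: derived_set_of_def)
qed

lemma perfect_Cantor0: "Cantor0 derived_set_of (topspace Cantor0) = topspace Cantor0"
proof -
  let ?S = "UNIV - {\<lambda>_. False}"
  have "Cantor0 derived_set_of ?S = ?S \<inter> Cantor1 derived_set_of (?S \<inter> UNIV)"
    by (simp add: Cantor0_def derived_set_of_subtopology)
  also have "\<dots> = ?S"
    using openin_Int_derived_set_of_eq[OF openin_Cantor1_nonzero, of UNIV] perfect_Cantor1 by simp
  finally show ?thesis
    by simp
qed

text \<open>Otherwise the removed point would be open in \<open>Cantor1\<close>, which is
  perfect.\<close>

lemma not_compact_Cantor0: "\<not> compact_space Cantor0"
proof
  assume "compact_space Cantor0"
  then have "compactin Cantor1 (UNIV - {\<lambda>_. False})"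
    by (simp add: Cantor0_def compact_space_subtopology compactin_subspace)
  then have "closedin Cantor1 (UNIV - {\<lambda>_. False})"
    by (rule compactin_imp_closedin[OF omega_Stone_spaceD(3)[OF omega_Stone_Cantor1]])
  then have "openin Cantor1 (topspace Cantor1 - (UNIV - {\<lambda>_. False}))"
    by blast
  then have "openin Cantor1 {\<lambda>_. False}"
    by (simp add: Diff_Diff_Int)
  moreover have "(\<lambda>_. False) \<in> Cantor1 derived_set_of UNIV"
    by (simp add: perfect_Cantor1)
  ultimately show False
    unfolding in_derived_set_of by blast
qed

lemma compact_Cantor1: "compact_space Cantor1"
  by (simp add: Cantor1_eq compact_space_seq_space)

subsection \<open>Perfect spaces\<close>

lemma compactin_Diff_iff:
  assumes "closedin X A" "openin X C" "compactin X (A \<inter> C)"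
  shows "compactin X (A - C) \<longleftrightarrow> compactin X A"
proof
  assume "compactin X (A - C)"
  then have "compactin X ((A - C) \<union> (A \<inter> C))"
    using assms(3) by (rule compactin_Un)
  then show "compactin X A"
    by (simp add: Un_Diff_Int)
next
  assume "compactin X A"
  then show "compactin X (A - C)"
    using assms by (intro closed_compactin[of X A "A - C"]) auto
qed

text \<open>In perfect spaces, emptiness and compactness are all that the back-and-forth argument
  has to remember about a clopen piece.\<close>

definition clopen_alike :: "'a topology \<Rightarrow> 'b topology \<Rightarrow> 'a set \<Rightarrow> 'b set \<Rightarrow> bool"
  where "clopen_alike X Y A B \<longleftrightarrow> closedin X A \<and> openin X A \<and> closedin Y B \<and> openin Y B \<and>
    (A = {} \<longleftrightarrow> B = {}) \<and> (compactin X A \<longleftrightarrow> compactin Y B)"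

lemma clopen_alike_sym: "clopen_alike X Y A B \<longleftrightarrow> clopen_alike Y X B A"
  by (auto simp: clopen_alike_def)

text \<open>If \<open>C\<close> cuts \<open>A\<close> properly, perfectness gives two points in
  \<open>B\<close>, and a compact open \<open>E\<close> containing one but not the other serves as
  partner. Removing compact pieces on both sides preserves whether the remainder is compact.\<close>

lemma clopen_alike_forward:
  assumes X: "omega_Stone_space X" and Y: "omega_Stone_space Y"
    and perfect: "Y derived_set_of (topspace Y) = topspace Y"
    and AB: "clopen_alike X Y A B" and C: "compact_open X C"
  shows "\<exists>B'\<subseteq>B. clopen_alike X Y (A \<inter> C) B' \<and> clopen_alike X Y (A - C) (B - B')"
proof -
  note HX = omega_Stone_spaceD(3)[OF X] and HY = omega_Stone_spaceD(3)[OF Y]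
  have A: "closedin X A" "openin X A" and B: "closedin Y B" "openin Y B"
    and iff: "A = {} \<longleftrightarrow> B = {}" "compactin X A \<longleftrightarrow> compactin Y B"
    using AB by (auto simp: clopen_alike_def)
  have C': "closedin X C" "openin X C"
    using compact_open_closedin[OF HX C] C by (auto simp: compact_open_def)
  have AC: "compactin X (A \<inter> C)"
    using compact_open_Int_clopen[OF C A] by (simp add: compact_open_def Int_commute)
  consider "A \<inter> C = {}" | "A - C = {}" | "A \<inter> C \<noteq> {}" "A - C \<noteq> {}"
    by blast
  then show ?thesis
  proof cases
    case 1
    then have "A - C = A"
      by blast
    show ?thesis
      using AB unfolding \<open>A - C = A\<close> 1 by (intro exI[of _ "{}"]) (simp add: clopen_alike_def)
  next
    case 2
    then have "A \<inter> C = A"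
      by blast
    show ?thesis
      using AB unfolding \<open>A \<inter> C = A\<close> 2 by (intro exI[of _ B]) (simp add: clopen_alike_def)
  next
    case 3
    then obtain y where y: "y \<in> B"
      using iff(1) by blast
    then have "y \<in> Y derived_set_of (topspace Y)"
      using perfect openin_subset[OF B(2)] by auto
    then obtain y' where y': "y' \<noteq> y" "y' \<in> B"
      using B(2) y unfolding in_derived_set_of by blast
    have "openin Y (B - {y'})"
      using openin_Diff_finite[OF HY B(2)] by simp
    moreover have "y \<in> B - {y'}"
      using y y' by simp
    ultimately obtain E where E: "compact_open Y E" "y \<in> E" "E \<subseteq> B - {y'}"
      by (rule omega_Stone_base[OF Y])
    have E': "closedin Y E" "openin Y E" "compactin Y E"
      using compact_open_closedin[OF HY E(1)] E(1) by (auto simp: compact_open_def)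
    have BE: "B \<inter> E = E"
      using E(3) by blast
    have "clopen_alike X Y (A \<inter> C) E"
      using A C' AC E' E(2) 3(1) by (auto simp: clopen_alike_def)
    moreover have "compactin X (A - C) \<longleftrightarrow> compactin Y (B - E)"
      using compactin_Diff_iff[OF A(1) C'(2) AC] compactin_Diff_iff[OF B(1) E'(2)] E'(3) BE iff(2) by simp
    then have "clopen_alike X Y (A - C) (B - E)"
      using A B C' E' E(3) y' 3(2) by (auto simp: clopen_alike_def openin_diff closedin_diff)
    ultimately show ?thesis
      using E(3) by (intro exI[of _ E]) auto
  qed
qed

lemma perfect_homeomorphic:
  assumes X: "omega_Stone_space X" "X derived_set_of (topspace X) = topspace X" "topspace X \<noteq> {}"
    and Y: "omega_Stone_space Y" "Y derived_set_of (topspace Y) = topspace Y" "topspace Y \<noteq> {}"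
    and cpt: "compact_space X \<longleftrightarrow> compact_space Y"
  shows "X homeomorphic_space Y"
proof (rule back_and_forth[OF X(1) Y(1), of "clopen_alike X Y" "{}" "{}"])
  show "clopen_alike X Y {} {}" "clopen_alike X Y (topspace X - {}) (topspace Y - {})"
    using X(3) Y(3) cpt by (simp_all add: clopen_alike_def compact_space_def)
  fix A B assume AB: "clopen_alike X Y A B"
  show "openin X A \<and> closedin X A \<and> openin Y B \<and> closedin Y B" "A = {} \<longleftrightarrow> B = {}"
    "compactin X A \<longleftrightarrow> compactin Y B"
    using AB by (simp_all add: clopen_alike_def)
  show "\<exists>B'\<subseteq>B. clopen_alike X Y (A \<inter> C) B' \<and> clopen_alike X Y (A - C) (B - B')"
    if "compact_open X C" for C
    by (rule clopen_alike_forward[OF X(1) Y(1,2) AB that])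
  show "\<exists>A'\<subseteq>A. clopen_alike X Y A' (B \<inter> D) \<and> clopen_alike X Y (A - A') (B - D)"
    if "compact_open Y D" for D
    using clopen_alike_forward[OF Y(1) X(1,2) AB[unfolded clopen_alike_sym[of X]] that]
    by (simp add: clopen_alike_sym[of Y])
qed

lemma perfect_homeomorphic_Cantor:
  assumes "omega_Stone_space X" "X derived_set_of (topspace X) = topspace X" "topspace X \<noteq> {}"
  shows "\<exists>C\<in>{Cantor0, Cantor1}. X homeomorphic_space C"
proof (cases "compact_space X")
  case True
  then have "X homeomorphic_space Cantor1"
    using assms
    by (intro perfect_homeomorphic omega_Stone_Cantor1) (auto simp: perfect_Cantor1 compact_Cantor1)
  then show ?thesis
    by blast
next
  case False
  have "(\<lambda>_. True) \<in> topspace Cantor0"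
    by (auto simp: fun_eq_iff)
  then have "topspace Cantor0 \<noteq> {}"
    by blast
  then have "X homeomorphic_space Cantor0"
    using assms False
    by (intro perfect_homeomorphic omega_Stone_Cantor0 perfect_Cantor0) (auto simp: not_compact_Cantor0)
  then show ?thesis
    by blast
qed

subsection \<open>Isomorphisms of ranked spaces\<close>

lemma pair_iso_iff:
  "pair_iso (U, r) (V, s) \<longleftrightarrow> (\<exists>\<phi>. homeomorphic_map U V \<phi> \<and> (\<forall>u\<in>topspace U. s (\<phi> u) = r u))"
  by (simp add: pair_iso_def)

lemma pair_iso_sym:
  assumes "pair_iso p q"
  shows "pair_iso q p"
proof -
  obtain U r V s where pq: "p = (U, r)" "q = (V, s)"
    by (metis surj_pair)
  then obtain \<phi> where \<phi>: "homeomorphic_map U V \<phi>" "\<And>u. u \<in> topspace U \<Longrightarrow> s (\<phi> u) = r u"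
    using assms by (auto simp: pair_iso_iff)
  then obtain \<psi> where \<psi>: "homeomorphic_maps V U \<psi> \<phi>"
    by (metis homeomorphic_map_maps homeomorphic_maps_sym)
  have "r (\<psi> v) = s v" if "v \<in> topspace V" for v
  proof -
    have "\<psi> v \<in> topspace U" "\<phi> (\<psi> v) = v"
      using \<psi> that by (auto simp: homeomorphic_maps_def continuous_map_def)
    then show ?thesis
      using \<phi>(2) by metis
  qed
  then show ?thesis
    using homeomorphic_maps_imp_map[OF \<psi>] by (auto simp: pq pair_iso_iff)
qed

lemma pair_iso_trans:
  assumes "pair_iso p q" "pair_iso q t"
  shows "pair_iso p t"
proof -
  obtain U r V s Z y where pq: "p = (U, r)" "q = (V, s)" "t = (Z, y)"
    by (metis surj_pair)
  then obtain \<phi> \<psi> where \<phi>: "homeomorphic_map U V \<phi>" "\<And>u. u \<in> topspace U \<Longrightarrow> s (\<phi> u) = r u"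
    and \<psi>: "homeomorphic_map V Z \<psi>" "\<And>v. v \<in> topspace V \<Longrightarrow> y (\<psi> v) = s v"
    using assms by (auto simp: pair_iso_iff)
  have "y ((\<psi> \<circ> \<phi>) u) = r u" if "u \<in> topspace U" for u
    using homeomorphic_imp_surjective_map[OF \<phi>(1)] \<phi>(2)[OF that] \<psi>(2)[of "\<phi> u"] that by auto
  then show ?thesis
    using homeomorphic_map_compose[OF \<phi>(1) \<psi>(1)] unfolding pq pair_iso_iff by blast
qed

subsection \<open>Homeomorphism invariance\<close>

context
  fixes W :: "'a topology" and X :: "'b topology" and f :: "'a \<Rightarrow> 'b"
  assumes f: "homeomorphic_map W X f"
begin

lemma inj_homeo: "inj_on f (topspace W)"
  using f homeomorphic_imp_injective_map by blast

lemma CB_image: "CB X \<xi> = f ` CB W \<xi>"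
proof (induction \<xi> rule: less_induct)
  case (less \<xi>)
  show ?case
  proof (cases \<xi> rule: omega1_cases)
    case 1
    then show ?thesis
      using homeomorphic_imp_surjective_map[OF f] by (simp add: CB_zero)
  next
    case (2 \<eta>)
    then have "CB X \<eta> = f ` CB W \<eta>"
      by (intro less.IH) (simp add: less_osuc)
    then show ?thesis
      using homeomorphic_map_derived_set_of[OF f CB_subset_topspace[of W \<eta>]] 2 by (simp add: CB_osuc)
  next
    case 3
    then have "0 < \<xi>"
      using omega1_zero_le[of \<xi>] by (auto simp: olimit_def less_le)
    \<comment> \<open>Images commute with intersections for an injective map and a nonempty index
      set, hence the witness \<open>0\<close>.\<close>
    have "f ` (\<Inter>\<eta>\<in>{..<\<xi>}. CB W \<eta>) = (\<Inter>\<eta>\<in>{..<\<xi>}. f ` CB W \<eta>)"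
      using \<open>0 < \<xi>\<close> CB_subset_topspace[of W] by (intro image_INT[OF inj_homeo, of _ _ 0]) auto
    then show ?thesis
      using less.IH by (simp add: CB_olimit[OF 3])
  qed
qed

lemma nu_image: "nu X = nu W"
  unfolding nu_def CB_image
  by (simp add: inj_on_image_eq_iff[OF inj_homeo] CB_subset_topspace)

lemma kernel_image: "kernel X = f ` kernel W"
  by (simp add: kernel_def CB_image nu_image)

lemma CB_Diff_kernel_image: "CB X \<xi> - kernel X = f ` (CB W \<xi> - kernel W)"
  using inj_on_image_set_diff[OF inj_homeo, of "CB W \<xi>" "kernel W"] CB_subset_topspace[of W \<xi>]
    kernel_subset_topspace[of W] by (auto simp: CB_image kernel_image)

lemma CB_level_image: "CB_level X \<xi> = f ` CB_level W \<xi>"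
  using inj_on_image_set_diff[OF inj_homeo, of "CB W \<xi>" "CB W (osuc \<xi>)"] CB_subset_topspace[of W]
  by (auto simp: CB_level_def CB_image)

lemma CB_Diff_subset: "CB W \<xi> - S \<subseteq> topspace W"
  using CB_subset_topspace[of W \<xi>] by blast

lemma rank_fun_image:
  assumes "x \<in> topspace W"
  shows "rank_fun X (f x) = rank_fun W x"
proof -
  have "f x \<in> X closure_of (CB X \<xi> - kernel X) \<longleftrightarrow> x \<in> W closure_of (CB W \<xi> - kernel W)" for \<xi>
    unfolding CB_Diff_kernel_image homeomorphic_map_closure_of[OF f CB_Diff_subset]
    by (rule inj_on_image_mem_iff[OF inj_homeo assms closure_of_subset_topspace])
  then show ?thesis
    by (simp add: rank_fun_def)
qed

lemma lambda_image: "lambda X = lambda W"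
  unfolding lambda_def CB_Diff_kernel_image
  using homeomorphic_map_closedness[OF f CB_Diff_subset] by simp

lemma rho_image: "rho X = rho W"
proof -
  have "CB_level W \<xi> \<subseteq> topspace W" for \<xi>
    by (simp add: CB_level_def CB_Diff_subset)
  then have "X closure_of CB_level X \<xi> = f ` (W closure_of CB_level W \<xi>)" for \<xi>
    by (simp add: CB_level_image homeomorphic_map_closure_of[OF f])
  then have "compactin X (X closure_of CB_level X \<xi>) \<longleftrightarrow> compactin W (W closure_of CB_level W \<xi>)" for \<xi>
    using homeomorphic_map_compactness[OF f closure_of_subset_topspace] by simp
  then show ?thesis
    by (simp add: rho_def)
qed

lemma rho_U_image: "rho_U X = rho_U W"
proof -
  have "kernel_above X \<xi> = f ` kernel_above W \<xi>" for \<xi>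
    using rank_fun_image kernel_subset_topspace[of W] by (auto simp: kernel_above_def kernel_image)
  moreover have "kernel_above W \<xi> \<subseteq> topspace W" for \<xi>
    using kernel_subset_topspace[of W] by (auto simp: kernel_above_def)
  ultimately show ?thesis
    using homeomorphic_map_compactness[OF f] by (simp add: rho_U_def)
qed

lemma strongly_uniform_image: "strongly_uniform X \<longleftrightarrow> strongly_uniform W"
  by (simp add: strongly_uniform_def uniform_Stone_def nu_image lambda_image rho_image rho_U_image)

lemma kernel_pair_image: "pair_iso (kernel_pair W) (kernel_pair X)"
proof -
  have "f ` (topspace W \<inter> kernel W) = topspace X \<inter> kernel X"
    using kernel_subset_topspace[of W] kernel_subset_topspace[of X]
    by (metis inf.absorb2 kernel_image)
  then have "homeomorphic_map (subtopology W (kernel W)) (subtopology X (kernel X)) f"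
    by (rule homeomorphic_map_subtopologies[OF f])
  then show ?thesis
    using rank_fun_image by (auto simp: kernel_pair_def pair_iso_iff)
qed

end

text \<open>Without kernel points \<open>lambda W\<close> is zero, so by uniformity
  \<open>nu W\<close> is zero and the kernel is the whole space.\<close>

lemma kernel_eq_empty:
  assumes W: "omega_Stone_space W" "strongly_uniform W" and "kernel W = {}"
  shows "topspace W = {}"
proof -
  have "kernel_above W \<xi> = {}" for \<xi>
    using assms(3) by (simp add: kernel_above_def)
  then have "lambda W = 0"
    using lambda_eq[OF W(1)] Least_le[of "\<lambda>\<xi>. kernel_above W \<xi> = {}" 0] by (simp add: order_antisym)
  then have "nu W = 0"
    using W(2) by (simp add: strongly_uniform_def uniform_Stone_def)
  then show ?thesis
    using assms(3) by (simp add: kernel_def CB_zero)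
qed

lemma closedin_rank_fun_ge:
  assumes W: "omega_Stone_space W"
  shows "closedin W {x \<in> kernel W. \<xi> \<le> rank_fun W x}"
proof -
  \<comment> \<open>Inserting \<open>kernel W\<close> keeps the intersected family nonempty when
    \<open>\<xi>\<close> is zero.\<close>
  have "{x \<in> kernel W. \<xi> \<le> rank_fun W x} = kernel W \<inter> \<Inter>(insert (kernel W) (kernel_above W ` {..<\<xi>}))"
    using not_le by (fastforce simp: kernel_above_def dest: less_le_trans)
  moreover have "closedin W (\<Inter>(insert (kernel W) (kernel_above W ` {..<\<xi>})))"
    using closedin_kernel_above[OF W] closedin_kernel[OF omega_Stone_spaceD(3)[OF W]]
    by (intro closedin_Inter) auto
  ultimately show ?thesis
    using closedin_kernel[OF omega_Stone_spaceD(3)[OF W]] by (simp add: closedin_Int)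
qed

text \<open>The kernel is its own derived set, so it is perfect and homeomorphic to one of the two
  Cantor spaces; the rank function is carried over by the inverse map.\<close>

lemma kernel_pair_model:
  assumes W: "omega_Stone_space W" "strongly_uniform W" and ne: "topspace W \<noteq> {}"
  shows "\<exists>p\<in>model_pairs. pair_iso (kernel_pair W) p"
proof -
  let ?K = "subtopology W (kernel W)"
  have top: "topspace ?K = kernel W"
    using kernel_subset_topspace[of W] by auto
  have "omega_Stone_space ?K"
    using closedin_kernel[OF omega_Stone_spaceD(3)[OF W(1)]] by (intro omega_Stone_subtopology W(1)) simp
  moreover have "?K derived_set_of (topspace ?K) = topspace ?K"
    unfolding top using derived_set_of_kernel[OF W(1)] by (simp add: derived_set_of_subtopology)
  moreover have "topspace ?K \<noteq> {}"
    unfolding top using kernel_eq_empty[OF W] ne by blast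
  ultimately obtain C where C: "C \<in> {Cantor0, Cantor1}" "?K homeomorphic_space C"
    using perfect_homeomorphic_Cantor[of ?K] by blast
  then obtain \<phi> \<psi> where h: "homeomorphic_maps ?K C \<phi> \<psi>"
    by (auto simp: homeomorphic_space_def)
  define r where "r = rank_fun W \<circ> \<psi>"
  have inv: "\<psi> (\<phi> x) = x" "\<phi> x \<in> topspace C" if "x \<in> kernel W" for x
    using h that top by (auto simp: homeomorphic_maps_def continuous_map_def)
  have inv': "\<phi> (\<psi> y) = y" "\<psi> y \<in> kernel W" if "y \<in> topspace C" for y
    using h that top by (auto simp: homeomorphic_maps_def continuous_map_def)
  have "closedin C {y \<in> topspace C. r y \<ge> \<xi>}" for \<xi>
  proof -
    let ?S = "{x \<in> kernel W. \<xi> \<le> rank_fun W x}"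
    have "{y \<in> topspace C. r y \<ge> \<xi>} = \<phi> ` ?S"
    proof (intro equalityI subsetI)
      fix y assume "y \<in> {y \<in> topspace C. r y \<ge> \<xi>}"
      then have "y = \<phi> (\<psi> y)" "\<psi> y \<in> ?S"
        using inv'[of y] by (auto simp: r_def)
      then show "y \<in> \<phi> ` ?S"
        by (rule image_eqI)
    qed (auto simp: r_def inv)
    moreover have "closedin ?K ?S"
      using closedin_rank_fun_ge[OF W(1)] by (intro closedin_subset_topspace) auto
    then have "closedin C (\<phi> ` ?S)"
      using homeomorphic_map_closedness[OF homeomorphic_maps_imp_map[OF h], of ?S] top by auto
    ultimately show ?thesis
      by simp
  qed
  then have "(C, r) \<in> model_pairs"
    using C(1) by (auto simp: model_pairs_def usc_def)
  moreover have "pair_iso (kernel_pair W) (C, r)"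
    using homeomorphic_maps_imp_map[OF h] top inv by (auto simp: kernel_pair_def pair_iso_iff r_def)
  ultimately show ?thesis
    by blast
qed

subsection \<open>Existence\<close>

text \<open>A value \<open>\<xi>\<close> of \<open>r\<close> is the maximum of \<open>r\<close> on
  some compact open set, by semi-continuity. Distinct values thus need distinct compact open sets,
  so only countably many occur, even if \<open>C\<close> is not compact.\<close>

lemma usc_bounded:
  assumes C: "omega_Stone_space C" and r: "usc C r"
  shows "\<exists>N. \<forall>x\<in>topspace C. r x \<le> N"
proof -
  let ?R = "r ` topspace C"
  have "\<exists>x A. x \<in> topspace C \<and> r x = \<xi> \<and> compact_open C A \<and> x \<in> A \<and> (\<forall>y\<in>A. r y \<le> \<xi>)"
    if \<xi>: "\<xi> \<in> ?R" for \<xi>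
  proof -
    obtain x where x: "x \<in> topspace C" "r x = \<xi>"
      using \<xi> by blast
    let ?U = "topspace C - {y \<in> topspace C. r y \<ge> osuc \<xi>}"
    have "openin C ?U"
      using r by (auto simp: usc_def)
    moreover have "x \<in> ?U"
      using x by (simp add: osuc_le_iff)
    ultimately obtain A where "compact_open C A" "x \<in> A" "A \<subseteq> ?U"
      by (rule omega_Stone_base[OF C])
    then have "compact_open C A \<and> x \<in> A \<and> (\<forall>y\<in>A. r y \<le> \<xi>)"
      by (auto simp: osuc_le_iff not_less)
    then show ?thesis
      using x by blast
  qed
  then obtain x A where xA: "\<And>\<xi>. \<xi> \<in> ?R \<Longrightarrow> x \<xi> \<in> topspace C \<and> r (x \<xi>) = \<xi> \<and>
      compact_open C (A \<xi>) \<and> x \<xi> \<in> A \<xi> \<and> (\<forall>y\<in>A \<xi>. r y \<le> \<xi>)"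
    by metis
  have "inj_on A ?R"
  proof (rule inj_onI)
    fix \<xi> \<eta> assume "\<xi> \<in> ?R" "\<eta> \<in> ?R" "A \<xi> = A \<eta>"
    then have "\<xi> \<le> \<eta>" "\<eta> \<le> \<xi>"
      using xA[of \<xi>] xA[of \<eta>] by metis+
    then show "\<xi> = \<eta>"
      by simp
  qed
  moreover have "countable (A ` ?R)"
    using xA by (intro countable_subset[OF _ countable_compact_open[OF omega_Stone_spaceD(4)[OF C]]]) auto
  ultimately have "countable ?R"
    by (rule countable_image_inj_on[rotated])
  then show ?thesis
    using countable_omega1_bounded[of ?R] by blast
qed

text \<open>Indices encode pairs: the first component enumerates the countable set
  \<open>{..N}\<close> and the second repeats each value.\<close>

lemma exists_infinite_repetition:
  "\<exists>e :: nat \<Rightarrow> omega1. \<forall>\<xi>\<le>N. infinite {k. e k = \<xi>}"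
proof (intro exI allI impI)
  let ?e = "\<lambda>k. from_nat_into {..N} (fst (prod_decode k))"
  fix \<xi> assume "\<xi> \<le> N"
  then obtain n where n: "from_nat_into {..N} n = \<xi>"
    using from_nat_into_surj[OF countable_atMost_omega1[of N], of \<xi>] by auto
  have "inj (\<lambda>i :: nat. prod_encode (n, i))"
    by (auto intro: injI)
  then have "infinite (range (\<lambda>i :: nat. prod_encode (n, i)))"
    using finite_imageD infinite_UNIV_nat by blast
  moreover have "range (\<lambda>i. prod_encode (n, i)) \<subseteq> {k. ?e k = \<xi>}"
    using n by auto
  ultimately show "infinite {k. ?e k = \<xi>}"
    using infinite_super by blast
qed

section \<open>The model space of decorated sequences\<close>

text \<open>A point \<open>w\<close> of the space below consists of a binary sequence \<open>fst \<circ> w\<close> and of a set of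
  positions (those where \<open>snd \<circ> w\<close> holds) along which \<open>e\<close> strictly decreases, so that this set is
  finite. With the empty set we obtain the points of the kernel; otherwise the minimum of \<open>e\<close> on the
  set is the Cantor-Bendixson rank of \<open>w\<close>, as \<open>w\<close> is the limit of the points that have one more,
  arbitrarily late, position of a given smaller \<open>e\<close>-value. The condition on the first position
  \<open>p\<close> says that the prefix of length \<open>p\<close> extends to a point of \<open>C\<close> of rank more than \<open>e p\<close>.\<close>

definition decorated :: "(nat \<Rightarrow> bool) set \<Rightarrow> ((nat \<Rightarrow> bool) \<Rightarrow> omega1) \<Rightarrow> (nat \<Rightarrow> omega1) \<Rightarrow>
    (nat \<Rightarrow> bool \<times> bool) set"
  where "decorated K r e = {w.
    (\<forall>i j. i < j \<and> snd (w i) \<and> snd (w j) \<longrightarrow> e j < e i) \<and>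
    (\<forall>p n. snd (w p) \<and> p \<le> n \<longrightarrow> \<not> fst (w n)) \<and>
    (\<forall>p. snd (w p) \<and> (\<forall>q<p. \<not> snd (w q)) \<longrightarrow>
      (\<exists>y\<in>K. (\<forall>n<p. y n = fst (w n)) \<and> e p < r y))}"

definition plain :: "(nat \<Rightarrow> bool) \<Rightarrow> nat \<Rightarrow> bool \<times> bool"
  where "plain x = (\<lambda>n. (x n, False))"

text \<open>Each way of violating the three conditions is visible in a finite prefix.\<close>

lemma closedin_decorated: "closedin seq_space (decorated K r e)"
proof -
  have "\<exists>m. \<forall>w'. (\<forall>n<m. w' n = w n) \<longrightarrow> w' \<in> UNIV - decorated K r e"
    if w: "w \<in> UNIV - decorated K r e" for w
  proof -
    consider i j where "i < j" "snd (w i)" "snd (w j)" "\<not> e j < e i"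
      | p n where "snd (w p)" "p \<le> n" "fst (w n)"
      | p where "snd (w p)" "\<forall>q<p. \<not> snd (w q)" "\<not> (\<exists>y\<in>K. (\<forall>n<p. y n = fst (w n)) \<and> e p < r y)"
      using w unfolding decorated_def by blast
    then show ?thesis
    proof cases
      case (1 i j)
      have "w' \<notin> decorated K r e" if "\<forall>n<Suc j. w' n = w n" for w'
      proof -
        have "w' i = w i" "w' j = w j"
          using that 1 by auto
        then show ?thesis
          using 1 by (auto simp: decorated_def)
      qed
      then show ?thesis
        by blast
    next
      case (2 p n)
      have "w' \<notin> decorated K r e" if "\<forall>k<Suc n. w' k = w k" for w'
      proof -
        have "w' p = w p" "w' n = w n"
          using that 2 by auto
        then have "snd (w' p)" "p \<le> n" "fst (w' n)"
          using 2 by auto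
        then show ?thesis
          unfolding decorated_def by blast
      qed
      then show ?thesis
        by blast
    next
      case (3 p)
      have "w' \<notin> decorated K r e" if w': "\<forall>k<Suc p. w' k = w k" for w'
      proof
        assume "w' \<in> decorated K r e"
        moreover have "snd (w' p)" "\<forall>q<p. \<not> snd (w' q)"
          using w' 3 by auto
        ultimately have "\<exists>y\<in>K. (\<forall>n<p. y n = fst (w' n)) \<and> e p < r y"
          by (simp add: decorated_def)
        then show False
          using w' 3(3) by auto
      qed
      then show ?thesis
        by blast
    qed
  qed
  then have "openin seq_space (UNIV - decorated K r e)"
    unfolding openin_seq_space by (intro ballI)
  then show ?thesis
    by (simp add: closedin_def)
qed

lemma continuous_map_seq_space:
  "continuous_map seq_space seq_space (\<lambda>w n. f (w n))"
  unfolding continuous_map_def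
proof (intro conjI allI impI)
  fix U :: "(nat \<Rightarrow> 'b) set" assume U: "openin seq_space U"
  show "openin seq_space {w \<in> topspace seq_space. (\<lambda>n. f (w n)) \<in> U}"
    unfolding openin_seq_space
  proof
    fix w assume "w \<in> {w \<in> topspace seq_space. (\<lambda>n. f (w n)) \<in> U}"
    then have "(\<lambda>n. f (w n)) \<in> U"
      by simp
    from bspec[OF U[unfolded openin_seq_space] this]
    obtain m where m: "\<forall>v. (\<forall>n<m. v n = f (w n)) \<longrightarrow> v \<in> U"
      by (elim exE) (rule that)
    show "\<exists>m. \<forall>w'. (\<forall>n<m. w' n = w n) \<longrightarrow> w' \<in> {w \<in> topspace seq_space. (\<lambda>n. f (w n)) \<in> U}"
      using m by (intro exI[of _ m]) simp
  qed
qed simp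

text \<open>Infinitely many indices for each value below a rank allow a mark of that value to be
  placed arbitrarily late, that is, arbitrarily close to a given point.\<close>

locale ranked_model =
  fixes C :: "(nat \<Rightarrow> bool) topology" and r :: "(nat \<Rightarrow> bool) \<Rightarrow> omega1" and e :: "nat \<Rightarrow> omega1"
  assumes C: "C \<in> {Cantor0, Cantor1}" and usc: "usc C r"
    and e: "\<And>x \<xi>. x \<in> topspace C \<Longrightarrow> \<xi> < r x \<Longrightarrow> infinite {k. e k = \<xi>}"
begin

text \<open>\<open>decorated\<close> contains \<open>plain x\<close> for every \<open>x\<close>; the
  extra condition removes the one such point that does not belong to \<open>Cantor0\<close>.\<close>

definition S :: "(nat \<Rightarrow> bool \<times> bool) set"
  where "S = {w \<in> decorated (topspace C) r e. (\<forall>n. \<not> snd (w n)) \<longrightarrow> fst \<circ> w \<in> topspace C}"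

definition W :: "(nat \<Rightarrow> bool \<times> bool) topology"
  where "W = subtopology seq_space S"

lemma topspace_W [simp]: "topspace W = S"
  by (simp add: W_def)

lemma plain_in_S_iff: "plain x \<in> S \<longleftrightarrow> x \<in> topspace C"
  by (simp add: S_def decorated_def plain_def comp_def)

lemma nonplain_in_S: "w \<in> decorated (topspace C) r e \<Longrightarrow> snd (w p) \<Longrightarrow> w \<in> S"
  by (auto simp: S_def)

lemma C_eq: "C = subtopology seq_space (topspace C)"
  using C by (auto simp: Cantor0_def Cantor1_eq)

lemma decreasing: "w \<in> S \<Longrightarrow> i < j \<Longrightarrow> snd (w i) \<Longrightarrow> snd (w j) \<Longrightarrow> e j < e i"
  by (simp add: S_def decorated_def)

lemma padded: "w \<in> S \<Longrightarrow> snd (w p) \<Longrightarrow> p \<le> n \<Longrightarrow> \<not> fst (w n)"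
  by (simp add: S_def decorated_def)

lemma first_position:
  assumes w: "w \<in> S" and p: "snd (w p)"
  obtains q y where "snd (w q)" "\<And>i. i < q \<Longrightarrow> \<not> snd (w i)" "y \<in> topspace C"
    "\<And>n. n < q \<Longrightarrow> y n = fst (w n)" "e q < r y"
proof -
  define q where "q = (LEAST q. snd (w q))"
  have q: "snd (w q)" "\<forall>i<q. \<not> snd (w i)"
    unfolding q_def by (rule LeastI[of "\<lambda>q. snd (w q)", OF p]) (auto dest: not_less_Least)
  then obtain y where "y \<in> topspace C" "\<forall>n<q. y n = fst (w n)" "e q < r y"
    using w unfolding S_def decorated_def by blast
  then show ?thesis
    using q by (intro that[of q y]) simp_all
qed

text \<open>A marked position with least \<open>e\<close>-value exists by well-ordering. No mark can
  follow it, as \<open>e\<close> strictly decreases along marks.\<close>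

lemma last_position:
  assumes w: "w \<in> S" and p: "snd (w p)"
  obtains t where "snd (w t)" "\<And>q. t < q \<Longrightarrow> \<not> snd (w q)" "\<And>q. snd (w q) \<Longrightarrow> e t \<le> e q"
proof -
  define \<xi> where "\<xi> = (LEAST \<xi>. \<exists>q. snd (w q) \<and> e q = \<xi>)"
  have "\<exists>q. snd (w q) \<and> e q = \<xi>"
    unfolding \<xi>_def by (rule LeastI[of _ "e p"]) (use p in blast)
  then obtain t where t: "snd (w t)" "e t = \<xi>"
    by blast
  have least: "e t \<le> e q" if "snd (w q)" for q
    unfolding t(2) \<xi>_def by (rule Least_le) (use that in blast)
  have "\<not> snd (w q)" if "t < q" for q
    using decreasing[OF w that t(1)] least[of q] by auto
  then show ?thesis
    by (rule that[OF t(1) _ least])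
qed

lemma nhds_W:
  assumes "openin W U" "w \<in> U"
  obtains m where "\<And>w'. w' \<in> S \<Longrightarrow> (\<And>n. n < m \<Longrightarrow> w' n = w n) \<Longrightarrow> w' \<in> U"
proof -
  obtain V where V: "openin seq_space V" "U = V \<inter> S"
    using assms(1) unfolding W_def openin_subtopology by blast
  then obtain m where m: "\<forall>w'. (\<forall>n<m. w' n = w n) \<longrightarrow> w' \<in> V"
    using assms(2) unfolding openin_seq_space by blast
  show ?thesis
    by (rule that[of m]) (use m V(2) in simp)
qed

lemma openin_W_cylinder: "openin W {w' \<in> S. \<forall>n<m. w' n = w n}"
proof -
  have "{w' \<in> S. \<forall>n<m. w' n = w n} = {w'. \<forall>n<m. w' n = w n} \<inter> S"
    by blast
  then show ?thesis
    by (simp add: W_def openin_subtopology_Int openin_seq_space_cylinder)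
qed

lemma derived_set_of_W:
  "w \<in> W derived_set_of T \<longleftrightarrow> w \<in> S \<and> (\<forall>m. \<exists>w'\<in>T \<inter> S. w' \<noteq> w \<and> (\<forall>n<m. w' n = w n))"
  (is "?l \<longleftrightarrow> ?r")
proof
  assume ?l
  then have w: "w \<in> S"
    and lim: "\<And>T'. w \<in> T' \<Longrightarrow> openin W T' \<Longrightarrow> \<exists>y. y \<noteq> w \<and> y \<in> T \<and> y \<in> T'"
    unfolding in_derived_set_of topspace_W by blast+
  have "\<exists>w'\<in>T \<inter> S. w' \<noteq> w \<and> (\<forall>n<m. w' n = w n)" for m
    using lim[OF _ openin_W_cylinder, of m w] w by auto
  then show ?r
    using w by simp
next
  assume R: ?r
  have "\<exists>y. y \<noteq> w \<and> y \<in> T \<and> y \<in> U" if U: "openin W U" "w \<in> U" for U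
  proof -
    obtain m where m: "\<And>w'. w' \<in> S \<Longrightarrow> (\<And>n. n < m \<Longrightarrow> w' n = w n) \<Longrightarrow> w' \<in> U"
      using nhds_W[OF U] by metis
    obtain w' where w': "w' \<in> T" "w' \<in> S" "w' \<noteq> w" "\<forall>n<m. w' n = w n"
      using R by blast
    then have "w' \<in> U"
      by (intro m) simp_all
    then show ?thesis
      using w' by blast
  qed
  moreover have "w \<in> topspace W"
    using R by simp
  ultimately show ?l
    unfolding in_derived_set_of by blast
qed

lemma closure_of_W:
  assumes "T \<subseteq> S"
  shows "w \<in> W closure_of T \<longleftrightarrow> w \<in> S \<and> (\<forall>m. \<exists>w'\<in>T. \<forall>n<m. w' n = w n)"
proof (cases "w \<in> T")
  case True
  then show ?thesis
    using assms closure_of_subset[of T W] by auto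
next
  case False
  then have "w \<in> W closure_of T \<longleftrightarrow> w \<in> W derived_set_of T"
    by (simp add: closure_of_alt)
  also have "\<dots> \<longleftrightarrow> w \<in> S \<and> (\<forall>m. \<exists>w'\<in>T. \<forall>n<m. w' n = w n)"
    unfolding derived_set_of_W Int_absorb2[OF assms] using False by metis
  finally show ?thesis .
qed

lemma omega_Stone_W: "omega_Stone_space W"
proof -
  let ?D = "decorated (topspace C) r e"
  have D: "omega_Stone_space (subtopology seq_space ?D)"
    by (intro omega_Stone_subtopology omega_Stone_seq_space disjI1 closedin_decorated)
  show ?thesis
  proof (cases "topspace C = UNIV")
    case True
    then have "S = ?D"
      by (auto simp: S_def)
    then show ?thesis
      using D by (simp add: W_def)
  next
    case False
    then have top: "topspace C = UNIV - {\<lambda>_. False}"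
      using C by auto
    have "fst \<circ> w \<in> topspace C" if "\<not> (\<forall>n. \<not> snd (w n)) \<or> w \<noteq> plain (\<lambda>_. False)" "\<forall>n. \<not> snd (w n)" for w
      using that unfolding top by (auto simp: plain_def fun_eq_iff prod_eq_iff)
    moreover have "plain (\<lambda>_. False) \<notin> S"
      unfolding plain_in_S_iff top by simp
    \<comment> \<open>The double intersection lets the subspace be taken in two steps: first the
      closed set \<open>?D\<close>, then an open part of it.\<close>
    ultimately have S: "S = ?D \<inter> (?D - {plain (\<lambda>_. False)})"
      by (auto simp: S_def)
    have "openin (subtopology seq_space ?D) ?D"
      using openin_topspace[of "subtopology seq_space ?D"] by simp
    then have "openin (subtopology seq_space ?D) (?D - {plain (\<lambda>_. False)})"
      by (rule openin_Diff_finite[OF omega_Stone_spaceD(3)[OF D]]) simp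
    from omega_Stone_subtopology[OF D disjI2[OF this]] show ?thesis
      by (simp add: W_def subtopology_subtopology S[symmetric])
  qed
qed

section \<open>Cantor-Bendixson derivatives of the model space\<close>

lemma perfect_C: "x \<in> topspace C \<Longrightarrow> \<exists>y\<in>topspace C. y \<noteq> x \<and> (\<forall>n<m. y n = x n)"
proof -
  assume x: "x \<in> topspace C"
  consider "C = Cantor0" | "C = Cantor1"
    using C by blast
  then have "C derived_set_of (topspace C) = topspace C"
    by cases (simp only: perfect_Cantor0, simp only: perfect_Cantor1 topspace_Cantor)
  then have "x \<in> C derived_set_of (topspace C)"
    using x by simp
  then have lim: "\<And>T. x \<in> T \<Longrightarrow> openin C T \<Longrightarrow> \<exists>y. y \<noteq> x \<and> y \<in> topspace C \<and> y \<in> T"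
    unfolding in_derived_set_of by blast
  have "openin C ({y. \<forall>n<m. y n = x n} \<inter> topspace C)"
    by (subst C_eq) (simp add: openin_subtopology_Int openin_seq_space_cylinder)
  from lim[OF _ this] x show ?thesis
    by auto
qed

lemma add_position:
  assumes w: "w \<in> S" and t: "snd (w t)" "\<And>q. snd (w q) \<Longrightarrow> e t \<le> e q" and k: "t < k" "e k < e t"
  shows "w(k := (False, True)) \<in> S"
proof (rule nonplain_in_S[of _ k])
  let ?w = "w(k := (False, True))"
  \<comment> \<open>After a mark all first components are already \<open>False\<close>, so the
    update only adds a mark.\<close>
  have fst: "fst (?w n) = fst (w n)" for n
    using padded[OF w t(1), of k] k by simp
  have late: "\<not> snd (w q)" if "t < q" for q
    using decreasing[OF w that t(1)] t(2)[of q] by auto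
  have "e j < e i" if "i < j" "snd (?w i)" "snd (?w j)" for i j
  proof (cases "j = k")
    case True
    then have "snd (w i)"
      using that by auto
    then show ?thesis
      using t(2)[of i] k(2) True by simp
  next
    case False
    then have j: "snd (w j)"
      using that by auto
    then have "j \<le> t"
      using late[of j] by (auto simp: not_less[symmetric])
    then have "snd (w i)"
      using that k by auto
    then show ?thesis
      using decreasing[OF w that(1)] j by simp
  qed
  moreover have "\<not> fst (?w n)" if "snd (?w p)" "p \<le> n" for p n
  proof (cases "p = k")
    case True
    then show ?thesis
      unfolding fst using padded[OF w t(1), of n] that k by simp
  next
    case False
    then show ?thesis
      unfolding fst using padded[OF w, of p n] that by simp
  qed
  moreover have "\<exists>y\<in>topspace C. (\<forall>n<p. y n = fst (?w n)) \<and> e p < r y"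
    if p: "snd (?w p)" "\<forall>q<p. \<not> snd (?w q)" for p
  proof -
    have "\<not> t < p"
      using p(2) t(1) k by auto
    then have "p \<noteq> k" "\<forall>q<p. \<not> snd (w q)"
      using k p(2) by auto
    then show ?thesis
      unfolding fst using p(1) w by (simp add: S_def decorated_def)
  qed
  ultimately show "?w \<in> decorated (topspace C) r e"
    unfolding decorated_def by blast
qed simp

lemma single_position:
  assumes y: "y \<in> topspace C" "e k < r y"
  shows "(\<lambda>n. (n < k \<and> y n, n = k)) \<in> S"
  by (rule nonplain_in_S[of _ k]) (use y in \<open>auto simp: decorated_def\<close>)

text \<open>The derivative of order \<open>\<xi>\<close>, as shown below. Sequences without marks
  satisfy the condition vacuously and so lie in every layer.\<close>

definition layer :: "omega1 \<Rightarrow> (nat \<Rightarrow> bool \<times> bool) set"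
  where "layer \<xi> = {w \<in> S. \<forall>p. snd (w p) \<longrightarrow> \<xi> \<le> e p}"

text \<open>A point near a marked \<open>w\<close> differs from it only by further marks, whose
  values are smaller than all those of \<open>w\<close>; conversely, marks of value
  \<open>\<xi>\<close> can be added arbitrarily late. Unmarked points are limits of unmarked points,
  as \<open>C\<close> is perfect.\<close>

lemma derived_set_of_layer: "W derived_set_of (layer \<xi>) = layer (osuc \<xi>)"
proof (intro equalityI subsetI)
  fix w assume w: "w \<in> W derived_set_of (layer \<xi>)"
  then have wS: "w \<in> S"
    by (simp add: derived_set_of_W)
  have "\<xi> < e p" if p: "snd (w p)" for p
  proof -
    obtain t where t: "snd (w t)" "\<And>q. t < q \<Longrightarrow> \<not> snd (w q)" "\<And>q. snd (w q) \<Longrightarrow> e t \<le> e q"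
      using last_position[OF wS p] by metis
    obtain w' where w': "w' \<in> layer \<xi>" "w' \<in> S" "w' \<noteq> w" "\<forall>n<Suc t. w' n = w n"
      using w unfolding derived_set_of_W by blast
    have t': "snd (w' t)"
      using w'(4) t(1) by simp
    \<comment> \<open>Beyond the mark at \<open>t\<close> both sequences have first component
      \<open>False\<close>, so they can only differ by a mark of \<open>w'\<close>.\<close>
    have "\<exists>q>t. snd (w' q)"
    proof (rule ccontr)
      assume no: "\<not> ?thesis"
      have "w' n = w n" for n
      proof (cases "n \<le> t")
        case False
        then show ?thesis
          using no t(2)[of n] padded[OF w'(2) t', of n] padded[OF wS t(1), of n] by (simp add: prod_eq_iff)
      qed (use w'(4) in simp)
      then show False
        using w'(3) by blast
    qed
    then obtain q where q: "t < q" "snd (w' q)"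
      by blast
    then have "\<xi> \<le> e q" "e q < e t"
      using w'(1) decreasing[OF w'(2) q(1) t' q(2)] by (auto simp: layer_def)
    then show ?thesis
      using t(3)[OF p] by simp
  qed
  then show "w \<in> layer (osuc \<xi>)"
    using wS by (simp add: layer_def osuc_le_iff)
next
  fix w assume w: "w \<in> layer (osuc \<xi>)"
  then have wS: "w \<in> S" and rk: "\<And>p. snd (w p) \<Longrightarrow> \<xi> < e p"
    by (auto simp: layer_def osuc_le_iff)
  have "\<exists>w'\<in>layer \<xi> \<inter> S. w' \<noteq> w \<and> (\<forall>n<m. w' n = w n)" for m
  proof (cases "\<exists>p. snd (w p)")
    case True
    then obtain p where p: "snd (w p)"
      by blast
    obtain t where t: "snd (w t)" "\<And>q. t < q \<Longrightarrow> \<not> snd (w q)" "\<And>q. snd (w q) \<Longrightarrow> e t \<le> e q"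
      using last_position[OF wS p] by metis
    obtain q y where "snd (w q)" "y \<in> topspace C" "e q < r y"
      using first_position[OF wS p] by metis
    \<comment> \<open>The value at the first mark lies above \<open>\<xi>\<close> and below the rank
      of \<open>y\<close>, so the assumption on \<open>e\<close> applies to
      \<open>\<xi>\<close>.\<close>
    then have "infinite {k. e k = \<xi>}"
      using rk[of q] e[of y \<xi>] by simp
    then obtain k where k: "max t m < k" "e k = \<xi>"
      unfolding infinite_nat_iff_unbounded by blast
    let ?w = "w(k := (False, True))"
    have "?w \<in> S"
      using k rk[OF t(1)] by (intro add_position[OF wS t(1,3)]) auto
    moreover have "\<xi> \<le> e q" if "snd (?w q)" for q
      using that k(2) rk[of q] by (cases "q = k") auto
    moreover have "?w \<noteq> w"
      using t(2)[of k] k(1) by (metis fun_upd_same max_less_iff_conj snd_conv)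
    moreover have "\<forall>n<m. ?w n = w n"
      using k(1) by simp
    ultimately show ?thesis
      by (intro bexI[of _ ?w]) (auto simp: layer_def)
  next
    case False
    then have "w = plain (fst \<circ> w)"
      by (simp add: plain_def fun_eq_iff prod_eq_iff)
    then have "fst \<circ> w \<in> topspace C"
      using wS plain_in_S_iff by metis
    then obtain y where y: "y \<in> topspace C" "y \<noteq> fst \<circ> w" "\<forall>n<m. y n = (fst \<circ> w) n"
      using perfect_C by blast
    have "plain y \<in> S"
      using y plain_in_S_iff by blast
    moreover have "plain y \<noteq> w"
      using y(2) by (auto simp: plain_def comp_def)
    moreover have "\<forall>n<m. plain y n = w n"
      using y(3) False by (simp add: plain_def prod_eq_iff)
    ultimately show ?thesis
      by (intro bexI[of _ "plain y"]) (auto simp: layer_def plain_def)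
  qed
  then show "w \<in> W derived_set_of (layer \<xi>)"
    using wS by (simp add: derived_set_of_W)
qed

lemma CB_W: "CB W \<xi> = layer \<xi>"
proof (induction \<xi> rule: less_induct)
  case (less \<xi>)
  show ?case
  proof (cases \<xi> rule: omega1_cases)
    case 1
    then show ?thesis
      by (simp add: CB_zero layer_def)
  next
    case (2 \<eta>)
    then show ?thesis
      using less.IH[of \<eta>] by (simp add: CB_osuc less_osuc derived_set_of_layer)
  next
    case 3
    have lim: "osuc \<eta> < \<xi>" if "\<eta> < \<xi>" for \<eta>
      using that 3 osuc_le_iff[of \<eta> \<xi>] by (auto simp: olimit_def le_less)
    have "0 < \<xi>"
      using 3 omega1_zero_le[of \<xi>] by (auto simp: olimit_def less_le)
    have "(\<Inter>\<eta>\<in>{..<\<xi>}. layer \<eta>) = layer \<xi>"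
    proof (intro equalityI subsetI)
      fix w assume w: "w \<in> (\<Inter>\<eta>\<in>{..<\<xi>}. layer \<eta>)"
      have "\<xi> \<le> e p" if p: "snd (w p)" for p
      proof (rule ccontr)
        assume "\<not> \<xi> \<le> e p"
        \<comment> \<open>The successor of \<open>e p\<close> is still below the limit
          \<open>\<xi>\<close>.\<close>
        then have "w \<in> layer (osuc (e p))"
          using w lim[of "e p"] by simp
        then have "osuc (e p) \<le> e p"
          using p by (simp add: layer_def)
        then show False
          by (simp add: osuc_le_iff)
      qed
      moreover have "w \<in> S"
        using w \<open>0 < \<xi>\<close> by (auto simp: layer_def)
      ultimately show "w \<in> layer \<xi>"
        by (simp add: layer_def)
    next
      fix w assume w: "w \<in> layer \<xi>"
      have "w \<in> layer \<eta>" if "\<eta> < \<xi>" for \<eta>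
        using w less_imp_le[OF that] order_trans[of \<eta> \<xi>] by (auto simp: layer_def)
      then show "w \<in> (\<Inter>\<eta>\<in>{..<\<xi>}. layer \<eta>)"
        by simp
    qed
    then show ?thesis
      using less.IH by (simp add: CB_olimit[OF 3])
  qed
qed

section \<open>Kernel, ranks and invariants of the model space\<close>

definition above :: "omega1 \<Rightarrow> (nat \<Rightarrow> bool) set"
  where "above \<xi> = {x \<in> topspace C. \<xi> < r x}"

lemma plain_subset_layer: "plain ` topspace C \<subseteq> layer \<xi>"
  using plain_in_S_iff by (auto simp: layer_def plain_def)

lemma layer_cases: "w \<in> layer \<xi> \<Longrightarrow> w \<in> plain ` topspace C \<or> (\<exists>p. snd (w p))"
proof (rule ccontr)
  assume w: "w \<in> layer \<xi>" and no: "\<not> (w \<in> plain ` topspace C \<or> (\<exists>p. snd (w p)))"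
  then have "w = plain (fst \<circ> w)"
    by (simp add: plain_def fun_eq_iff prod_eq_iff)
  moreover have "w \<in> S"
    using w by (simp add: layer_def)
  ultimately show False
    using no plain_in_S_iff by (metis imageI)
qed

text \<open>Here \<open>x\<close> may also be the point of \<open>Cantor1\<close> that is missing from \<open>Cantor0\<close>.\<close>

lemma nonplain_near_plain_iff:
  "(\<forall>m. \<exists>w\<in>layer \<xi> - plain ` topspace C. \<forall>n<m. w n = plain x n) \<longleftrightarrow>
    (\<forall>m. \<exists>y\<in>above \<xi>. \<forall>n<m. y n = x n)"
proof (intro iffI allI)
  fix m assume "\<forall>m. \<exists>w\<in>layer \<xi> - plain ` topspace C. \<forall>n<m. w n = plain x n"
  then obtain w where w: "w \<in> layer \<xi>" "w \<notin> plain ` topspace C" "\<forall>n<m. w n = plain x n"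
    by blast
  then obtain p where p: "snd (w p)"
    using layer_cases by blast
  have "w \<in> S"
    using w by (simp add: layer_def)
  then obtain q y where q: "snd (w q)" "\<And>i. i < q \<Longrightarrow> \<not> snd (w i)" "y \<in> topspace C"
      "\<And>n. n < q \<Longrightarrow> y n = fst (w n)" "e q < r y"
    using first_position[of w p] p by metis
  \<comment> \<open>Before position \<open>m\<close> the sequence agrees with an unmarked one, so
    its first mark comes later.\<close>
  have "m \<le> q"
    using q(1) w(3) by (auto simp: plain_def not_less[symmetric])
  then have "\<forall>n<m. y n = x n"
    using q(4) w(3) by (simp add: plain_def)
  moreover have "y \<in> above \<xi>"
    using q w(1) by (auto simp: above_def layer_def intro: le_less_trans)
  ultimately show "\<exists>y\<in>above \<xi>. \<forall>n<m. y n = x n"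
    by blast
next
  fix m assume "\<forall>m. \<exists>y\<in>above \<xi>. \<forall>n<m. y n = x n"
  then obtain y where y: "y \<in> topspace C" "\<xi> < r y" "\<forall>n<m. y n = x n"
    by (auto simp: above_def)
  then obtain k where k: "m < k" "e k = \<xi>"
    using e unfolding infinite_nat_iff_unbounded by blast
  let ?w = "\<lambda>n. (n < k \<and> y n, n = k)"
  have "?w \<in> layer \<xi>"
    using single_position[OF y(1), of k] y k by (simp add: layer_def)
  moreover have "?w \<notin> plain ` topspace C"
  proof
    assume "?w \<in> plain ` topspace C"
    then obtain z where "?w = plain z"
      by blast
    from fun_cong[OF this, of k] show False
      by (simp add: plain_def)
  qed
  moreover have "\<forall>n<m. ?w n = plain x n"
    using y(3) k by (simp add: plain_def)
  ultimately show "\<exists>w\<in>layer \<xi> - plain ` topspace C. \<forall>n<m. w n = plain x n"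
    by (intro bexI[of _ ?w] DiffI)
qed

lemma near_above_iff:
  assumes x: "x \<in> topspace C"
  shows "(\<forall>m. \<exists>y\<in>above \<xi>. \<forall>n<m. y n = x n) \<longleftrightarrow> \<xi> < r x"
proof
  assume near: "\<forall>m. \<exists>y\<in>above \<xi>. \<forall>n<m. y n = x n"
  show "\<xi> < r x"
  proof (rule ccontr)
    assume "\<not> \<xi> < r x"
    let ?U = "topspace C - {y \<in> topspace C. osuc \<xi> \<le> r y}"
    have "openin C ?U"
      using usc by (auto simp: usc_def)
    then obtain V where V: "openin seq_space V" "?U = V \<inter> topspace C"
      by (subst (asm) C_eq) (auto simp: openin_subtopology)
    moreover have "x \<in> ?U"
      using x \<open>\<not> \<xi> < r x\<close> by (simp add: osuc_le_iff)
    ultimately have "x \<in> V"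
      by blast
    then obtain m where m: "\<forall>y. (\<forall>n<m. y n = x n) \<longrightarrow> y \<in> V"
      using V(1) unfolding openin_seq_space by blast
    obtain y where "y \<in> above \<xi>" "\<forall>n<m. y n = x n"
      using near by blast
    then have "y \<in> ?U" "y \<in> above \<xi>"
      using m V(2) by (auto simp: above_def)
    then show False
      by (simp add: above_def osuc_le_iff)
  qed
qed (use x in \<open>auto simp: above_def\<close>)

lemma layer_eq_plain: "above \<xi> = {} \<Longrightarrow> layer \<xi> = plain ` topspace C"
proof
  assume e: "above \<xi> = {}"
  show "layer \<xi> \<subseteq> plain ` topspace C"
  proof
    fix w assume w: "w \<in> layer \<xi>"
    show "w \<in> plain ` topspace C"
    proof (rule ccontr)
      assume "w \<notin> plain ` topspace C"
      then obtain p where p: "snd (w p)"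
        using layer_cases[OF w] by blast
      have "w \<in> S"
        using w by (simp add: layer_def)
      then obtain q y where "snd (w q)" "y \<in> topspace C" "e q < r y"
        using first_position[of w p] p by metis
      then have "y \<in> above \<xi>"
        using w by (auto simp: above_def layer_def intro: le_less_trans)
      then show False
        using e by simp
    qed
  qed
qed (rule plain_subset_layer)

text \<open>A point of rank above \<open>\<xi>\<close> permits a sequence with a single mark of
  value \<open>\<xi>\<close>, which is lost in the next layer; without such points the layers
  contain no marked sequences at all.\<close>

lemma layer_eq_layer_osuc_iff: "layer \<xi> = layer (osuc \<xi>) \<longleftrightarrow> above \<xi> = {}"
proof
  assume eq: "layer \<xi> = layer (osuc \<xi>)"
  show "above \<xi> = {}"
  proof (rule ccontr)
    assume "above \<xi> \<noteq> {}"
    then obtain y where y: "y \<in> topspace C" "\<xi> < r y"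
      by (auto simp: above_def)
    then obtain k where k: "e k = \<xi>"
      using e[OF y] infinite_imp_nonempty by blast
    let ?w = "\<lambda>n. (n < k \<and> y n, n = k)"
    have "?w \<in> layer \<xi>"
      using single_position[OF y(1), of k] y k by (simp add: layer_def)
    moreover have "?w \<notin> layer (osuc \<xi>)"
      using k by (auto simp: layer_def osuc_le_iff)
    ultimately show False
      using eq by blast
  qed
next
  assume e: "above \<xi> = {}"
  then have "above (osuc \<xi>) = {}"
    using less_osuc[of \<xi>] by (auto simp: above_def dest: less_trans)
  then show "layer \<xi> = layer (osuc \<xi>)"
    using e layer_eq_plain by simp
qed

lemma nu_W: "nu W = (LEAST \<xi>. above \<xi> = {})"
  by (simp add: nu_def CB_W layer_eq_layer_osuc_iff)

lemma kernel_W: "kernel W = plain ` topspace C"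
proof -
  have "CB W (nu W) = CB W (osuc (nu W))"
    using CB_nu[OF omega_Stone_W] by (simp add: kernel_def)
  then have "above (nu W) = {}"
    by (simp add: CB_W layer_eq_layer_osuc_iff)
  then show ?thesis
    by (simp add: kernel_def CB_W layer_eq_plain)
qed

lemma rank_fun_W:
  assumes x: "x \<in> topspace C"
  shows "rank_fun W (plain x) = r x"
proof -
  have "\<xi> < rank_fun W (plain x) \<longleftrightarrow> \<xi> < r x" for \<xi>
  proof -
    have "layer \<xi> - plain ` topspace C \<subseteq> S"
      by (auto simp: layer_def)
    then have "\<xi> < rank_fun W (plain x) \<longleftrightarrow>
        (\<forall>m. \<exists>w\<in>layer \<xi> - plain ` topspace C. \<forall>n<m. w n = plain x n)"
      unfolding less_rank_fun_iff[OF omega_Stone_W] CB_W kernel_W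
      by (simp add: closure_of_W plain_in_S_iff x)
    also have "\<dots> \<longleftrightarrow> \<xi> < r x"
      unfolding nonplain_near_plain_iff by (rule near_above_iff[OF x])
    finally show ?thesis .
  qed
  then show ?thesis
    by (metis less_irrefl linorder_neqE)
qed

lemma kernel_above_W: "kernel_above W \<xi> = plain ` above \<xi>"
  by (auto simp: kernel_above_def kernel_W above_def rank_fun_W)

lemma inj_plain: "inj plain"
  by (auto simp: plain_def fun_eq_iff intro!: injI)

text \<open>This is where \<open>rho = rho_U\<close> comes from. For the converse, the level is
  closed up in the compact space \<open>seq_space\<close>. An unmarked limit is also a limit of
  plain points over \<open>above \<xi>\<close>, and these form a compact, hence closed set; so the
  closure never leaves \<open>S\<close>.\<close>

lemma compactin_closure_level_iff:
  "compactin W (W closure_of CB_level W \<xi>) \<longleftrightarrow> compactin W (kernel_above W \<xi>)"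
proof
  assume "compactin W (W closure_of CB_level W \<xi>)"
  then show "compactin W (kernel_above W \<xi>)"
    by (rule closed_compactin[OF _ kernel_above_subset_closure_level[OF omega_Stone_W]
          closedin_kernel_above[OF omega_Stone_W]])
next
  assume cpt: "compactin W (kernel_above W \<xi>)"
  have "compactin seq_space (plain ` above \<xi>)"
    using cpt unfolding kernel_above_W by (simp add: W_def compactin_subtopology)
  then have closed: "closedin seq_space (plain ` above \<xi>)"
    by (rule compactin_imp_closedin[OF omega_Stone_spaceD(3)[OF omega_Stone_seq_space]])
  let ?T = "seq_space closure_of CB_level W \<xi>"
  have lev: "CB_level W \<xi> \<subseteq> layer \<xi> - plain ` topspace C"
    using CB_level_disjoint_kernel[OF omega_Stone_W, of \<xi>] CB_level_subset[of W \<xi>]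
    by (auto simp: CB_W kernel_W)
  have levS: "CB_level W \<xi> \<subseteq> S"
    using lev by (auto simp: layer_def)
  have "?T \<subseteq> decorated (topspace C) r e"
    using levS by (intro closure_of_minimal closedin_decorated) (auto simp: S_def)
  moreover have "fst \<circ> w \<in> topspace C" if w: "w \<in> ?T" "\<forall>n. \<not> snd (w n)" for w
  proof -
    let ?x = "fst \<circ> w"
    have wx: "w = plain ?x"
      using w(2) by (simp add: plain_def fun_eq_iff prod_eq_iff)
    have lim: "\<exists>v. v \<in> CB_level W \<xi> \<and> v \<in> T'" if "w \<in> T'" "openin seq_space T'" for T'
      using w(1) that unfolding in_closure_of by blast
    have st: "\<exists>v\<in>layer \<xi> - plain ` topspace C. \<forall>n<m. v n = plain ?x n" for m
    proof -
      obtain v where v: "v \<in> CB_level W \<xi>" "\<forall>n<m. v n = w n"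
        using lim[OF _ openin_seq_space_cylinder, of m w] by auto
      show ?thesis
        unfolding wx[symmetric] using v(2) subsetD[OF lev v(1)] by (rule bexI)
    qed
    have "\<forall>m. \<exists>v\<in>layer \<xi> - plain ` topspace C. \<forall>n<m. v n = plain ?x n"
      using st by (rule allI)
    then have near: "\<forall>m. \<exists>y\<in>above \<xi>. \<forall>n<m. y n = ?x n"
      by (rule nonplain_near_plain_iff[THEN iffD1])
    have "plain ?x \<in> plain ` above \<xi>"
    proof (rule ccontr)
      assume "plain ?x \<notin> plain ` above \<xi>"
      then have nin: "plain ?x \<in> topspace seq_space - plain ` above \<xi>"
        by simp
      have "openin seq_space (topspace seq_space - plain ` above \<xi>)"
        using closed by blast
      from bspec[OF this[unfolded openin_seq_space] nin] obtain m
        where m: "\<forall>v. (\<forall>n<m. v n = plain ?x n) \<longrightarrow> v \<in> topspace seq_space - plain ` above \<xi>"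
        by (elim exE) (rule that)
      obtain y where y: "y \<in> above \<xi>" "\<forall>n<m. y n = ?x n"
        using near by blast
      then have "plain y \<in> topspace seq_space - plain ` above \<xi>"
        by (intro m[rule_format]) (simp add: plain_def)
      then show False
        using y(1) by blast
    qed
    then have "?x \<in> above \<xi>"
      using inj_plain by (simp add: inj_image_mem_iff)
    then show ?thesis
      by (simp add: above_def)
  qed
  ultimately have TS: "?T \<subseteq> S"
    by (auto simp: S_def)
  then have "W closure_of CB_level W \<xi> = ?T"
    using levS by (simp add: W_def closure_of_subtopology Int_absorb1)
  moreover have "compactin seq_space ?T"
    by (simp add: closedin_compact_space compact_space_seq_space)
  ultimately show "compactin W (W closure_of CB_level W \<xi>)"
    using TS by (simp add: W_def compactin_subtopology)
qed

lemma strongly_uniform_W: "strongly_uniform W"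
proof -
  have "kernel_above W \<xi> = {} \<longleftrightarrow> above \<xi> = {}" for \<xi>
    by (simp add: kernel_above_W)
  then show ?thesis
    by (simp add: strongly_uniform_def uniform_Stone_def nu_W lambda_eq[OF omega_Stone_W]
        rho_def rho_U_def compactin_closure_level_iff)
qed

lemma kernel_pair_W: "pair_iso (kernel_pair W) (C, r)"
proof -
  let ?g = "\<lambda>w n. fst (w n)" and ?K = "plain ` topspace C"
  have plain_eq: "plain = (\<lambda>x n. (x n, False))"
    by (simp add: plain_def fun_eq_iff)
  have cont: "continuous_map seq_space seq_space plain"
    unfolding plain_eq by (rule continuous_map_seq_space[of "\<lambda>b. (b, False)"])
  have "homeomorphic_maps (subtopology seq_space (topspace C)) (subtopology seq_space ?K) plain ?g"
    unfolding homeomorphic_maps_def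
    using cont continuous_map_seq_space[of "fst :: bool \<times> bool \<Rightarrow> bool"]
    by (auto simp: continuous_map_in_subtopology continuous_map_from_subtopology plain_def)
  moreover have "subtopology W (kernel W) = subtopology seq_space ?K"
    unfolding kernel_W using plain_in_S_iff
    by (simp add: W_def subtopology_subtopology Int_absorb1 image_subset_iff)
  ultimately have "homeomorphic_map C (subtopology W (kernel W)) plain"
    using C_eq homeomorphic_maps_imp_map by metis
  then have "pair_iso (C, r) (kernel_pair W)"
    using rank_fun_W by (auto simp: pair_iso_iff kernel_pair_def)
  then show ?thesis
    by (rule pair_iso_sym)
qed

end

lemma model_pair_realized:
  assumes p: "p \<in> model_pairs"
  shows "\<exists>W :: (nat \<Rightarrow> bool \<times> bool) topology. omega_Stone_space W \<and> topspace W \<noteq> {} \<and>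
    strongly_uniform W \<and> pair_iso (kernel_pair W) p"
proof -
  obtain C r where Cr: "p = (C, r)" "C \<in> {Cantor0, Cantor1}" "usc C r"
    using p by (auto simp: model_pairs_def)
  then have "omega_Stone_space C"
    using omega_Stone_Cantor0 omega_Stone_Cantor1 by auto
  then obtain N where N: "\<forall>x\<in>topspace C. r x \<le> N"
    using usc_bounded Cr(3) by blast
  obtain e :: "nat \<Rightarrow> omega1" where e: "\<forall>\<xi>\<le>N. infinite {k. e k = \<xi>}"
    using exists_infinite_repetition by blast
  interpret ranked_model C r e
  proof
    fix x \<xi> assume "x \<in> topspace C" "\<xi> < r x"
    then show "infinite {k. e k = \<xi>}"
      using N e by (meson less_imp_le order_trans)
  qed (use Cr in auto)
  have "(\<lambda>_. True) \<in> topspace C"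
    using Cr(2) by (auto simp: fun_eq_iff)
  then have "topspace W \<noteq> {}"
    using plain_in_S_iff by auto
  then show ?thesis
    using omega_Stone_W strongly_uniform_W kernel_pair_W Cr(1) by blast
qed

subsection \<open>The classification\<close>

lemma transport_topology:
  fixes W :: "'a topology" and h :: "'a \<Rightarrow> 'b"
  assumes h: "inj h"
  shows "\<exists>X. homeomorphic_map W X h"
proof -
  let ?X = "pullback_topology (range h) (inv h) W"
  have inv: "inv h (h x) = x" for x
    using h by simp
  have "continuous_map W ?X h"
    using inv by (intro continuous_map_pullback') (auto simp: comp_def)
  moreover have "continuous_map ?X W (inv h)"
    using continuous_map_pullback[of W W id "range h" "inv h"] by simp
  ultimately have "homeomorphic_maps W ?X h (inv h)"
    using inv h by (auto simp: homeomorphic_maps_def topspace_pullback_topology)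
  then show ?thesis
    using homeomorphic_maps_imp_map by blast
qed

text \<open>The two Boolean components are interleaved into one set of naturals, on even and odd
  places, and such sets are equinumerous with the reals.\<close>

lemma exists_inj_from_sequences:
  assumes "\<exists>f :: real \<Rightarrow> 'u. inj f"
  shows "\<exists>h :: (nat \<Rightarrow> bool \<times> bool) \<Rightarrow> 'u. inj h"
proof -
  obtain f :: "real \<Rightarrow> 'u" where f: "inj f"
    using assms by blast
  obtain g :: "nat set \<Rightarrow> real" where "bij_betw g UNIV UNIV"
    using nat_sets_eqpoll_reals by (auto simp: eqpoll_def)
  then have g: "inj g"
    by (rule bij_betw_imp_inj_on)
  let ?c = "\<lambda>w. {2 * n | n. fst (w n)} \<union> {Suc (2 * n) | n. snd (w n)}"
  have c: "2 * n \<in> ?c w \<longleftrightarrow> fst (w n)" "Suc (2 * n) \<in> ?c w \<longleftrightarrow> snd (w n)"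
    for w :: "nat \<Rightarrow> bool \<times> bool" and n
    by (auto, presburger+)
  have "inj ?c"
  proof (rule injI)
    fix v w :: "nat \<Rightarrow> bool \<times> bool" assume eq: "?c v = ?c w"
    have "v n = w n" for n
      using c[of n v] c[of n w] unfolding eq by (simp add: prod_eq_iff)
    then show "v = w"
      by blast
  qed
  then have "inj (f \<circ> g \<circ> ?c)"
    using f g by (intro inj_compose)
  then show ?thesis
    by blast
qed

lemma strongly_uniform_homeomorphic_iff:
  assumes "W \<in> strongly_uniform_spaces" "X \<in> strongly_uniform_spaces"
  shows "W homeomorphic_space X \<longleftrightarrow> pair_iso (kernel_pair W) (kernel_pair X)"
proof
  show "W homeomorphic_space X \<Longrightarrow> pair_iso (kernel_pair W) (kernel_pair X)"
    using kernel_pair_image by (auto simp: homeomorphic_space)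
  show "pair_iso (kernel_pair W) (kernel_pair X) \<Longrightarrow> W homeomorphic_space X"
    using assms by (intro strongly_uniform_homeomorphic) (auto simp: strongly_uniform_spaces_def)
qed

lemma kernel_class_eq_Image:
  assumes "p \<in> model_pairs" "pair_iso (kernel_pair W) p"
  shows "kernel_class W = model_pairs_rel `` {p}"
proof -
  have "pair_iso (kernel_pair W) q \<longleftrightarrow> pair_iso p q" for q
    using assms(2) pair_iso_trans pair_iso_sym by metis
  then show ?thesis
    using assms(1) by (auto simp: kernel_class_def model_pairs_rel_def)
qed

lemma kernel_class_eq_iff:
  assumes W: "W \<in> strongly_uniform_spaces" and X: "X \<in> strongly_uniform_spaces"
  shows "kernel_class W = kernel_class X \<longleftrightarrow> W homeomorphic_space X"
proof -
  obtain p where p: "p \<in> model_pairs" "pair_iso (kernel_pair W) p"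
    using kernel_pair_model[of W] W by (auto simp: strongly_uniform_spaces_def)
  have "kernel_class W = kernel_class X \<longleftrightarrow> pair_iso (kernel_pair W) (kernel_pair X)"
  proof
    assume "kernel_class W = kernel_class X"
    then have "pair_iso (kernel_pair X) p"
      using p by (auto simp: kernel_class_def)
    then show "pair_iso (kernel_pair W) (kernel_pair X)"
      using p(2) pair_iso_trans pair_iso_sym by metis
  next
    assume iso: "pair_iso (kernel_pair W) (kernel_pair X)"
    have "pair_iso (kernel_pair W) q \<longleftrightarrow> pair_iso (kernel_pair X) q" for q :: "(nat \<Rightarrow> bool) topology \<times> _"
      using iso pair_iso_trans pair_iso_sym by metis
    then show "kernel_class W = kernel_class X"
      by (simp add: kernel_class_def)
  qed
  then show ?thesis
    using strongly_uniform_homeomorphic_iff[OF W X] by simp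
qed

lemma equiv_homeo_rel: "equiv (strongly_uniform_spaces :: 'a topology set) homeo_rel"
proof (rule equivI)
  let ?r = "homeo_rel :: ('a topology \<times> 'a topology) set"
  show "?r \<subseteq> strongly_uniform_spaces \<times> strongly_uniform_spaces"
    by (auto simp: homeo_rel_def)
  show "refl_on strongly_uniform_spaces ?r"
    by (auto simp: homeo_rel_def refl_on_def homeomorphic_space_refl)
  show "sym ?r"
  proof (rule symI)
    fix U V :: "'a topology" assume "(U, V) \<in> homeo_rel"
    then show "(V, U) \<in> homeo_rel"
      using homeomorphic_space_sym[of U V] by (simp add: homeo_rel_def)
  qed
  show "trans ?r"
  proof (rule transI)
    fix U V W :: "'a topology" assume "(U, V) \<in> homeo_rel" "(V, W) \<in> homeo_rel"
    then show "(U, W) \<in> homeo_rel"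
      using homeomorphic_space_trans[of U V W] by (simp add: homeo_rel_def)
  qed
qed

lemma kernel_class_respects: "kernel_class respects homeo_rel"
  by (rule congruentI) (auto simp: homeo_rel_def kernel_class_eq_iff)

lemma model_pair_realized_in:
  assumes u: "\<exists>f :: real \<Rightarrow> 'u. inj f" and p: "p \<in> model_pairs"
  shows "\<exists>X \<in> (strongly_uniform_spaces :: 'u topology set). pair_iso (kernel_pair X) p"
proof -
  obtain V :: "(nat \<Rightarrow> bool \<times> bool) topology" where V: "omega_Stone_space V" "topspace V \<noteq> {}"
      "strongly_uniform V" "pair_iso (kernel_pair V) p"
    using model_pair_realized[OF p] by blast
  obtain h :: "(nat \<Rightarrow> bool \<times> bool) \<Rightarrow> 'u" where "inj h"
    using exists_inj_from_sequences[OF u] by blast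
  then obtain X where X: "homeomorphic_map V X h"
    using transport_topology by blast
  have "omega_Stone_space X"
    using V(1) homeomorphic_omega_Stone_space homeomorphic_map_imp_homeomorphic_space[OF X] by blast
  moreover have "topspace X \<noteq> {}"
    using V(2) homeomorphic_imp_surjective_map[OF X] by auto
  moreover have "strongly_uniform X"
    using V(3) strongly_uniform_image[OF X] by blast
  moreover have "pair_iso (kernel_pair X) p"
    by (rule pair_iso_trans[OF pair_iso_sym[OF kernel_pair_image[OF X]] V(4)])
  ultimately show ?thesis
    by (auto simp: strongly_uniform_spaces_def)
qed

theorem theorem7:
  fixes W :: "'a topology" and X :: "'b topology"
  shows "(omega_Stone_space W \<and> strongly_uniform W \<and>
          omega_Stone_space X \<and> strongly_uniform X \<and>
          pair_iso (kernel_pair X) (kernel_pair W) \<longrightarrow> X homeomorphic_space W) \<and>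
         ((\<exists>f :: real \<Rightarrow> 'u. inj f) \<longrightarrow>
          (kernel_class :: 'u topology \<Rightarrow> _) respects homeo_rel \<and>
          bij_betw (\<lambda>C. \<Union>V\<in>C. kernel_class V)
            ((strongly_uniform_spaces :: 'u topology set) // homeo_rel)
            (model_pairs // model_pairs_rel))"
proof (intro conjI impI)
  show "X homeomorphic_space W"
    if "omega_Stone_space W \<and> strongly_uniform W \<and> omega_Stone_space X \<and> strongly_uniform X \<and>
      pair_iso (kernel_pair X) (kernel_pair W)"
    using that by (intro strongly_uniform_homeomorphic) auto
  show "(kernel_class :: 'u topology \<Rightarrow> _) respects homeo_rel"
    by (rule kernel_class_respects)
  assume u: "\<exists>f :: real \<Rightarrow> 'u. inj f"
  let ?S = "strongly_uniform_spaces :: 'u topology set"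
  let ?F = "\<lambda>C. \<Union>V\<in>C. kernel_class (V :: 'u topology)"
  have F: "?F (homeo_rel `` {V}) = kernel_class V" if "V \<in> ?S" for V
    using UN_equiv_class[OF equiv_homeo_rel kernel_class_respects that] .
  show "bij_betw ?F (?S // homeo_rel) (model_pairs // model_pairs_rel)"
  proof (rule bij_betwI')
    fix C D assume "C \<in> ?S // homeo_rel" "D \<in> ?S // homeo_rel"
    then obtain V V' where V: "V \<in> ?S" "C = homeo_rel `` {V}" and V': "V' \<in> ?S" "D = homeo_rel `` {V'}"
      by (auto elim!: quotientE)
    have "C = D \<longleftrightarrow> V homeomorphic_space V'"
      using eq_equiv_class_iff[OF equiv_homeo_rel V(1) V'(1)] V V' by (simp add: homeo_rel_def)
    then show "?F C = ?F D \<longleftrightarrow> C = D"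
      using kernel_class_eq_iff[OF V(1) V'(1)] F[OF V(1)] F[OF V'(1)] V(2) V'(2) by simp
  next
    fix C assume "C \<in> ?S // homeo_rel"
    then obtain V where V: "V \<in> ?S" "C = homeo_rel `` {V}"
      by (auto elim!: quotientE)
    then obtain p where p: "p \<in> model_pairs" "pair_iso (kernel_pair V) p"
      using kernel_pair_model[of V] by (auto simp: strongly_uniform_spaces_def)
    then have "?F C = model_pairs_rel `` {p}"
      using F[OF V(1)] V(2) kernel_class_eq_Image[OF p] by simp
    then show "?F C \<in> model_pairs // model_pairs_rel"
      using p(1) by (simp add: quotientI)
  next
    fix P assume "P \<in> model_pairs // model_pairs_rel"
    then obtain p where p: "p \<in> model_pairs" "P = model_pairs_rel `` {p}"
      by (auto elim!: quotientE)
    obtain V where V: "V \<in> ?S" "pair_iso (kernel_pair V) p"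
      using model_pair_realized_in[OF u p(1)] by blast
    then have "P = ?F (homeo_rel `` {V})"
      using F[OF V(1)] kernel_class_eq_Image[OF p(1) V(2)] p(2) by simp
    then show "\<exists>C\<in>?S // homeo_rel. P = ?F C"
      using V(1) by (blast intro: quotientI)
  qed
qed

end
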